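(* Let $\gamma$ be a positive integer. Consider the ARX system described in the context and suppose that Assumption A (with this $\gamma$), Assumption B and Assumption C of the context hold. Let $\hat\theta_k$ be the recursive least-squares (RLS) estimates, $\tilde\theta_k=\hat\theta_k-\theta$, and let $\sigma_{\mathrm{CR}}(k)=\delta_d^2\left(\sum_{l=1}^k\mathbb{E}[\phi_l\phi_l^T]\right)^{-1}$ be the Cramér–Rao lower bound. (i) If $\gamma\ge2$, then $\hat\theta_k$ is an asymptotically efficient estimate of $\theta$ in the distribution sense, i.e. $$\sqrt{k}\,\tilde\theta_k\xrightarrow{d}\mathcal{N}\left(0,\ \delta_d^2\left(\bar{\mathbb{E}}[\phi_k\phi_k^T]\right)^{-1}\right)\quad\text{as }k\to\infty,$$ where $\xrightarrow{d}$ denotes convergence in distribution, and $$\delta_d^2\left(\bar{\mathbb{E}}[\phi_k\phi_k^T]\right)^{-1}=\lim_{k\to\infty}k\,\sigma_{\mathrm{CR}}(k).$$ (ii) If $\gamma>4$, then $\hat\theta_k$ is an asymptotically efficient estimate of $\theta$ in the covariance sense, i.e. $$\lim_{k\to\infty}k\left(\mathbb{E}[\tilde\theta_k\tilde\theta_k^T]-\sigma_{\mathrm{CR}}(k)\right)=0.$$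
   Context: **System.** Let $m,n$ be the orders of the system. The ARX system is $$y_k+a_1y_{k-1}+\cdots+a_my_{k-m}=b_1u_{k-1}+\cdots+b_nu_{k-n}+d_k,\qquad k\ge1,$$ i.e. $A(z)y_k=B(z)u_k+d_k$ with $z$ the unit backward shift ($zy_k=y_{k-1}$), $A(z)=1+a_1z+\cdots+a_mz^m$, $B(z)=b_1z+\cdots+b_nz^n$. Here $u_k\in\mathbb{R}$ is the input, $y_k\in\mathbb{R}$ the output, $d_k\in\mathbb{R}$ the unmeasurable noise, and $y_k=0$ for $k\le0$, $u_k=0$ for $k<0$. The unknown parameter is $\theta=[a_1,\dots,a_m,b_1,\dots,b_n]^T\in\mathbb{R}^{m+n}$ and the regression vector is $\phi_k=[-y_{k-1},\dots,-y_{k-m},u_{k-1},\dots,u_{k-n}]^T$, $k\ge1$. **RLS algorithm.** Given a (deterministic) initial value $\hat\theta_0\in\mathbb{R}^{m+n}$ and a symmetric positive definite matrix $P_0\in\mathbb{R}^{(m+n)\times(m+n)}$, for $k\ge1$: $$\hat\theta_k=\hat\theta_{k-1}+\alpha_kP_{k-1}\phi_k(y_k-\phi_k^T\hat\theta_{k-1}),\quad \alpha_k=(1+\phi_k^TP_{k-1}\phi_k)^{-1},\quad P_k=P_{k-1}-\alpha_kP_{k-1}\phi_k\phi_k^TP_{k-1}.$$ **Averaged expectation.** For a process $\{t_k\}$, $\bar{\mathbb{E}}[t_k]=\lim_{k\to\infty}\frac1k\sum_{l=1}^k\mathbb{E}[t_l]$ (entrywise for matrices). **Quasi-stationarity.**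 A real process $\{t_k\}$ is quasi-stationary if for some constant $C>0$, $\sup_k|\mathbb{E}[t_k]|<C$, $\sup_{i,j}|\mathbb{E}[t_it_j]|<C$, and $R^t_\tau=\bar{\mathbb{E}}[t_kt_{k-\tau}]$ exists for every $\tau\in\mathbb{Z}$. **Assumption A (with parameter $\gamma$).** There are a bounded deterministic sequence $\{r_k\}_{k\ge0}$ and a sequence $\{e_k\}_{k\ge0}$ of independent random variables with zero mean, variance $\delta_e^2$ and $\sup_k\mathbb{E}[|e_k|^{4\gamma}]<\infty$ (with $r_k=e_k=0$ for $k<0$), and deterministic real filters $f_i^{(j)}(k)$, $j=1,2,3,4$, such that $$y_k=\sum_{i=1}^\infty f_i^{(1)}(k)r_{k-i}+\sum_{i=0}^\infty f_i^{(2)}(k)e_{k-i}\ (k\ge1),\qquad u_k=\sum_{i=0}^\infty f_i^{(3)}(k)r_{k-i}+\sum_{i=0}^\infty f_i^{(4)}(k)e_{k-i}\ (k\ge0),$$ and: (i) (uniform stability) there is a sequence $\{f_i\}_{i\ge0}$ with $\sup_{k,j}|f_i^{(j)}(k)|\le|f_i|$ for all $i$ and $\sum_i|f_i|<\infty$; (ii) (joint quasi-stationarity) $\{y_k\}_{k\ge1}$ and $\{u_k\}_{k\ge0}$ are quasi-stationary, and $R^{yu}_\tau=\bar{\mathbb{E}}[y_ku_{k-\tau}]$ exists for every $\tau\in\mathbb{Z}$; (iii) (persistent excitation) the matrix $\bar{\mathbb{E}}[\phi_k\phi_k^T]$ (whose entries are, up to sign, values of the covariance functions $R^y,R^u$ and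 the cross-covariance function of $y$ and $u$) is positive definite. **Assumption B.** $A$ is stable: the filter $1/A$ has no poles on or outside the unit circle in the forward-shift variable $q=z^{-1}$; equivalently $A(z)\ne0$ for all complex $z$ with $|z|\le1$. **Assumption C.** $\{d_k\}_{k\ge1}$ is a sequence of independent Gaussian random variables with zero mean and variance $\delta_d^2$. **Cramér–Rao bound.** $\sigma_{\mathrm{CR}}(k)$ is given by the explicit formula in the claim, considered for those $k$ (all sufficiently large ones) for which $\sum_{l=1}^k\mathbb{E}[\phi_l\phi_l^T]$ is invertible. $\mathcal{N}(0,\Sigma)$ is the Gaussian distribution with mean $0$ and covariance $\Sigma$.
   Formalization: Added assumption: for each k ≥ 1 the noise d_k is independent of all y_j, u_j with j < k. Without it the claim fails: for m=n=1, b_1=0, e_k iid N(0,1), u_k=e_k, d_k=e_{k-1}, the RLS estimate of b_1 tends to 1, not 0. *)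

theory Defs
  imports "HOL-Probability.Probability"
begin

section \<open>Signals and averaged expectations\<close>

text \<open>
  Scalar signals are two-sided random processes of type \<open>int \<Rightarrow> 'w \<Rightarrow> real\<close> (time first), so that
  a lag \<open>k - i\<close> is meaningful for every \<open>k\<close> and \<open>i\<close>; initial conditions say that
  they vanish at early times.
\<close>

definition mean_avg ::
  "'w measure \<Rightarrow> (int \<Rightarrow> 'w \<Rightarrow> 'b::{banach,second_countable_topology}) \<Rightarrow> nat \<Rightarrow> 'b" where
  "mean_avg M t k = (1 / real k) *\<^sub>R (\<Sum>l=1..k. \<integral>\<omega>. t (int l) \<omega> \<partial>M)"

definition Ebar_exists ::
  "'w measure \<Rightarrow> (int \<Rightarrow> 'w \<Rightarrow> 'b::{banach,second_countable_topology}) \<Rightarrow> bool" where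
  "Ebar_exists M t \<longleftrightarrow> convergent (mean_avg M t)"

text \<open>
  At matrix type, the Bochner integral and the limit are entrywise.
\<close>

definition Ebar ::
  "'w measure \<Rightarrow> (int \<Rightarrow> 'w \<Rightarrow> 'b::{banach,second_countable_topology}) \<Rightarrow> 'b" where
  "Ebar M t = lim (mean_avg M t)"

text \<open>
  The next definition is meant for a process that is put to \<open>0\<close> before its first time index, so that
  the bounds over all integers are those over the actual index set.
\<close>

definition quasi_stationary :: "'w measure \<Rightarrow> (int \<Rightarrow> 'w \<Rightarrow> real) \<Rightarrow> bool" where
  "quasi_stationary M t \<longleftrightarrow>
     (\<exists>C>0. (\<forall>k. integrable M (t k) \<and> \<bar>\<integral>\<omega>. t k \<omega> \<partial>M\<bar> < C) \<and>
            (\<forall>i j. integrable M (\<lambda>\<omega>. t i \<omega> * t j \<omega>) \<and> \<bar>\<integral>\<omega>. t i \<omega> * t j \<omega> \<partial>M\<bar> < C)) \<and>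
     (\<forall>\<tau>. Ebar_exists M (\<lambda>k \<omega>. t k \<omega> * t (k - \<tau>) \<omega>))"


section \<open>Vectors, matrices, Gaussian laws and convergence in distribution\<close>

definition outer :: "real^'p \<Rightarrow> real^'p \<Rightarrow> real^'p^'p" where
  "outer x y = (\<chi> i j. x $ i * y $ j)"

definition pos_def :: "real^'p^'p \<Rightarrow> bool" where
  "pos_def A \<longleftrightarrow> transpose A = A \<and> (\<forall>x. x \<noteq> 0 \<longrightarrow> x \<bullet> (A *v x) > 0)"

text \<open>The second argument is the variance; variance \<open>0\<close> gives a point mass.\<close>

definition gaussian_law :: "real \<Rightarrow> real \<Rightarrow> real measure" where
  "gaussian_law \<mu> v = (if v = 0 then return borel \<mu> else density lborel (normal_density \<mu> (sqrt v)))"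

text \<open>
  \<open>N\<close> is the Gaussian law with mean \<open>\<mu>\<close> and covariance \<open>\<Sigma>\<close>: every linear functional
  has the corresponding one-dimensional Gaussian law. This determines \<open>N\<close> uniquely and also covers
  singular \<open>\<Sigma>\<close>.
\<close>

definition is_gaussian_law :: "(real^'p) measure \<Rightarrow> real^'p \<Rightarrow> real^'p^'p \<Rightarrow> bool" where
  "is_gaussian_law N \<mu> \<Sigma> \<longleftrightarrow>
     sets N = sets borel \<and>
     (\<forall>v. distr N borel (\<lambda>x. v \<bullet> x) = gaussian_law (v \<bullet> \<mu>) (v \<bullet> (\<Sigma> *v v)))"

definition converges_in_distribution ::
  "'w measure \<Rightarrow> (nat \<Rightarrow> 'w \<Rightarrow> 'b::topological_space) \<Rightarrow> 'b measure \<Rightarrow> bool" where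
  "converges_in_distribution M X N \<longleftrightarrow>
     (\<forall>k. X k \<in> borel_measurable M) \<and> prob_space N \<and> sets N = sets borel \<and>
     (\<forall>g :: 'b \<Rightarrow> real. continuous_on UNIV g \<and> bounded (range g) \<longrightarrow>
        (\<lambda>k. \<integral>\<omega>. g (X k \<omega>) \<partial>M) \<longlonglongrightarrow> (\<integral>x. g x \<partial>N))"


section \<open>The ARX system\<close>

text \<open>
  Vectors of length \<open>m + n\<close> have type \<open>real^'p\<close>, where a bijection \<open>ix\<close> from \<open>'p\<close> onto
  \<open>{1..m+n}\<close> gives the position of each coordinate.
\<close>

definition arx_param ::
  "('p::finite \<Rightarrow> nat) \<Rightarrow> nat \<Rightarrow> (nat \<Rightarrow> real) \<Rightarrow> (nat \<Rightarrow> real) \<Rightarrow> real^'p" where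
  "arx_param ix m a b = (\<chi> p. if ix p \<le> m then a (ix p) else b (ix p - m))"

definition arx_regressor ::
  "('p::finite \<Rightarrow> nat) \<Rightarrow> nat \<Rightarrow> (int \<Rightarrow> 'w \<Rightarrow> real) \<Rightarrow> (int \<Rightarrow> 'w \<Rightarrow> real) \<Rightarrow> int \<Rightarrow> 'w \<Rightarrow> real^'p" where
  "arx_regressor ix m y u k \<omega> =
     (\<chi> p. if ix p \<le> m then - y (k - int (ix p)) \<omega> else u (k - int (ix p - m)) \<omega>)"

definition arx_system ::
  "'w measure \<Rightarrow> nat \<Rightarrow> nat \<Rightarrow> (nat \<Rightarrow> real) \<Rightarrow> (nat \<Rightarrow> real) \<Rightarrow>
   (int \<Rightarrow> 'w \<Rightarrow> real) \<Rightarrow> (int \<Rightarrow> 'w \<Rightarrow> real) \<Rightarrow> (int \<Rightarrow> 'w \<Rightarrow> real) \<Rightarrow> bool" where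
  "arx_system M m n a b y u d \<longleftrightarrow>
     (\<forall>\<omega>\<in>space M.
        (\<forall>k\<le>0. y k \<omega> = 0) \<and> (\<forall>k<0. u k \<omega> = 0) \<and>
        (\<forall>k\<ge>1. y k \<omega> + (\<Sum>i=1..m. a i * y (k - int i) \<omega>) =
                 (\<Sum>i=1..n. b i * u (k - int i) \<omega>) + d k \<omega>))"

definition arx_A :: "nat \<Rightarrow> (nat \<Rightarrow> real) \<Rightarrow> complex \<Rightarrow> complex" where
  "arx_A m a z = 1 + (\<Sum>i=1..m. complex_of_real (a i) * z ^ i)"

definition stable_A :: "nat \<Rightarrow> (nat \<Rightarrow> real) \<Rightarrow> bool" where
  "stable_A m a \<longleftrightarrow> (\<forall>z. norm z \<le> 1 \<longrightarrow> arx_A m a z \<noteq> 0)"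

text \<open>
  Here \<open>f j k i\<close> stands for $f_i^{(j)}(k)$. The series over \<open>i\<close> have only finitely many nonzero
  terms, as \<open>r\<close> and \<open>e\<close> vanish at negative times.
\<close>

definition filtered_data_assumption ::
  "'w measure \<Rightarrow> nat \<Rightarrow> (int \<Rightarrow> 'w \<Rightarrow> real) \<Rightarrow> (int \<Rightarrow> 'w \<Rightarrow> real) \<Rightarrow> (int \<Rightarrow> 'w \<Rightarrow> real^'p) \<Rightarrow> bool" where
  "filtered_data_assumption M \<gamma> y u \<phi> \<longleftrightarrow>
     (\<exists>(r :: int \<Rightarrow> real) (e :: int \<Rightarrow> 'w \<Rightarrow> real) (\<delta>e :: real)
       (f :: nat \<Rightarrow> int \<Rightarrow> nat \<Rightarrow> real) (h :: nat \<Rightarrow> real).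
        bounded (range r) \<and> (\<forall>k<0. r k = 0) \<and>
        (\<forall>k<0. \<forall>\<omega>\<in>space M. e k \<omega> = 0) \<and>
        prob_space.indep_vars M (\<lambda>_. borel) e {0..} \<and>
        (\<forall>k\<ge>0. prob_space.expectation M (e k) = 0 \<and> prob_space.variance M (e k) = \<delta>e\<^sup>2) \<and>
        (\<exists>C. \<forall>k\<ge>0. integrable M (\<lambda>\<omega>. \<bar>e k \<omega>\<bar> ^ (4 * \<gamma>)) \<and>
                    (\<integral>\<omega>. \<bar>e k \<omega>\<bar> ^ (4 * \<gamma>) \<partial>M) \<le> C) \<and>
        (\<forall>k\<ge>1. \<forall>\<omega>\<in>space M. y k \<omega> =
            (\<Sum>i. f 1 k (Suc i) * r (k - int (Suc i))) + (\<Sum>i. f 2 k i * e (k - int i) \<omega>)) \<and>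
        (\<forall>k\<ge>0. \<forall>\<omega>\<in>space M. u k \<omega> =
            (\<Sum>i. f 3 k i * r (k - int i)) + (\<Sum>i. f 4 k i * e (k - int i) \<omega>)) \<and>
        (\<forall>j\<in>{1..4}. \<forall>k\<ge>0. \<forall>i. \<bar>f j k i\<bar> \<le> \<bar>h i\<bar>) \<and> summable (\<lambda>i. \<bar>h i\<bar>)) \<and>
     quasi_stationary M y \<and> quasi_stationary M u \<and>
     (\<forall>\<tau>. Ebar_exists M (\<lambda>k \<omega>. y k \<omega> * u (k - \<tau>) \<omega>)) \<and>
     pos_def (Ebar M (\<lambda>k \<omega>. outer (\<phi> k \<omega>) (\<phi> k \<omega>)))"

definition gaussian_noise :: "'w measure \<Rightarrow> (int \<Rightarrow> 'w \<Rightarrow> real) \<Rightarrow> real \<Rightarrow> bool" where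
  "gaussian_noise M d \<delta>d \<longleftrightarrow>
     prob_space.indep_vars M (\<lambda>_. borel) d {1..} \<and>
     (\<forall>k\<ge>1. distr M borel (d k) = gaussian_law 0 (\<delta>d\<^sup>2))"

text \<open>
  The noise at time \<open>k\<close> is independent of the inputs and outputs before \<open>k\<close>. This
  usual convention for an ARX equation error is not a consequence of the other
  hypotheses, and least squares is inconsistent without it: for orders
  \<open>m = n = 1\<close> and \<open>b\<^sub>1 = 0\<close>, take standard Gaussian independent \<open>e\<^sub>k\<close> with
  \<open>u\<^sub>k = e\<^sub>k\<close> and \<open>d\<^sub>k = e\<^bsub>k-1\<^esub>\<close>; then the estimate of \<open>b\<^sub>1\<close> tends to \<open>1\<close>.
\<close>

definition noise_indep_of_past ::
  "'w measure \<Rightarrow> (int \<Rightarrow> 'w \<Rightarrow> real) \<Rightarrow> (int \<Rightarrow> 'w \<Rightarrow> real) \<Rightarrow> (int \<Rightarrow> 'w \<Rightarrow> real) \<Rightarrow> bool" where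
  "noise_indep_of_past M d y u \<longleftrightarrow>
     (\<forall>k\<ge>1. prob_space.indep_set M
        {d k -` S \<inter> space M | S. S \<in> sets borel}
        (sigma_sets (space M)
           ({y j -` S \<inter> space M | j S. j < k \<and> S \<in> sets borel} \<union>
            {u j -` S \<inter> space M | j S. j < k \<and> S \<in> sets borel})))"


section \<open>Recursive least squares\<close>

definition rls_gain :: "real^'p^'p \<Rightarrow> real^'p \<Rightarrow> real" where
  "rls_gain P x = inverse (1 + x \<bullet> (P *v x))"

primrec rls_P :: "(nat \<Rightarrow> real^'p) \<Rightarrow> real^'p^'p \<Rightarrow> nat \<Rightarrow> real^'p^'p" where
  "rls_P x P0 0 = P0"
| "rls_P x P0 (Suc k) =
     (let P = rls_P x P0 k
      in P - rls_gain P (x (Suc k)) *\<^sub>R (P ** outer (x (Suc k)) (x (Suc k)) ** P))"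

primrec rls_estimate ::
  "(nat \<Rightarrow> real^'p) \<Rightarrow> (nat \<Rightarrow> real) \<Rightarrow> real^'p \<Rightarrow> real^'p^'p \<Rightarrow> nat \<Rightarrow> real^'p" where
  "rls_estimate x z \<theta>0 P0 0 = \<theta>0"
| "rls_estimate x z \<theta>0 P0 (Suc k) =
     (let \<theta>' = rls_estimate x z \<theta>0 P0 k; P = rls_P x P0 k
      in \<theta>' + (rls_gain P (x (Suc k)) * (z (Suc k) - x (Suc k) \<bullet> \<theta>')) *\<^sub>R (P *v x (Suc k)))"

text \<open>
  The Cramer-Rao bound; meaningful for those \<open>k\<close> for which the summed matrix is invertible.
\<close>

definition sigma_CR :: "'w measure \<Rightarrow> (int \<Rightarrow> 'w \<Rightarrow> real^'p) \<Rightarrow> real \<Rightarrow> nat \<Rightarrow> real^'p^'p" where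
  "sigma_CR M \<phi> \<delta>d k =
     \<delta>d\<^sup>2 *\<^sub>R matrix_inv (\<Sum>l=1..k. \<integral>\<omega>. outer (\<phi> (int l) \<omega>) (\<phi> (int l) \<omega>) \<partial>M)"

end

theory Submission
  imports Defs "HOL-Real_Asymp.Real_Asymp"
begin

text \<open>
  Let \<open>w\<^sub>k = \<Sum>\<^bsub>l\<le>k\<^esub> d\<^sub>l \<phi>\<^sub>l\<close> be the score. The recursion for \<open>P\<^sub>k\<close> is the Sherman-Morrison formula,
  so \<open>P\<^sub>k\<close> is the inverse of \<open>P\<^sub>0\<inverse> + \<Sum>\<^bsub>l\<le>k\<^esub> \<phi>\<^sub>l \<phi>\<^sub>l\<^sup>T\<close>, and since \<open>y\<^sub>l = \<phi>\<^sub>l\<^sup>T \<theta> + d\<^sub>l\<close> the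
  estimation error is \<open>P\<^sub>k (P\<^sub>0\<inverse> (\<theta>\<^sub>0 - \<theta>) + w\<^sub>k)\<close> with the initial estimate \<open>\<theta>\<^sub>0\<close>
  (\<open>rls_error\<close>). Two facts about the data then
  decide everything: the average of \<open>\<phi>\<^sub>l \<phi>\<^sub>l\<^sup>T\<close> settles down at \<open>R\<close>, and \<open>w\<^sub>k\<close> is a martingale
  with Gaussian innovations.

  Law of large numbers. The entries of \<open>\<Sum> (\<phi>\<^sub>l \<phi>\<^sub>l\<^sup>T - E \<phi>\<^sub>l \<phi>\<^sub>l\<^sup>T)\<close> are centred quadratic forms in the
  independent \<open>e\<^sub>s\<close>, and uniform stability bounds the row and column sums of their kernels. The part
  of the form off the diagonal, together with the linear part, is a martingale \<open>\<Sum> z\<^sub>s e\<^sub>s\<close> whose coefficient \<open>z\<^sub>s\<close>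
  depends on the \<open>e\<^sub>t\<close> with \<open>t < s\<close> only; the diagonal is a weighted sum of \<open>e\<^sub>s\<^sup>2 - \<delta>\<^sub>e\<^sup>2\<close>. A martingale
  transform with bounded moments of order \<open>2q\<close> has a \<open>2q\<close>-th moment of order \<open>n\<^sup>q\<close>
  (\<open>martingale_transform_moment\<close>), so the \<open>2q\<close>-th moments of the entries are of order \<open>k\<^sup>q\<close> for
  all \<open>q \<le> \<gamma>\<close> (\<open>filtered_covariance_moment\<close>).

  Central limit theorem. If \<open>S = \<Sum> z\<^sub>s X\<^sub>s\<close> and \<open>Q = \<Sum> z\<^sub>s\<^sup>2\<close>, where each \<open>X\<^sub>s\<close> is Gaussian with variance
  \<open>v\<close> and independent of the past while \<open>z\<^sub>s\<close> belongs to the past, and if \<open>Q\<close> is bounded, then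
  \<open>exp (i S + v Q / 2)\<close> has expectation exactly one. When \<open>Q\<close> tends to a constant this is the
  convergence of the characteristic function of \<open>S\<close> (\<open>gaussian_martingale_clt\<close>). The passage from
  characteristic functions to bounded continuous test functions of a vector is
  \<open>levy_continuity_vector\<close>, whose core is a uniform approximation by trigonometric polynomials.

  Comparison. The scaled error \<open>\<surd>k P\<^sub>k (P\<^sub>0\<inverse> (\<theta>\<^sub>0 - \<theta>) + w\<^sub>k)\<close> is compared with \<open>R\<inverse> w\<^sub>k / \<surd>k\<close>, to which
  the limit theorem applies directly and whose covariance is
  \<open>\<delta>\<^sub>d\<^sup>2 R\<inverse> (E \<Sum> \<phi>\<^sub>l \<phi>\<^sub>l\<^sup>T / k) R\<inverse>\<close>. As long as \<open>P\<^sub>k\<inverse> / k\<close> is close to \<open>R\<close>, the difference is at most a multiple of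
  \<open>|P\<^sub>k\<inverse> / k - R| |w\<^sub>k| / \<surd>k\<close>, apart from a term of order \<open>1 / \<surd>k\<close>. Otherwise \<open>P\<^sub>k \<le> P\<^sub>0\<close> still bounds it by a multiple of
  \<open>\<surd>k (1 + |w\<^sub>k|)\<close>, and there one pays with a power \<open>m\<close> of the deviation of the averaged information
  matrix, which is bounded below on that event. With \<open>m = 1\<close> the difference vanishes in probability,
  which gives the convergence in distribution. With \<open>m = 5\<close> its mean square on the bad event is of order
  \<open>k \<cdot> k\<^bsup>-5/2\<^esup> \<cdot> k = k\<^bsup>-1/2\<^esup>\<close>, which gives the convergence of the covariance; the moments that this needs are
  those available for \<open>\<gamma> \<ge> 5\<close>.
\<close>

section \<open>Matrices\<close>

lemma norm_matrix_sq: "(norm (A::real^'p^'q))\<^sup>2 = (\<Sum>i\<in>UNIV. \<Sum>j\<in>UNIV. (A $ i $ j)\<^sup>2)"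
  by (simp add: norm_vec_def L2_set_def sum_nonneg)

lemma abs_entry_le_norm: "\<bar>(A::real^'p^'q) $ i $ j\<bar> \<le> norm A"
  by (metis Finite_Cartesian_Product.norm_nth_le order_trans real_norm_def)

lemma norm_matrix_vector_le: "norm ((A::real^'p^'q) *v x) \<le> norm A * norm x"
proof -
  have "norm (A *v x) = L2_set (\<lambda>i. norm ((A *v x) $ i)) UNIV"
    by (simp add: norm_vec_def)
  also have "\<dots> \<le> L2_set (\<lambda>i. norm (A $ i) * norm x) UNIV"
  proof (rule L2_set_mono)
    fix i
    have "(A *v x) $ i = A $ i \<bullet> x" by (simp add: matrix_vector_mul_component)
    then show "norm ((A *v x) $ i) \<le> norm (A $ i) * norm x"
      by (simp add: Cauchy_Schwarz_ineq2)
  qed simp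
  also have "\<dots> = norm A * norm x"
    by (simp add: norm_vec_def [of A] L2_set_left_distrib)
  finally show ?thesis .
qed

lemma norm_matrix_matrix_le: "norm ((A::real^'q^'r) ** (B::real^'p^'q)) \<le> norm A * norm B"
proof -
  have "(norm (A ** B))\<^sup>2 = (\<Sum>i\<in>UNIV. \<Sum>j\<in>UNIV. (\<Sum>k\<in>UNIV. A $ i $ k * B $ k $ j)\<^sup>2)"
    by (simp add: norm_matrix_sq matrix_matrix_mult_def)
  also have "\<dots> \<le> (\<Sum>i\<in>UNIV. \<Sum>j\<in>UNIV. (\<Sum>k\<in>UNIV. (A $ i $ k)\<^sup>2) * (\<Sum>k\<in>UNIV. (B $ k $ j)\<^sup>2))"
    by (intro sum_mono Cauchy_Schwarz_ineq_sum)
  also have "\<dots> = (\<Sum>i\<in>UNIV. \<Sum>k\<in>UNIV. (A $ i $ k)\<^sup>2) * (\<Sum>j\<in>UNIV. \<Sum>k\<in>UNIV. (B $ k $ j)\<^sup>2)"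
    by (rule sum_product[symmetric])
  also have "(\<Sum>j\<in>UNIV. \<Sum>k\<in>UNIV. (B $ k $ j)\<^sup>2) = (norm B)\<^sup>2"
    unfolding norm_matrix_sq by (rule sum.swap)
  also have "(\<Sum>i\<in>UNIV. \<Sum>k\<in>UNIV. (A $ i $ k)\<^sup>2) = (norm A)\<^sup>2"
    by (simp only: norm_matrix_sq)
  finally have "(norm (A ** B))\<^sup>2 \<le> (norm A * norm B)\<^sup>2" by (simp add: power_mult_distrib)
  then show ?thesis by (rule power2_le_imp_le) simp
qed

lemma outer_mult_vec: "outer x y *v z = (y \<bullet> z) *\<^sub>R x"
  by (simp add: vec_eq_iff outer_def matrix_vector_mult_def inner_vec_def sum_distrib_left
      sum_distrib_right mult_ac)

lemma transpose_outer: "transpose (outer x y) = outer y x"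
  by (simp add: vec_eq_iff outer_def transpose_def mult.commute)

lemma sum_matrix_vector: "(\<Sum>l\<in>I. A l) *v x = (\<Sum>l\<in>I. (A l :: real^'p^'q) *v x)"
  by (induct I rule: infinite_finite_induct) (simp_all add: matrix_vector_mult_add_rdistrib)

lemma matrix_eqI_vector: "(\<And>x. A *v x = B *v x) \<Longrightarrow> A = (B::real^'p^'q)"
  by (simp add: matrix_eq)

lemma scaleR_matrix_vector: "(c *\<^sub>R (A::real^'p^'q)) *v x = c *\<^sub>R (A *v x)"
  by (simp add: vec_eq_iff matrix_vector_mult_def sum_distrib_left mult_ac)

lemma vector_scaleR_matrix: "(A::real^'p^'q) *v (c *\<^sub>R x) = c *\<^sub>R (A *v x)"
  by (simp add: vec_eq_iff matrix_vector_mult_def sum_distrib_left mult_ac)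

lemma pos_def_inverse:
  assumes "pos_def (A::real^'p^'p)"
  shows "A ** matrix_inv A = mat 1" "matrix_inv A ** A = mat 1"
    "transpose (matrix_inv A) = matrix_inv A" "x \<bullet> (matrix_inv A *v x) \<ge> 0"
proof -
  have "\<forall>x. A *v x = 0 \<longrightarrow> x = 0"
    using assms unfolding pos_def_def by force
  then have "invertible A"
    by (metis matrix_left_invertible_ker matrix_left_right_inverse invertible_def)
  then have "\<exists>B. A ** B = mat 1 \<and> B ** A = mat 1" by (simp add: invertible_def)
  then have *: "A ** matrix_inv A = mat 1 \<and> matrix_inv A ** A = mat 1"
    unfolding matrix_inv_def by (rule someI_ex)
  show l: "A ** matrix_inv A = mat 1" and r: "matrix_inv A ** A = mat 1" using * by auto
  have "transpose (matrix_inv A) ** A = mat 1"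
    using arg_cong[OF l, of transpose] assms by (simp add: matrix_transpose_mul pos_def_def)
  then show "transpose (matrix_inv A) = matrix_inv A"
    by (metis l matrix_mul_assoc matrix_mul_lid matrix_mul_rid)
  have "x \<bullet> (matrix_inv A *v x) = (matrix_inv A *v x) \<bullet> (A *v (matrix_inv A *v x))"
    by (simp add: matrix_vector_mul_assoc l inner_commute)
  also have "\<dots> \<ge> 0"
    using assms unfolding pos_def_def by (cases "matrix_inv A *v x = 0") (auto simp: less_imp_le)
  finally show "x \<bullet> (matrix_inv A *v x) \<ge> 0" .
qed

lemma matrix_inv_eqI: "(A::real^'p^'p) ** B = mat 1 \<Longrightarrow> matrix_inv A = B"
proof -
  assume *: "A ** B = mat 1"
  then have "B ** A = mat 1" using matrix_left_right_inverse by blast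
  then have "\<exists>B. A ** B = mat 1 \<and> B ** A = mat 1" using * by blast
  then have "A ** matrix_inv A = mat 1 \<and> matrix_inv A ** A = mat 1"
    unfolding matrix_inv_def by (rule someI_ex)
  then show ?thesis by (metis * \<open>B ** A = mat 1\<close> matrix_mul_assoc matrix_mul_lid matrix_mul_rid)
qed

text \<open>
  The bound comes from the resolvent identity \<open>W - S = W (R - V) S\<close>: when \<open>V - R\<close> is small compared with
  the inverse \<open>S\<close> of \<open>R\<close>, it first bounds \<open>W\<close> itself and then the difference.
\<close>

lemma inverse_perturbation:
  fixes V W R S :: "real^'p^'p"
  assumes WV: "W ** V = mat 1" and RS: "R ** S = mat 1"
    and small: "norm (V - R) * norm S \<le> 1/2"
  shows "norm W \<le> 2 * norm S" "norm (W - S) \<le> 2 * (norm S)\<^sup>2 * norm (V - R)"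
proof -
  have "W - S = (W ** R) ** S - (W ** V) ** S"
    by (simp add: WV RS matrix_mul_assoc[symmetric])
  also have "\<dots> = W ** (R - V) ** S"
    by (simp add: vec_eq_iff matrix_matrix_mult_def sum_subtractf left_diff_distrib
        right_diff_distrib)
  finally have eq: "W - S = W ** (R - V) ** S" .
  have "norm (W - S) \<le> norm (W ** (R - V)) * norm S"
    unfolding eq by (rule norm_matrix_matrix_le)
  also have "\<dots> \<le> norm W * norm (R - V) * norm S"
    by (intro mult_right_mono norm_matrix_matrix_le) auto
  finally have b: "norm (W - S) \<le> norm W * (norm (V - R) * norm S)"
    by (simp add: norm_minus_commute mult.assoc)
  also have "\<dots> \<le> norm W * (1/2)" by (intro mult_left_mono small) auto
  finally have "norm (W - S) \<le> norm W / 2" by simp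
  moreover have "norm W \<le> norm (W - S) + norm S" by (metis norm_triangle_sub add.commute)
  ultimately show W: "norm W \<le> 2 * norm S" by linarith
  have "norm W * (norm (V - R) * norm S) \<le> 2 * norm S * (norm (V - R) * norm S)"
    by (intro mult_right_mono W) auto
  with b show "norm (W - S) \<le> 2 * (norm S)\<^sup>2 * norm (V - R)"
    by (simp add: power2_eq_square mult_ac)
qed

lemma tendsto_matrix_inverse:
  fixes V W :: "nat \<Rightarrow> real^'p^'p"
  assumes lim: "V \<longlonglongrightarrow> R" and RS: "R ** S = mat 1"
    and W: "eventually (\<lambda>k. W k ** V k = mat 1) sequentially"
  shows "W \<longlonglongrightarrow> S"
proof -
  have "(\<lambda>k. norm (V k - R)) \<longlonglongrightarrow> 0" using lim by (simp add: LIM_zero tendsto_norm_zero)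
  then have "(\<lambda>k. norm (V k - R) * norm S) \<longlonglongrightarrow> 0" and l: "(\<lambda>k. 2 * (norm S)\<^sup>2 * norm (V k - R)) \<longlonglongrightarrow> 0"
    by (auto intro: tendsto_mult_left_zero tendsto_mult_right_zero)
  then have "eventually (\<lambda>k. norm (V k - R) * norm S < 1/2) sequentially"
    by (intro order_tendstoD) auto
  with W have "eventually (\<lambda>k. norm (W k - S) \<le> 2 * (norm S)\<^sup>2 * norm (V k - R)) sequentially"
    by eventually_elim (auto intro: inverse_perturbation[OF _ RS])
  then have "(\<lambda>k. W k - S) \<longlonglongrightarrow> 0" by (rule Lim_null_comparison[OF _ l])
  then show ?thesis by (simp add: LIM_zero_iff)
qed

text \<open>
  If \<open>V x = 0\<close> then \<open>x = - S (V - R) x\<close>, which contracts once \<open>V\<close> is close to \<open>R\<close>; so the kernel is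
  trivial.
\<close>

lemma eventually_invertible_of_tendsto:
  fixes V :: "nat \<Rightarrow> real^'p^'p"
  assumes lim: "V \<longlonglongrightarrow> R" and RS: "R ** S = mat 1"
  shows "eventually (\<lambda>k. matrix_inv (V k) ** V k = mat 1 \<and> V k ** matrix_inv (V k) = mat 1) sequentially"
proof -
  have "S ** R = mat 1" using RS matrix_left_right_inverse by blast
  have "(\<lambda>k. norm (V k - R)) \<longlonglongrightarrow> 0" using lim by (simp add: LIM_zero tendsto_norm_zero)
  then have "(\<lambda>k. norm (V k - R) * norm S) \<longlonglongrightarrow> 0" by (auto intro: tendsto_mult_left_zero)
  then have "eventually (\<lambda>k. norm (V k - R) * norm S < 1/2) sequentially"
    by (intro order_tendstoD) auto
  then show ?thesis
  proof eventually_elim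
    case (elim k)
    have "x = 0" if "V k *v x = 0" for x
    proof (rule ccontr)
      assume "x \<noteq> 0"
      have "x = S *v (R *v x)" by (simp add: matrix_vector_mul_assoc \<open>S ** R = mat 1\<close>)
      also have "\<dots> = - (S *v ((V k - R) *v x))"
        using that by (simp add: matrix_vector_mult_diff_rdistrib)
          (simp add: vec_eq_iff matrix_vector_mult_def sum_negf)
      finally have "norm x = norm (S *v ((V k - R) *v x))" by (metis norm_minus_cancel)
      also have "\<dots> \<le> norm S * (norm (V k - R) * norm x)"
        by (rule order_trans[OF norm_matrix_vector_le]) (intro mult_left_mono norm_matrix_vector_le, simp)
      also have "\<dots> = (norm (V k - R) * norm S) * norm x" by simp
      also have "\<dots> < 1 * norm x" using elim \<open>x \<noteq> 0\<close> by (intro mult_strict_right_mono) auto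
      finally show False by simp
    qed
    then obtain B where "B ** V k = mat 1" by (metis matrix_left_invertible_ker)
    then show ?case by (metis matrix_inv_eqI matrix_left_right_inverse)
  qed
qed

section \<open>The recursive least squares recursion\<close>

definition information :: "real^'p^'p \<Rightarrow> (nat \<Rightarrow> real^'p) \<Rightarrow> nat \<Rightarrow> real^'p^'p" where
  "information P0 x k = matrix_inv P0 + (\<Sum>l=1..k. outer (x l) (x l))"

lemma information_Suc: "information P0 x (Suc k) = information P0 x k + outer (x (Suc k)) (x (Suc k))"
  by (simp add: information_def)

lemma information_nonneg:
  assumes "pos_def P0" shows "v \<bullet> (information P0 x k *v v) \<ge> 0"
  using pos_def_inverse(4)[OF assms]
  by (simp add: information_def matrix_vector_mult_add_rdistrib sum_matrix_vector outer_mult_vec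
      inner_add_right inner_sum_right inner_commute sum_nonneg)

text \<open>
  One step of the recursion is the Sherman-Morrison formula for adding \<open>outer x x\<close> to the inverse of \<open>P\<close>.
\<close>

lemma rls_P_step:
  fixes P Q :: "real^'p^'p" and x :: "real^'p"
  assumes PQ: "P ** Q = mat 1" and sym: "transpose P = P" and psd: "\<And>v. v \<bullet> (P *v v) \<ge> 0"
  defines "P' \<equiv> P - rls_gain P x *\<^sub>R (P ** outer x x ** P)"
  shows "P' ** (Q + outer x x) = mat 1" "transpose P' = P'"
    "v \<bullet> (P' *v v) = v \<bullet> (P *v v) - rls_gain P x * (v \<bullet> (P *v x))\<^sup>2"
    "rls_gain P x * (1 + x \<bullet> (P *v x)) = 1" "rls_gain P x \<ge> 0"
proof -
  let ?g = "rls_gain P x"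
  have pos: "1 + x \<bullet> (P *v x) > 0" using psd[of x] by linarith
  then show g: "?g * (1 + x \<bullet> (P *v x)) = 1" and gpos: "?g \<ge> 0" by (auto simp: rls_gain_def)
  have adj: "(P *v v) \<bullet> w = v \<bullet> (P *v w)" for v w
    by (metis dot_lmul_matrix matrix_vector_mul_component sym transpose_matrix_vector inner_commute)
  have P': "P' *v v = P *v v - (?g * (x \<bullet> (P *v v))) *\<^sub>R (P *v x)" for v
    by (simp add: P'_def matrix_vector_mult_diff_rdistrib scaleR_matrix_vector
        matrix_vector_mul_assoc[symmetric] outer_mult_vec vector_scaleR_matrix)
  have "(P' ** (Q + outer x x)) *v v = mat 1 *v v" for v
  proof -
    have [simp]: "P *v (Q *v v) = v" for v by (simp add: matrix_vector_mul_assoc PQ)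
    have "(P' ** (Q + outer x x)) *v v =
       v + (x \<bullet> v) *\<^sub>R (P *v x) - (?g * ((x \<bullet> v) * (1 + x \<bullet> (P *v x)))) *\<^sub>R (P *v x)"
      by (simp add: matrix_vector_mul_assoc[symmetric] P' matrix_vector_mult_add_rdistrib outer_mult_vec
        matrix_vector_right_distrib vector_scaleR_matrix inner_add_right algebra_simps)
    also have "?g * ((x \<bullet> v) * (1 + x \<bullet> (P *v x))) = x \<bullet> v"
      using g by (metis mult.left_commute mult.right_neutral)
    finally show ?thesis by simp
  qed
  then show "P' ** (Q + outer x x) = mat 1" by (rule matrix_eqI_vector)
  show "transpose P' = P'"
  proof -
    have "transpose (P ** outer x x ** P) = P ** outer x x ** P"
      by (simp add: matrix_transpose_mul sym transpose_outer matrix_mul_assoc)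
    then show ?thesis using sym unfolding P'_def by (simp add: vec_eq_iff transpose_def)
  qed
  show "v \<bullet> (P' *v v) = v \<bullet> (P *v v) - ?g * (v \<bullet> (P *v x))\<^sup>2"
  proof -
    have "x \<bullet> (P *v v) = v \<bullet> (P *v x)" by (metis adj inner_commute)
    then show ?thesis by (simp add: P' inner_diff_right power2_eq_square)
  qed
qed

text \<open>
  The matrices \<open>P\<^sub>k\<close> decrease in the order of quadratic forms, since each step subtracts a nonnegative
  multiple of a square. They stay nonnegative because their inverses are sums of nonnegative forms.
\<close>

lemma rls_P_props:
  assumes P0: "pos_def P0"
  shows "rls_P x P0 k ** information P0 x k = mat 1 \<and> transpose (rls_P x P0 k) = rls_P x P0 k \<and>
    (\<forall>v. v \<bullet> (rls_P x P0 k *v v) \<ge> 0 \<and> v \<bullet> (rls_P x P0 k *v v) \<le> v \<bullet> (P0 *v v))"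
proof (induct k)
  case 0
  have "v \<bullet> (P0 *v v) \<ge> 0" for v using P0 unfolding pos_def_def by (cases "v = 0") (auto simp: less_imp_le)
  then show ?case using P0 pos_def_inverse(1)[OF P0] by (simp add: information_def pos_def_def)
next
  case (Suc k)
  let ?P = "rls_P x P0 k" and ?P' = "rls_P x P0 (Suc k)" and ?Q' = "information P0 x (Suc k)"
  have PQ: "?P ** information P0 x k = mat 1" and Psym: "transpose ?P = ?P"
    and Pnn: "\<And>v. 0 \<le> v \<bullet> (?P *v v)" and Ple: "\<And>v. v \<bullet> (?P *v v) \<le> v \<bullet> (P0 *v v)"
    using Suc by auto
  note st = rls_P_step[OF PQ Psym Pnn, where x = "x (Suc k)"]
  have P': "?P' = ?P - rls_gain ?P (x (Suc k)) *\<^sub>R (?P ** outer (x (Suc k)) (x (Suc k)) ** ?P)"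
    by (simp add: Let_def)
  have inv: "?P' ** ?Q' = mat 1" and sym: "transpose ?P' = ?P'"
    and dec: "v \<bullet> (?P' *v v) = v \<bullet> (?P *v v) - rls_gain ?P (x (Suc k)) * (v \<bullet> (?P *v x (Suc k)))\<^sup>2"
    and g: "rls_gain ?P (x (Suc k)) \<ge> 0" for v
    unfolding information_Suc P' using st by simp_all
  have inv': "?Q' ** ?P' = mat 1" using inv matrix_left_right_inverse by blast
  have "v \<bullet> (?P' *v v) \<ge> 0" for v
  proof -
    have "v \<bullet> (?P' *v v) = (?P' *v v) \<bullet> (?Q' *v (?P' *v v))"
      by (simp only: matrix_vector_mul_assoc[of ?Q'] inv' matrix_vector_mul_lid)
        (rule inner_commute)
    then show ?thesis using information_nonneg[OF P0] by metis
  qed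
  moreover have "v \<bullet> (?P' *v v) \<le> v \<bullet> (P0 *v v)" for v
  proof -
    have "0 \<le> rls_gain ?P (x (Suc k)) * (v \<bullet> (?P *v x (Suc k)))\<^sup>2" using g by simp
    with Ple[of v] dec[of v] show ?thesis by linarith
  qed
  ultimately show ?case using inv sym by blast
qed

text \<open>
  Testing a nonnegative form with \<open>e\<^sub>i \<plusminus> e\<^sub>j\<close> bounds its entries by the diagonal ones, and these are
  monotone in the form. This makes the norms of all \<open>P\<^sub>k\<close> bounded by a constant that depends on \<open>P\<^sub>0\<close> alone.
\<close>

lemma psd_norm_le:
  fixes P :: "real^'p^'p"
  assumes sym: "transpose P = P" and "\<And>v. 0 \<le> v \<bullet> (P *v v)" "\<And>v. v \<bullet> (P *v v) \<le> v \<bullet> (P0 *v v)"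
  shows "norm P \<le> (\<Sum>i\<in>(UNIV::'p set). \<Sum>j\<in>(UNIV::'p set). norm P0)"
proof -
  have quad: "axis i 1 \<bullet> (A *v axis j 1) = A $ i $ j" for i j and A :: "real^'p^'p"
    by (simp add: inner_axis' matrix_vector_mult_basis column_def)
  have diag: "0 \<le> P $ i $ i \<and> P $ i $ i \<le> norm P0" for i
    using assms(2,3)[of "axis i 1"] abs_entry_le_norm[of P0 i i] unfolding quad by linarith
  have symc: "P $ i $ j = P $ j $ i" for i j
    using sym by (metis transpose_def vec_lambda_beta)
  have "\<bar>P $ i $ j\<bar> \<le> norm P0" for i j
  proof -
    let ?v = "axis i 1 + axis j (1::real)" and ?w = "axis i 1 - axis j (1::real)"
    have "?v \<bullet> (P *v ?v) = P $ i $ i + 2 * P $ i $ j + P $ j $ j"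
      by (simp add: matrix_vector_right_distrib inner_add_left inner_add_right quad symc[of j i])
    moreover have "?w \<bullet> (P *v ?w) = P $ i $ i - 2 * P $ i $ j + P $ j $ j"
      by (simp add: matrix_vector_mult_diff_distrib inner_diff_left inner_diff_right quad symc[of j i])
    ultimately show ?thesis
      using assms(2)[of ?v] assms(2)[of ?w] diag[of i] diag[of j] by linarith
  qed
  moreover have "norm P \<le> (\<Sum>i\<in>UNIV. \<Sum>j\<in>UNIV. \<bar>P $ i $ j\<bar>)"
    unfolding norm_vec_def[of P]
    by (rule order_trans[OF L2_set_le_sum]) (auto intro!: sum_mono norm_le_l1_cart)
  ultimately show ?thesis by (meson order_trans sum_mono)
qed

text \<open>
  In terms of the information matrix the recursion for the error is additive: the information matrix times
  the error grows by \<open>d\<^sub>l x\<^sub>l\<close> at each step.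
\<close>

lemma rls_error:
  assumes P0: "pos_def P0" and z: "\<And>l. l \<in> {1..k} \<Longrightarrow> z l = x l \<bullet> \<theta> + d l"
  shows "rls_estimate x z \<theta>0 P0 k - \<theta> =
    rls_P x P0 k *v (matrix_inv P0 *v (\<theta>0 - \<theta>) + (\<Sum>l=1..k. d l *\<^sub>R x l))"
proof -
  have "information P0 x k *v (rls_estimate x z \<theta>0 P0 k - \<theta>) =
      matrix_inv P0 *v (\<theta>0 - \<theta>) + (\<Sum>l=1..k. d l *\<^sub>R x l)"
    using z
  proof (induct k)
    case 0 show ?case by (simp add: information_def)
  next
    case (Suc k)
    let ?P = "rls_P x P0 k" and ?Q = "information P0 x k" and ?X = "x (Suc k)"
    let ?e = "rls_estimate x z \<theta>0 P0 k - \<theta>"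
    let ?g = "rls_gain ?P ?X"
    have PQ: "?P ** ?Q = mat 1" and "transpose ?P = ?P" "\<And>v. v \<bullet> (?P *v v) \<ge> 0"
      using rls_P_props[OF P0, of x k] by auto
    note g = rls_P_step(4)[OF this, of ?X]
    have QP: "?Q *v (?P *v v) = v" for v
      using PQ matrix_left_right_inverse by (metis matrix_vector_mul_assoc matrix_vector_mul_lid)
    define c where "c = d (Suc k) - ?X \<bullet> ?e"
    have "z (Suc k) - ?X \<bullet> rls_estimate x z \<theta>0 P0 k = c"
      using Suc.prems by (simp add: c_def inner_diff_right)
    then have E: "rls_estimate x z \<theta>0 P0 (Suc k) - \<theta> = ?e + (?g * c) *\<^sub>R (?P *v ?X)"
      by (simp add: Let_def)
    have "information P0 x (Suc k) *v (rls_estimate x z \<theta>0 P0 (Suc k) - \<theta>) =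
       ?Q *v ?e + (?g * c) *\<^sub>R ?X + (?X \<bullet> ?e + ?g * c * (?X \<bullet> (?P *v ?X))) *\<^sub>R ?X"
      unfolding E by (simp add: information_Suc matrix_vector_mult_add_rdistrib outer_mult_vec matrix_vector_right_distrib
          vector_scaleR_matrix QP inner_add_right scaleR_add_left scaleR_add_right)
    also have "\<dots> = ?Q *v ?e + (c * (?g * (1 + ?X \<bullet> (?P *v ?X))) + ?X \<bullet> ?e) *\<^sub>R ?X"
      by (simp add: algebra_simps)
    also have "\<dots> = ?Q *v ?e + d (Suc k) *\<^sub>R ?X"
      using g by (simp add: c_def)
    finally show ?case using Suc by simp
  qed
  then show ?thesis
    using rls_P_props[OF P0, of x k] by (metis matrix_vector_mul_assoc matrix_vector_mul_lid)
qed


section \<open>Gaussian laws\<close>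

text \<open>
  With this representation the degenerate law with variance \<open>0\<close> needs no separate treatment.
\<close>

lemma gaussian_law_eq_distr:
  assumes "v \<ge> 0"
  shows "gaussian_law 0 v = distr std_normal_distribution borel (\<lambda>x. sqrt v * x)"
proof (cases "v = 0")
  case True
  interpret S: prob_space std_normal_distribution
    using real_dist_normal_dist by (simp add: real_distribution_def)
  show ?thesis using True by (simp add: gaussian_law_def S.distr_const)
next
  case False
  interpret S: prob_space std_normal_distribution
    using real_dist_normal_dist by (simp add: real_distribution_def)
  have v: "sqrt v > 0" using False assms by simp
  have "distributed std_normal_distribution lborel (\<lambda>x. x) std_normal_density"
    by (auto simp: distributed_def distr_id2)
  then have "distributed std_normal_distribution lborel (\<lambda>x. (sqrt v * x - 0) / sqrt v) std_normal_density"
    using v by simp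
  then have "distributed std_normal_distribution lborel (\<lambda>x. sqrt v * x) (normal_density 0 (sqrt v))"
    using S.normal_standard_normal_convert[OF v, of "\<lambda>x. sqrt v * x" 0] by simp
  then have "distr std_normal_distribution lborel (\<lambda>x. sqrt v * x) = density lborel (normal_density 0 (sqrt v))"
    by (simp add: distributed_def)
  moreover have "distr std_normal_distribution lborel (\<lambda>x. sqrt v * x) = distr std_normal_distribution borel (\<lambda>x. sqrt v * x)"
    by (rule distr_cong) auto
  ultimately show ?thesis using False by (simp add: gaussian_law_def)
qed

lemma real_distribution_gaussian_law: "v \<ge> 0 \<Longrightarrow> real_distribution (gaussian_law 0 v)"
  by (simp add: gaussian_law_eq_distr real_distribution_def prob_space.prob_space_distr
      real_distribution_axioms_def real_dist_normal_dist[unfolded real_distribution_def])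

lemma char_gaussian_law:
  assumes "v \<ge> 0"
  shows "char (gaussian_law 0 v) t = complex_of_real (exp (- (v * t\<^sup>2) / 2))"
proof -
  have "char (gaussian_law 0 v) t = (CLINT x|std_normal_distribution. iexp (t * (sqrt v * x)))"
    unfolding char_def gaussian_law_eq_distr[OF assms] by (subst integral_distr) auto
  also have "\<dots> = char std_normal_distribution (t * sqrt v)"
    by (simp add: char_def mult.assoc)
  finally show ?thesis using assms
    by (simp add: char_std_normal_distribution power_mult_distrib mult.commute)
qed

lemma gaussian_law_moments:
  assumes "v \<ge> 0"
  shows "integrable (gaussian_law 0 v) (\<lambda>x. x ^ k)" "(\<integral>x. x \<partial>gaussian_law 0 v) = 0"
    "(\<integral>x. x\<^sup>2 \<partial>gaussian_law 0 v) = v"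
proof -
  show "integrable (gaussian_law 0 v) (\<lambda>x. x ^ k)"
    unfolding gaussian_law_eq_distr[OF assms]
    by (subst integrable_distr_eq) (auto simp: power_mult_distrib integrable_std_normal_distribution_moment)
  show "(\<integral>x. x \<partial>gaussian_law 0 v) = 0"
    unfolding gaussian_law_eq_distr[OF assms]
    using integral_std_normal_distribution_moment_odd[of 1] by (subst integral_distr) auto
  show "(\<integral>x. x\<^sup>2 \<partial>gaussian_law 0 v) = v"
    unfolding gaussian_law_eq_distr[OF assms]
    using std_normal_distribution_even_moments(1)[of 1] assms
    by (subst integral_distr) (auto simp: power_mult_distrib)
qed

text \<open>
  Symmetric Gaussian elimination. For a symmetric nonnegative form that only involves the coordinates in
  \<open>S\<close> and for \<open>s \<in> S\<close>, subtracting the square of the normalised \<open>s\<close>-th column leaves a nonnegative form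
  that only involves \<open>S - {s}\<close>; a vanishing diagonal entry forces its whole column to vanish.
\<close>

lemma psd_sum_of_squares:
  fixes A :: "real^'p^'p"
  assumes "transpose A = A" "\<And>v. 0 \<le> v \<bullet> (A *v v)"
  shows "\<exists>w :: 'p \<Rightarrow> real^'p. \<forall>v. v \<bullet> (A *v v) = (\<Sum>i\<in>UNIV. (v \<bullet> w i)\<^sup>2)"
proof -
  have quad: "axis i 1 \<bullet> (A *v axis j 1) = A $ i $ j" for i j and A :: "real^'p^'p"
    by (simp add: inner_axis' matrix_vector_mult_basis column_def)
  have "\<exists>w :: 'p \<Rightarrow> real^'p. \<forall>v. v \<bullet> (A *v v) = (\<Sum>i\<in>S. (v \<bullet> w i)\<^sup>2)"
    if "finite S" "transpose A = A" "\<And>v. 0 \<le> v \<bullet> (A *v v)"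
      "\<And>i j. i \<notin> S \<Longrightarrow> A $ i $ j = 0" for S and A :: "real^'p^'p"
    using that
  proof (induct S arbitrary: A)
    case empty
    then have "A = 0" by (simp add: vec_eq_iff)
    then show ?case by simp
  next
    case (insert s S)
    have sym: "A $ i $ j = A $ j $ i" for i j
      using insert.prems(1) by (metis transpose_def vec_lambda_beta)
    have ss: "A $ s $ s \<ge> 0" using insert.prems(2)[of "axis s 1"] by (simp add: quad)
    define r where "r = A *v axis s 1"
    have adj: "(A *v v) \<bullet> w = v \<bullet> (A *v w)" for v w
      by (metis dot_lmul_matrix insert.prems(1) transpose_matrix_vector inner_commute)
    have rv: "v \<bullet> r = axis s 1 \<bullet> (A *v v)" for v
      by (metis adj inner_commute r_def)
    have rs: "r $ s = A $ s $ s" "\<And>i. r $ i = A $ i $ s"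
      by (simp_all add: r_def matrix_vector_mult_basis column_def)
    have expand: "(v + c *\<^sub>R axis s 1) \<bullet> (A *v (v + c *\<^sub>R axis s 1)) =
       v \<bullet> (A *v v) + 2 * c * (v \<bullet> r) + c\<^sup>2 * A $ s $ s" for v c
    proof -
      have "A *v (v + c *\<^sub>R axis s 1) = A *v v + c *\<^sub>R r"
        by (simp add: r_def matrix_vector_right_distrib)
          (simp add: vec_eq_iff matrix_vector_mult_def sum_distrib_left mult_ac)
      moreover have "axis s 1 \<bullet> r = A $ s $ s" by (simp add: r_def quad)
      ultimately show ?thesis
        by (simp add: inner_add_left inner_add_right rv[symmetric] r_def[symmetric] power2_eq_square algebra_simps)
    qed
    define c where "c = (if A $ s $ s = 0 then 0 else 1 / A $ s $ s)"
    have r0: "r = 0" if "A $ s $ s = 0"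
    proof -
      have "v \<bullet> r = 0" for v
      proof (rule ccontr)
        assume nz: "v \<bullet> r \<noteq> 0"
        \<comment> \<open>the value for which moving from \<open>v\<close> along the \<open>s\<close>-th axis would make the form equal to \<open>-1\<close>\<close>
        define t where "t = - (v \<bullet> (A *v v) + 1) / (2 * (v \<bullet> r))"
        have "(v + t *\<^sub>R axis s 1) \<bullet> (A *v (v + t *\<^sub>R axis s 1)) = -1"
          unfolding expand using nz that by (simp add: t_def field_simps)
        then show False using insert.prems(2)[of "v + t *\<^sub>R axis s 1"] by simp
      qed
      then show ?thesis by (metis inner_eq_zero_iff)
    qed
    have cc: "c * r $ s * r $ i = r $ i" for i
      using r0 rs(1) by (cases "A $ s $ s = 0") (auto simp: c_def)
    define A' where "A' = A - c *\<^sub>R (\<chi> i j. r $ i * r $ j)"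
    have o: "(\<chi> i j. r $ i * r $ j) *v v = (r \<bullet> v) *\<^sub>R r" for v
      by (simp add: vec_eq_iff matrix_vector_mult_def inner_vec_def sum_distrib_left sum_distrib_right mult_ac)
    have A'v: "v \<bullet> (A' *v v) = v \<bullet> (A *v v) - c * (v \<bullet> r)\<^sup>2" for v
    proof -
      have "A' *v v = A *v v - c *\<^sub>R ((\<chi> i j. r $ i * r $ j) *v v)"
        unfolding A'_def by (simp add: vec_eq_iff matrix_vector_mult_def sum_distrib_left
            sum_subtractf[symmetric] algebra_simps)
      then show ?thesis unfolding o by (simp add: inner_diff_right power2_eq_square inner_commute)
    qed
    have "\<exists>w :: 'p \<Rightarrow> real^'p. \<forall>v. v \<bullet> (A' *v v) = (\<Sum>i\<in>S. (v \<bullet> w i)\<^sup>2)"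
    proof (rule insert.hyps(3))
      show "transpose A' = A'"
        by (simp add: A'_def vec_eq_iff transpose_def sym mult.commute)
      show "0 \<le> v \<bullet> (A' *v v)" for v
      proof -
        \<comment> \<open>minimising the form along the \<open>s\<close>-th axis shows that what is left is nonnegative\<close>
        have "v \<bullet> (A' *v v) = (v + (- c * (v \<bullet> r)) *\<^sub>R axis s 1) \<bullet> (A *v (v + (- c * (v \<bullet> r)) *\<^sub>R axis s 1))"
          unfolding A'v expand by (cases "A $ s $ s = 0") (auto simp: c_def power2_eq_square field_simps r0)
        also have "\<dots> \<ge> 0" by (rule insert.prems(2))
        finally show ?thesis .
      qed
      show "A' $ i $ j = 0" if "i \<notin> S" for i j
      proof (cases "i = s")
        case True
        then show ?thesis using cc[of j] rs(2)[of j] sym[of s j] by (simp add: A'_def)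
      next
        case False
        then have "A $ i $ j = 0" for j using insert.prems(3) that by simp
        then show ?thesis by (simp add: A'_def rs(2))
      qed
    qed
    then obtain w where w: "\<And>v. v \<bullet> (A' *v v) = (\<Sum>i\<in>S. (v \<bullet> w i)\<^sup>2)" by blast
    have "v \<bullet> (A *v v) = (\<Sum>i\<in>insert s S. (v \<bullet> (w(s := sqrt c *\<^sub>R r)) i)\<^sup>2)" for v
    proof -
      have "c \<ge> 0" using ss by (simp add: c_def)
      then have "(v \<bullet> (sqrt c *\<^sub>R r))\<^sup>2 = c * (v \<bullet> r)\<^sup>2" by (simp add: power_mult_distrib)
      moreover have "(\<Sum>i\<in>S. (v \<bullet> (w(s := sqrt c *\<^sub>R r)) i)\<^sup>2) = (\<Sum>i\<in>S. (v \<bullet> w i)\<^sup>2)"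
        using insert.hyps(2) by (intro sum.cong) auto
      ultimately show ?thesis using A'v[of v] w[of v] insert.hyps by simp
    qed
    then show ?case by blast
  qed
  from this[of UNIV A] assms show ?thesis by simp
qed

text \<open>
  If the quadratic form of \<open>A\<close> is \<open>\<Sum>\<^sub>i (v \<bullet> w\<^sub>i)\<^sup>2\<close>, then \<open>\<Sum>\<^sub>i z\<^sub>i w\<^sub>i\<close> with independent standard Gaussian \<open>z\<^sub>i\<close> has
  covariance \<open>A\<close>. Its linear functionals are identified by their characteristic functions.
\<close>

lemma gaussian_law_exists:
  fixes A :: "real^'p^'p"
  assumes "transpose A = A" "\<And>v. 0 \<le> v \<bullet> (A *v v)"
  obtains N where "is_gaussian_law N 0 A" "prob_space N"
proof -
  obtain w :: "'p \<Rightarrow> real^'p" where w: "\<And>v. v \<bullet> (A *v v) = (\<Sum>i\<in>UNIV. (v \<bullet> w i)\<^sup>2)"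
    using psd_sum_of_squares[OF assms] by blast
  interpret S: real_distribution std_normal_distribution by (rule real_dist_normal_dist)
  interpret product_prob_space "\<lambda>_::'p. std_normal_distribution" UNIV
    by unfold_locales
  define G where "G = PiM (UNIV :: 'p set) (\<lambda>_. std_normal_distribution)"
  interpret G: prob_space G unfolding G_def by (rule P.prob_space_axioms)
  define f where "f = (\<lambda>z::'p \<Rightarrow> real. \<Sum>i\<in>UNIV. z i *\<^sub>R w i)"
  have comp [measurable]: "(\<lambda>z. z i) \<in> borel_measurable G" for i
    using measurable_component_singleton[of i UNIV "\<lambda>_. std_normal_distribution"] unfolding G_def by simp
  have f [measurable]: "f \<in> borel_measurable G" unfolding f_def by measurable
  define N where "N = distr G borel f"
  interpret N: prob_space N unfolding N_def by (rule G.prob_space_distr) simp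
  have "distr N borel (\<lambda>x. v \<bullet> x) = gaussian_law 0 (v \<bullet> (A *v v))" for v
  proof (rule Levy_uniqueness)
    show "real_distribution (distr N borel (\<lambda>x. v \<bullet> x))"
      by (auto simp: N_def intro!: N.prob_space_distr[unfolded N_def] simp: real_distribution_def real_distribution_axioms_def)
    show "real_distribution (gaussian_law 0 (v \<bullet> (A *v v)))"
      using assms by (intro real_distribution_gaussian_law)
    show "char (distr N borel (\<lambda>x. v \<bullet> x)) = char (gaussian_law 0 (v \<bullet> (A *v v)))"
    proof
      fix t
      have "char (distr N borel (\<lambda>x. v \<bullet> x)) t = (CLINT z|G. iexp (t * (v \<bullet> f z)))"
        by (simp add: char_def N_def integral_distr)
      also have "\<dots> = (CLINT z|G. (\<Prod>i\<in>UNIV. iexp (t * (v \<bullet> w i) * z i)))"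
        by (simp add: f_def inner_sum_right sum_distrib_left exp_sum[symmetric] mult_ac)
      also have "\<dots> = (\<Prod>i\<in>UNIV. CLINT x|std_normal_distribution. iexp (t * (v \<bullet> w i) * x))"
        unfolding G_def by (rule product_integral_prod) (auto intro!: S.integrable_iexp)
      also have "\<dots> = (\<Prod>i\<in>UNIV. complex_of_real (exp (- (t * (v \<bullet> w i))\<^sup>2 / 2)))"
        by (rule prod.cong[OF refl]) (rule fun_cong[OF char_std_normal_distribution, unfolded char_def])
      also have "\<dots> = complex_of_real (exp (\<Sum>i\<in>UNIV. - (t * (v \<bullet> w i))\<^sup>2 / 2))"
        by (simp add: exp_sum)
      also have "(\<Sum>i\<in>UNIV. - (t * (v \<bullet> w i))\<^sup>2 / 2) = - ((v \<bullet> (A *v v)) * t\<^sup>2) / 2"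
        by (simp add: w sum_negf power_mult_distrib sum_divide_distrib[symmetric]
              sum_distrib_left[symmetric] mult.commute)
      finally show "char (distr N borel (\<lambda>x. v \<bullet> x)) t = char (gaussian_law 0 (v \<bullet> (A *v v))) t"
        using assms by (simp add: char_gaussian_law)
    qed
  qed
  then have "is_gaussian_law N 0 A" by (simp add: is_gaussian_law_def N_def)
  then show ?thesis using that N.prob_space_axioms by blast
qed

section \<open>Convergence in distribution from characteristic functions\<close>

text \<open>
  Trigonometric polynomials: the functions whose expectations are controlled by the characteristic function.
  The phase \<open>t\<close> makes this class contain the sines and the constants and closes it under products.
\<close>

inductive trig :: "(real^'p \<Rightarrow> real) \<Rightarrow> bool" where
  cosine: "trig (\<lambda>x. c * cos (v \<bullet> x + t))"
| plus: "trig f \<Longrightarrow> trig g \<Longrightarrow> trig (\<lambda>x. f x + g x)"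

lemma trig_const: "trig (\<lambda>x. c)" using trig.cosine[of c 0 0] by simp

lemma trig_mult_cos: "trig f \<Longrightarrow> trig (\<lambda>x. f x * (c * cos (v \<bullet> x + t)))"
proof (induct rule: trig.induct)
  case (cosine c' v' t')
  have "trig (\<lambda>x. c * c' / 2 * cos ((v' - v) \<bullet> x + (t' - t)) + c * c' / 2 * cos ((v' + v) \<bullet> x + (t' + t)))"
    by (intro trig.intros)
  moreover have "c' * cos (v' \<bullet> x + t') * (c * cos (v \<bullet> x + t)) =
      c * c' / 2 * cos ((v' - v) \<bullet> x + (t' - t)) + c * c' / 2 * cos ((v' + v) \<bullet> x + (t' + t))" for x
  proof -
    have "cos (v' \<bullet> x + t') * cos (v \<bullet> x + t) = (cos ((v' - v) \<bullet> x + (t' - t)) + cos ((v' + v) \<bullet> x + (t' + t))) / 2"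
      by (simp only: cos_times_cos inner_diff_left inner_add_left add_diff_add add.assoc add.left_commute)
    then show ?thesis by (simp add: field_simps)
  qed
  ultimately show ?case by simp
next
  case (plus f g)
  then show ?case using trig.plus[OF plus(2,4)] by (simp add: distrib_right)
qed

lemma trig_mult: "trig g \<Longrightarrow> trig f \<Longrightarrow> trig (\<lambda>x. f x * g x)"
proof (induct rule: trig.induct)
  case (cosine c v t) then show ?case by (rule trig_mult_cos)
next
  case (plus g h)
  then show ?case using trig.plus by (simp add: distrib_left)
qed

lemma trig_sum: "(\<And>i. i \<in> I \<Longrightarrow> trig (f i)) \<Longrightarrow> trig (\<lambda>x. \<Sum>i\<in>I. f i x)"
  by (induct I rule: infinite_finite_induct) (auto intro: trig_const trig.plus)

text \<open>
  The map that winds \<open>\<real>\<^sup>p\<close> around a torus, with period \<open>2 \<pi> / c\<close> in each coordinate; polynomials on the torus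
  become trigonometric polynomials.
\<close>

definition wind :: "real \<Rightarrow> real^'p \<Rightarrow> (real^'p) \<times> (real^'p)" where
  "wind c x = ((\<chi> i. cos (c * x $ i)), (\<chi> i. sin (c * x $ i)))"

lemma trig_polynomial:
  assumes "real_polynomial_function p"
  shows "trig (\<lambda>x::real^'p. p (wind c x))"
  using assms
proof (induct rule: real_polynomial_function.induct)
  case (linear f)
  interpret bounded_linear f by fact
  have dec: "w = (\<Sum>i\<in>UNIV. (w $ i) *\<^sub>R axis i 1)" for w :: "real^'p"
    by (simp add: vec_eq_iff axis_def if_distrib cong: if_cong)
  have "f (wind c x) = (\<Sum>i\<in>UNIV. f (axis i 1, 0) * cos ((c *\<^sub>R axis i 1) \<bullet> x + 0) +
      f (0, axis i 1) * cos ((c *\<^sub>R axis i 1) \<bullet> x + (- pi / 2)))" for x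
  proof -
    let ?C = "(\<chi> i. cos (c * x $ i)) :: real^'p" and ?S = "(\<chi> i. sin (c * x $ i)) :: real^'p"
    have "wind c x = (\<Sum>i\<in>UNIV. (?C $ i) *\<^sub>R (axis i 1, 0)) + (\<Sum>i\<in>UNIV. (?S $ i) *\<^sub>R (0, axis i 1))"
    proof -
      have "(\<Sum>i\<in>UNIV. (?C $ i) *\<^sub>R (axis i 1, 0 :: real^'p)) = (?C, 0)"
        by (simp add: prod_eq_iff fst_sum snd_sum dec[symmetric] del: vec_lambda_beta)
      moreover have "(\<Sum>i\<in>UNIV. (?S $ i) *\<^sub>R (0 :: real^'p, axis i 1)) = (0, ?S)"
        by (simp add: prod_eq_iff fst_sum snd_sum dec[symmetric] del: vec_lambda_beta)
      ultimately show ?thesis by (simp only: wind_def add_Pair add_0_left add_0_right)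
    qed
    then have "f (wind c x) = (\<Sum>i\<in>UNIV. ?C $ i * f (axis i 1, 0)) + (\<Sum>i\<in>UNIV. ?S $ i * f (0, axis i 1))"
      by (simp only: add sum scaleR real_scaleR_def)
    moreover have "(c *\<^sub>R axis i 1) \<bullet> x = c * x $ i" for i by (simp add: inner_axis')
    moreover have "cos (z + (- pi / 2)) = sin z" for z by (simp add: cos_diff)
    ultimately show ?thesis
      by (simp only: sum.distrib add_0_right vec_lambda_beta mult.commute)
  qed
  moreover have "trig (\<lambda>x. \<Sum>i\<in>UNIV. f (axis i 1, 0) * cos ((c *\<^sub>R axis i 1) \<bullet> x + 0) +
      f (0, axis i 1) * cos ((c *\<^sub>R axis i 1) \<bullet> x + (- pi / 2)))"
    by (intro trig_sum trig.intros)
  ultimately show ?case by simp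
qed (auto intro: trig_const trig.plus trig_mult)

lemma one_minus_prod_le:
  fixes f :: "'i \<Rightarrow> real"
  assumes "finite I" "\<And>i. i \<in> I \<Longrightarrow> 0 \<le> f i \<and> f i \<le> 1"
  shows "1 - (\<Prod>i\<in>I. f i) \<le> (\<Sum>i\<in>I. 1 - f i)" "0 \<le> (\<Prod>i\<in>I. f i)" "(\<Prod>i\<in>I. f i) \<le> 1"
proof -
  have "1 - (\<Prod>i\<in>I. f i) \<le> (\<Sum>i\<in>I. 1 - f i) \<and> 0 \<le> (\<Prod>i\<in>I. f i) \<and> (\<Prod>i\<in>I. f i) \<le> 1"
    using assms
  proof (induct I rule: finite_induct)
    case (insert i I)
    let ?p = "\<Prod>i\<in>I. f i"
    have p: "1 - ?p \<le> (\<Sum>i\<in>I. 1 - f i)" "0 \<le> ?p" "?p \<le> 1" and fi: "0 \<le> f i" "f i \<le> 1"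
      using insert by auto
    have "(1 - f i) * ?p \<le> (1 - f i) * 1" using p fi by (intro mult_left_mono) auto
    moreover have "f i * ?p \<le> 1" using p fi by (simp add: mult_le_one)
    moreover have "0 \<le> f i * ?p" using p fi by simp
    ultimately show ?case using insert p by (simp add: algebra_simps)
  qed simp
  then show "1 - (\<Prod>i\<in>I. f i) \<le> (\<Sum>i\<in>I. 1 - f i)" "0 \<le> (\<Prod>i\<in>I. f i)" "(\<Prod>i\<in>I. f i) \<le> 1" by auto
qed

text \<open>
  On the set of all pairs of vectors \<open>(C, S)\<close> with entries in \<open>[-1, 1]\<close>, the function
  \<open>g (arcsin S / c) \<cdot> \<Prod>\<^sub>i max 0 C\<^sub>i\<close> is continuous. Composed with the winding map it is bounded everywhere by the
  bound of \<open>g\<close>, and for small \<open>c\<close> it is close to \<open>g\<close> on a given ball, since there \<open>arcsin\<close> undoes the winding and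
  all cosines are close to \<open>1\<close>. The Weierstrass theorem replaces it by a polynomial on the torus. Unlike for an
  approximation on the ball alone, the bound off the ball does not depend on the ball; this is what makes
  tightness sufficient later.
\<close>

lemma trig_approximation:
  fixes g :: "real^'p \<Rightarrow> real"
  assumes g: "continuous_on UNIV g" "\<And>x. \<bar>g x\<bar> \<le> B" and e: "e > 0"
  obtains h where "trig h" "\<And>x. norm x \<le> K \<Longrightarrow> \<bar>g x - h x\<bar> \<le> e" "\<And>x. \<bar>h x\<bar> \<le> B + e"
proof -
  have B: "B \<ge> 0" using g(2)[of 0] by linarith
  have "\<exists>c>0. c * \<bar>K\<bar> \<le> 1 \<and> B * (c\<^sup>2 * K\<^sup>2) \<le> e / 2"
  proof -
    \<comment> \<open>small enough for \<open>arcsin\<close> to be the inverse of \<open>sin\<close> on the scaled ball and for the cosine factor to cost at most \<open>e / 2\<close>\<close>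
    define c where "c = min (1 / (\<bar>K\<bar> + 1)) (sqrt (e / (2 * (B + 1) * (K\<^sup>2 + 1))))"
    have pos: "0 < e / (2 * (B + 1) * (K\<^sup>2 + 1))" using e B by (intro divide_pos_pos mult_pos_pos) (auto simp: add_nonneg_pos)
    then have c: "c > 0" by (auto simp: c_def)
    have "c * \<bar>K\<bar> \<le> 1 / (\<bar>K\<bar> + 1) * \<bar>K\<bar>" by (intro mult_right_mono) (auto simp: c_def)
    also have "\<dots> \<le> 1" by (simp add: field_simps)
    finally have 1: "c * \<bar>K\<bar> \<le> 1" .
    have "c\<^sup>2 \<le> e / (2 * (B + 1) * (K\<^sup>2 + 1))"
      using c pos by (metis c_def less_imp_le min.cobounded2 power2_eq_square real_sqrt_pow2 power_mono)
    then have "c\<^sup>2 * ((B + 1) * (K\<^sup>2 + 1)) \<le> e / (2 * (B + 1) * (K\<^sup>2 + 1)) * ((B + 1) * (K\<^sup>2 + 1))"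
      using B by (intro mult_right_mono) (auto)
    also have "\<dots> = e / 2" using B by (simp add: field_simps add_nonneg_eq_0_iff)
    finally have "c\<^sup>2 * ((B + 1) * (K\<^sup>2 + 1)) \<le> e / 2" .
    moreover have "B * (c\<^sup>2 * K\<^sup>2) \<le> c\<^sup>2 * ((B + 1) * (K\<^sup>2 + 1))"
    proof -
      have "B * K\<^sup>2 \<le> (B + 1) * (K\<^sup>2 + 1)" using B by (intro mult_mono) auto
      then have "c\<^sup>2 * (B * K\<^sup>2) \<le> c\<^sup>2 * ((B + 1) * (K\<^sup>2 + 1))" by (intro mult_left_mono) auto
      then show ?thesis by (simp add: mult_ac)
    qed
    ultimately show ?thesis using c 1 by (intro exI[of _ c]) linarith
  qed
  then obtain c where c: "c > 0" "c * \<bar>K\<bar> \<le> 1" "B * (c\<^sup>2 * K\<^sup>2) \<le> e / 2" by blast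
  define T where "T = (cbox (-1) 1 :: (real^'p) set) \<times> (cbox (-1) 1 :: (real^'p) set)"
  define G where "G = (\<lambda>w :: (real^'p) \<times> (real^'p).
     g (\<chi> i. arcsin (snd w $ i) / c) * (\<Prod>i\<in>UNIV. max 0 (fst w $ i)))"
  have T: "w \<in> T \<longleftrightarrow> (\<forall>i. \<bar>fst w $ i\<bar> \<le> 1 \<and> \<bar>snd w $ i\<bar> \<le> 1)" for w
    by (cases w) (auto simp: T_def mem_box_cart abs_le_iff; metis minus_le_iff)
  have "continuous_on T G"
  proof -
    have "continuous_on T (\<lambda>w. (\<chi> i. arcsin (snd w $ i) / c) :: real^'p)"
      using c by (intro continuous_intros) (auto simp: T abs_le_iff minus_le_iff)
    then have "continuous_on T (\<lambda>w. g (\<chi> i. arcsin (snd w $ i) / c))"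
      by (rule continuous_on_compose2[OF g(1)]) auto
    then show ?thesis unfolding G_def by (intro continuous_intros)
  qed
  moreover have "compact T" unfolding T_def by (intro compact_Times compact_cbox)
  ultimately obtain p where p: "real_polynomial_function p" "\<And>w. w \<in> T \<Longrightarrow> \<bar>G w - p w\<bar> < e / 2"
    using Stone_Weierstrass_real_polynomial_function[of T G "e/2"] e by auto
  have wT: "wind c x \<in> T" for x :: "real^'p" by (simp add: T wind_def)
  have GB: "\<bar>G w\<bar> \<le> B" if "w \<in> T" for w
  proof -
    have q: "0 \<le> (\<Prod>i\<in>UNIV. max 0 (fst w $ i))" "(\<Prod>i\<in>UNIV. max 0 (fst w $ i)) \<le> 1"
      using that one_minus_prod_le(2,3)[of UNIV "\<lambda>i. max 0 (fst w $ i)"] by (auto simp: T abs_le_iff)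
    have "\<bar>G w\<bar> \<le> B * 1" unfolding G_def abs_mult using q g(2) B by (intro mult_mono) auto
    then show ?thesis by simp
  qed
  show ?thesis
  proof (rule that)
    show "trig (\<lambda>x. p (wind c x))" by (rule trig_polynomial[OF p(1)])
    show "\<bar>p (wind c x)\<bar> \<le> B + e" for x using p(2)[OF wT[of x]] GB[OF wT[of x]] e by linarith
    show "\<bar>g x - p (wind c x)\<bar> \<le> e" if x: "norm x \<le> K" for x
    proof -
      have xi: "\<bar>c * x $ i\<bar> \<le> 1" for i
      proof -
        have "\<bar>x $ i\<bar> \<le> \<bar>K\<bar>" using component_le_norm_cart[of x i] x by linarith
        then have "c * \<bar>x $ i\<bar> \<le> c * \<bar>K\<bar>" using c by (intro mult_left_mono) auto
        moreover have "\<bar>c * x $ i\<bar> = c * \<bar>x $ i\<bar>" using c by (simp add: abs_mult)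
        ultimately show ?thesis using c by linarith
      qed
      have pi: "pi / 2 > 1" using pi_gt3 by linarith
      have as: "arcsin (sin (c * x $ i)) / c = x $ i" for i
        using xi[of i] pi c by (subst arcsin_sin) (auto simp: abs_le_iff)
      have cp: "0 \<le> cos (c * x $ i)" for i
        using xi[of i] pi by (intro cos_ge_zero) (auto simp: abs_le_iff)
      define q where "q = (\<Prod>i\<in>UNIV. cos (c * x $ i))"
      have G: "G (wind c x) = g x * q"
        using cp by (simp add: G_def wind_def as q_def max_absorb2)
      have q: "0 \<le> q" "q \<le> 1"
        using one_minus_prod_le(2,3)[of UNIV "\<lambda>i. cos (c * x $ i)"] cp unfolding q_def by auto
      have "1 - q \<le> (\<Sum>i\<in>UNIV. 1 - cos (c * x $ i))"
        using one_minus_prod_le(1)[of UNIV "\<lambda>i. cos (c * x $ i)"] cp unfolding q_def by auto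
      also have "\<dots> \<le> (\<Sum>i\<in>UNIV. (c * x $ i)\<^sup>2)"
      proof (rule sum_mono)
        fix i
        have "cos (c * x $ i) = 1 - 2 * (sin (c * x $ i / 2))\<^sup>2"
          using cos_double_sin[of "c * x $ i / 2"] by simp
        moreover have "(sin (c * x $ i / 2))\<^sup>2 \<le> (c * x $ i / 2)\<^sup>2"
          by (rule abs_le_square_iff[THEN iffD1, OF abs_sin_x_le_abs_x])
        moreover have "(c * x $ i / 2)\<^sup>2 = (c * x $ i)\<^sup>2 / 4" by (simp add: power_divide)
        moreover have "0 \<le> (c * x $ i)\<^sup>2" by simp
        ultimately show "1 - cos (c * x $ i) \<le> (c * x $ i)\<^sup>2" by linarith
      qed
      also have "\<dots> = c\<^sup>2 * (norm x)\<^sup>2"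
        by (simp add: norm_vec_def L2_set_def sum_nonneg power_mult_distrib sum_distrib_left)
      also have "\<dots> \<le> c\<^sup>2 * K\<^sup>2" using x by (intro mult_left_mono power_mono) auto
      finally have q1: "1 - q \<le> c\<^sup>2 * K\<^sup>2" .
      have "\<bar>g x - G (wind c x)\<bar> = \<bar>g x\<bar> * (1 - q)"
        using q unfolding G by (metis abs_mult abs_of_nonneg diff_ge_0_iff_ge mult.right_neutral right_diff_distrib)
      also have "\<dots> \<le> B * (c\<^sup>2 * K\<^sup>2)" using q q1 g(2) B by (intro mult_mono) auto
      finally show ?thesis using p(2)[OF wT[of x]] c(3) by linarith
    qed
  qed
qed

lemma trig_continuous: "trig h \<Longrightarrow> continuous_on UNIV h"
  by (induct rule: trig.induct) (auto intro!: continuous_intros)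

lemma trig_bounded: "trig h \<Longrightarrow> \<exists>B. \<forall>x. \<bar>h x\<bar> \<le> B"
proof (induct rule: trig.induct)
  case (cosine c v t)
  have "\<bar>c * cos (v \<bullet> x + t)\<bar> \<le> \<bar>c\<bar>" for x by (simp add: abs_mult mult_left_le)
  then show ?case by blast
next
  case (plus f g)
  then obtain B C where "\<And>x. \<bar>f x\<bar> \<le> B" "\<And>x. \<bar>g x\<bar> \<le> C" by auto
  then have "\<bar>f x + g x\<bar> \<le> B + C" for x using abs_triangle_ineq order_trans add_mono by meson
  then show ?case by blast
qed

lemma expectation_diff_le:
  assumes "prob_space M" and X: "X \<in> borel_measurable M"
    and g: "continuous_on UNIV g" "\<And>x. \<bar>g x\<bar> \<le> B" and h: "continuous_on UNIV h" "\<And>x. \<bar>h x\<bar> \<le> B + e"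
    and K: "\<And>x::'a::euclidean_space. norm x \<le> K \<Longrightarrow> \<bar>g x - h x\<bar> \<le> e"
    and p: "measure M {\<omega>\<in>space M. norm (X \<omega>) > K} \<le> \<delta>" and e: "e \<ge> 0"
  shows "\<bar>(\<integral>\<omega>. g (X \<omega>) \<partial>M) - (\<integral>\<omega>. h (X \<omega>) \<partial>M)\<bar> \<le> e + (2 * B + e) * \<delta>"
proof -
  interpret prob_space M by fact
  have B: "B \<ge> 0" using g(2)[of undefined] by linarith
  have [measurable]: "X \<in> borel_measurable M" by fact
  have [measurable]: "g \<in> borel_measurable borel" "h \<in> borel_measurable borel"
    using g h by (auto intro: borel_measurable_continuous_onI)
  have ig: "integrable M (\<lambda>\<omega>. g (X \<omega>))" by (rule integrable_const_bound[of _ B]) (auto simp: g)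
  have ih: "integrable M (\<lambda>\<omega>. h (X \<omega>))" by (rule integrable_const_bound[of _ "B + e"]) (auto simp: h)
  let ?A = "{\<omega>\<in>space M. norm (X \<omega>) > K}"
  have A: "?A \<in> sets M" by measurable
  have "\<bar>(\<integral>\<omega>. g (X \<omega>) \<partial>M) - (\<integral>\<omega>. h (X \<omega>) \<partial>M)\<bar> = \<bar>\<integral>\<omega>. g (X \<omega>) - h (X \<omega>) \<partial>M\<bar>"
    using ig ih by simp
  also have "\<dots> \<le> (\<integral>\<omega>. \<bar>g (X \<omega>) - h (X \<omega>)\<bar> \<partial>M)" by (rule integral_abs_bound)
  also have "\<dots> \<le> (\<integral>\<omega>. e + (2 * B + e) * indicator ?A \<omega> \<partial>M)"
  proof (rule integral_mono)
    show "integrable M (\<lambda>\<omega>. \<bar>g (X \<omega>) - h (X \<omega>)\<bar>)" using ig ih by simp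
    show "integrable M (\<lambda>\<omega>. e + (2 * B + e) * indicator ?A \<omega>)"
      using A by (auto simp: emeasure_eq_measure)
    fix \<omega> assume "\<omega> \<in> space M"
    show "\<bar>g (X \<omega>) - h (X \<omega>)\<bar> \<le> e + (2 * B + e) * indicator ?A \<omega>"
    proof (cases "norm (X \<omega>) \<le> K")
      case True then show ?thesis using K[of "X \<omega>"] by (simp add: indicator_def)
    next
      case False
      have "\<bar>g (X \<omega>) - h (X \<omega>)\<bar> \<le> 2 * B + e" using g(2)[of "X \<omega>"] h(2)[of "X \<omega>"] by linarith
      then show ?thesis using False \<open>\<omega> \<in> space M\<close> e by (simp add: indicator_def)
    qed
  qed
  also have "\<dots> = e + (2 * B + e) * measure M ?A"
    using A by (subst Bochner_Integration.integral_add) (auto simp: emeasure_eq_measure prob_space)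
  also have "\<dots> \<le> e + (2 * B + e) * \<delta>" using p B e by (intro add_left_mono mult_left_mono) auto
  finally show ?thesis .
qed

lemma trig_expectation_tendsto:
  fixes X :: "nat \<Rightarrow> 'w \<Rightarrow> real^'p"
  assumes M: "prob_space M" and N: "prob_space N" "sets N = sets borel"
    and X: "\<And>k. X k \<in> borel_measurable M"
    and ch: "\<And>v. (\<lambda>k. CLINT \<omega>|M. iexp (v \<bullet> X k \<omega>)) \<longlonglongrightarrow> (CLINT x|N. iexp (v \<bullet> x))"
    and "trig h"
  shows "(\<lambda>k. \<integral>\<omega>. h (X k \<omega>) \<partial>M) \<longlonglongrightarrow> (\<integral>x. h x \<partial>N)"
  using \<open>trig h\<close>
proof (induct rule: trig.induct)
  case (cosine c v t)
  have eq: "c * cos (s + t) = Re (complex_of_real c * iexp t * iexp s)" for s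
    by (simp add: cis_conv_exp[symmetric] cos_add algebra_simps)
  have gen: "(\<integral>\<omega>. c * cos (v \<bullet> Y \<omega> + t) \<partial>L) = Re (complex_of_real c * iexp t * (CLINT \<omega>|L. iexp (v \<bullet> Y \<omega>)))"
    if "prob_space L" and Y: "Y \<in> borel_measurable L" for L :: "'c measure" and Y :: "'c \<Rightarrow> real^'p"
  proof -
    interpret prob_space L by fact
    note [measurable] = Y
    have i: "complex_integrable L (\<lambda>\<omega>. iexp (v \<bullet> Y \<omega>))"
      by (intro integrable_const_bound[of _ 1]) auto
    show ?thesis unfolding eq using i
      by (subst integral_Re) (auto intro!: integrable_mult_right)
  qed
  have "(\<lambda>k. Re (complex_of_real c * iexp t * (CLINT \<omega>|M. iexp (v \<bullet> X k \<omega>)))) \<longlonglongrightarrow>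
     Re (complex_of_real c * iexp t * (CLINT x|N. iexp (v \<bullet> x)))"
    by (intro tendsto_intros ch)
  moreover have "(\<lambda>x. x) \<in> borel_measurable N" by (rule measurable_ident_sets[OF N(2)])
  ultimately show ?case using gen[OF M X] gen[OF N(1), of "\<lambda>x. x"] by simp
next
  case (plus f g)
  have int: "integrable L (\<lambda>\<omega>. f (Y \<omega>))" if L: "prob_space L" and Y: "Y \<in> borel_measurable L"
     and f: "trig f" for L :: "'c measure" and Y :: "'c \<Rightarrow> real^'p" and f
  proof -
    interpret prob_space L by fact
    note [measurable] = Y
    obtain B where "\<And>x. \<bar>f x\<bar> \<le> B" using trig_bounded[OF f] by blast
    moreover have [measurable]: "f \<in> borel_measurable borel"
      using trig_continuous[OF f] by (auto intro: borel_measurable_continuous_onI)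
    ultimately show ?thesis by (intro integrable_const_bound[of _ B]) auto
  qed
  have id: "(\<lambda>x. x) \<in> borel_measurable N" by (rule measurable_ident_sets[OF N(2)])
  show ?case
    using tendsto_add[OF plus(2,4)] int[OF M X plus(1)] int[OF M X plus(3)]
      int[OF N(1) id plus(1)] int[OF N(1) id plus(3)] by simp
qed

text \<open>
  Tightness is only required asymptotically, which is what a perturbation argument provides.
\<close>

lemma levy_continuity_vector:
  fixes X :: "nat \<Rightarrow> 'w \<Rightarrow> real^'p"
  assumes M: "prob_space M" and N: "prob_space N" "sets N = sets borel"
    and X: "\<And>k. X k \<in> borel_measurable M"
    and tight: "\<And>\<epsilon>. \<epsilon> > 0 \<Longrightarrow> \<exists>K. \<forall>\<^sub>F k in sequentially. measure M {\<omega>\<in>space M. norm (X k \<omega>) > K} \<le> \<epsilon>"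
    and ch: "\<And>v. (\<lambda>k. CLINT \<omega>|M. iexp (v \<bullet> X k \<omega>)) \<longlonglongrightarrow> (CLINT x|N. iexp (v \<bullet> x))"
  shows "converges_in_distribution M X N"
  unfolding converges_in_distribution_def
proof (intro conjI allI impI)
  fix g :: "real^'p \<Rightarrow> real" assume "continuous_on UNIV g \<and> bounded (range g)"
  then obtain B where g: "continuous_on UNIV g" and B: "\<And>x. \<bar>g x\<bar> \<le> B" by (auto simp: bounded_real)
  have Bp: "B \<ge> 0" using B[of 0] by linarith
  interpret N: prob_space N by fact
  have id: "(\<lambda>x. x) \<in> borel_measurable N" by (rule measurable_ident_sets[OF N(2)])
  show "(\<lambda>k. \<integral>\<omega>. g (X k \<omega>) \<partial>M) \<longlonglongrightarrow> (\<integral>x. g x \<partial>N)"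
  proof (rule LIMSEQ_I, unfold real_norm_def)
    fix r :: real assume r: "r > 0"
    define e where "e = min 1 (r / (4 * (B + 1) + 4))"
    have den: "4 * (B + 1) + 4 > 0" using Bp by simp
    have e: "e > 0" "e \<le> 1" using r den by (auto simp: e_def)
    have er: "e + (2 * B + e) * e < r / 2"
    proof -
      have "e + (2 * B + e) * e \<le> (2 * (B + 1)) * e"
      proof -
        have "e * e \<le> 1 * e" using e by (intro mult_right_mono) auto
        then show ?thesis by (simp add: algebra_simps)
      qed
      also have "\<dots> \<le> (2 * (B + 1)) * (r / (4 * (B + 1) + 4))" using Bp by (intro mult_left_mono) (auto simp: e_def)
      also have "\<dots> < r / 2" using Bp r by (simp add: field_simps)
      finally show ?thesis .
    qed
    obtain K1 where K1: "\<forall>\<^sub>F k in sequentially. measure M {\<omega>\<in>space M. norm (X k \<omega>) > K1} \<le> e"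
      using tight[OF e(1)] by blast
    have "(\<lambda>n. measure N {x\<in>space N. norm x > real n}) \<longlonglongrightarrow> measure N (\<Inter>n. {x\<in>space N. norm x > real n})"
    proof (rule N.finite_Lim_measure_decseq)
      show "range (\<lambda>n. {x \<in> space N. real n < norm x}) \<subseteq> sets N" using id by (auto)
      show "decseq (\<lambda>n. {x \<in> space N. real n < norm x})" by (auto simp: decseq_def)
    qed
    moreover have "(\<Inter>n. {x\<in>space N. norm x > real n}) = {}"
      by auto (meson not_less real_arch_simple)
    ultimately have "(\<lambda>n. measure N {x\<in>space N. norm x > real n}) \<longlonglongrightarrow> 0" by simp
    then have "\<forall>\<^sub>F n in sequentially. measure N {x\<in>space N. norm x > real n} < e"
      by (rule order_tendstoD(2)[OF _ e(1)])
    then obtain n0 where n0: "\<And>n. n \<ge> n0 \<Longrightarrow> measure N {x\<in>space N. norm x > real n} < e"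
      by (auto simp: eventually_sequentially)
    \<comment> \<open>a radius that is large enough for both the limit law and the sequence\<close>
    define n1 where "n1 = max n0 (nat \<lceil>K1\<rceil>)"
    define K where "K = real n1"
    have KN: "measure N {x\<in>space N. norm x > K} \<le> e" using n0[of n1] by (simp add: K_def n1_def)
    have K1K: "K1 \<le> K" unfolding K_def n1_def by linarith
    obtain h where h: "trig h" "\<And>x. norm x \<le> K \<Longrightarrow> \<bar>g x - h x\<bar> \<le> e" "\<And>x. \<bar>h x\<bar> \<le> B + e"
      using trig_approximation[OF g B e(1)] by blast
    have hN: "\<bar>(\<integral>x. g x \<partial>N) - (\<integral>x. h x \<partial>N)\<bar> \<le> e + (2 * B + e) * e"
      using e by (intro expectation_diff_le[OF N(1) id g B trig_continuous[OF h(1)] h(3) h(2) KN]) auto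
    define b where "b = e + (2 * B + e) * e"
    define \<delta> where "\<delta> = r - 2 * b"
    have "\<delta> > 0" using er unfolding \<delta>_def b_def[symmetric] by linarith
    then have "\<forall>\<^sub>F k in sequentially. \<bar>(\<integral>\<omega>. h (X k \<omega>) \<partial>M) - (\<integral>x. h x \<partial>N)\<bar> < \<delta>"
      using tendstoD[OF trig_expectation_tendsto[OF M N X ch h(1)]] by (simp only: dist_real_def)
    then have "\<forall>\<^sub>F k in sequentially. \<bar>(\<integral>\<omega>. g (X k \<omega>) \<partial>M) - (\<integral>x. g x \<partial>N)\<bar> < r"
      using K1
    proof eventually_elim
      case (elim k)
      interpret M: prob_space M by fact
      have "measure M {\<omega>\<in>space M. norm (X k \<omega>) > K} \<le> measure M {\<omega>\<in>space M. norm (X k \<omega>) > K1}"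
        using K1K X[of k] by (intro M.finite_measure_mono) auto
      then have "measure M {\<omega>\<in>space M. norm (X k \<omega>) > K} \<le> e" using elim by linarith
      then have "\<bar>(\<integral>\<omega>. g (X k \<omega>) \<partial>M) - (\<integral>\<omega>. h (X k \<omega>) \<partial>M)\<bar> \<le> e + (2 * B + e) * e"
        using e by (intro expectation_diff_le[OF M X g B trig_continuous[OF h(1)] h(3) h(2)]) auto
      then show ?case using elim hN unfolding \<delta>_def b_def[symmetric] by linarith
    qed
    then show "\<exists>no. \<forall>n\<ge>no. \<bar>(\<integral>\<omega>. g (X n \<omega>) \<partial>M) - (\<integral>x. g x \<partial>N)\<bar> < r"
      by (simp add: eventually_sequentially)
  qed
qed (use assms in auto)


section \<open>Power inequalities\<close>

lemma even_power_nonneg: "0 \<le> (x::real) ^ (2 * r + 2)"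
  by (rule zero_le_even_power) simp

text \<open>
  Compare \<open>w x\<^sup>2\<close> with \<open>a\<^sup>2\<close>. The free weight \<open>w\<close> will be the number of steps of the martingale, so that the
  first term contributes a factor \<open>1 + O(1/n)\<close> per step.
\<close>

lemma young_power:
  fixes a x w :: real
  assumes "w > 0"
  shows "a ^ (2 * r) * x\<^sup>2 \<le> a ^ (2 * r + 2) / w + w ^ r * x ^ (2 * r + 2)"
proof (cases "w * x\<^sup>2 \<le> a\<^sup>2")
  case True
  then have "x\<^sup>2 \<le> a\<^sup>2 / w" using assms by (simp add: field_simps)
  then have "a ^ (2 * r) * x\<^sup>2 \<le> a ^ (2 * r) * (a\<^sup>2 / w)" by (intro mult_left_mono) auto
  also have "\<dots> = a ^ (2 * r + 2) / w" by (simp add: power_add power2_eq_square)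
  moreover have "0 \<le> w ^ r * x ^ (2 * r + 2)"
    using assms by (intro mult_nonneg_nonneg even_power_nonneg) auto
  ultimately show ?thesis by linarith
next
  case False
  then have "(a\<^sup>2) ^ r \<le> (w * x\<^sup>2) ^ r" by (intro power_mono) auto
  then have "a ^ (2 * r) * x\<^sup>2 \<le> (w * x\<^sup>2) ^ r * x\<^sup>2" by (intro mult_right_mono) (auto simp: power_mult)
  also have "\<dots> = w ^ r * x ^ (2 * r + 2)"
    by (simp add: power_mult power_mult_distrib power_add power2_eq_square)
  moreover have "0 \<le> a ^ (2 * r + 2) / w"
    using assms by (intro divide_nonneg_nonneg even_power_nonneg) auto
  ultimately show ?thesis by linarith
qed

text \<open>
  The binomial terms of order at least two in \<open>x\<close> are all dominated by \<open>a\<^bsup>2r\<^esup> x\<^sup>2 + x\<^bsup>2r+2\<^esup>\<close>; the term of first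
  order is kept, because its expectation vanishes for a martingale.
\<close>

lemma power_add_second_order:
  fixes a x w :: real
  assumes w: "w > 0"
  shows "(a + x) ^ (2 * r + 2) \<le> a ^ (2 * r + 2) + real (2 * r + 2) * (a ^ (2 * r + 1) * x)
     + 4 ^ (r + 1) * (a ^ (2 * r + 2) / w + (w ^ r + 1) * x ^ (2 * r + 2))"
proof -
  let ?n = "2 * r + 2"
  let ?R = "a ^ ?n / w + (w ^ r + 1) * x ^ ?n"
  have xn: "0 \<le> x ^ ?n" "0 \<le> a ^ ?n" by (rule even_power_nonneg)+
  have wx: "0 \<le> w ^ r * x ^ ?n" using w by (intro mult_nonneg_nonneg xn) auto
  have aw: "0 \<le> a ^ ?n / w" using w by (intro divide_nonneg_nonneg xn) auto
  have wx1: "w ^ r * x ^ ?n + x ^ ?n = (w ^ r + 1) * x ^ ?n" by (simp only: distrib_right mult_1_left)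
  have R: "0 \<le> ?R" using wx aw xn wx1 by linarith
  have term_le: "x ^ j * a ^ (?n - j) \<le> ?R" if j: "j \<in> {2..?n}" for j
  proof -
    obtain i where i: "j = i + 2" "i \<le> 2 * r" using j by (auto simp: le_iff_add add.commute)
    have "x ^ j * a ^ (?n - j) \<le> \<bar>x\<bar> ^ j * \<bar>a\<bar> ^ (?n - j)"
      using abs_ge_self[of "x ^ j * a ^ (?n - j)"] by (simp only: abs_mult power_abs)
    also have "\<dots> \<le> ?R"
    proof (cases "\<bar>x\<bar> \<le> \<bar>a\<bar>")
      case True
      have "\<bar>x\<bar> ^ j * \<bar>a\<bar> ^ (?n - j) = \<bar>x\<bar> ^ i * x\<^sup>2 * \<bar>a\<bar> ^ (2 * r - i)"
      proof -
        have "?n - (i + 2) = 2 * r - i" by simp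
        then show ?thesis by (simp only: i(1) power_add power2_abs)
      qed
      also have "\<dots> \<le> \<bar>a\<bar> ^ i * x\<^sup>2 * \<bar>a\<bar> ^ (2 * r - i)"
        using True by (intro mult_right_mono power_mono) auto
      also have "\<dots> = \<bar>a\<bar> ^ (i + (2 * r - i)) * x\<^sup>2" by (simp add: power_add)
      also have "\<dots> = a ^ (2 * r) * x\<^sup>2" using i by (simp add: power_mult)
      also have "\<dots> \<le> a ^ ?n / w + w ^ r * x ^ ?n" by (rule young_power[OF w])
      also have "\<dots> \<le> ?R" using xn wx1 by linarith
      finally show ?thesis .
    next
      case False
      then have "\<bar>x\<bar> ^ j * \<bar>a\<bar> ^ (?n - j) \<le> \<bar>x\<bar> ^ j * \<bar>x\<bar> ^ (?n - j)"
        by (intro mult_left_mono power_mono) auto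
      also have "\<dots> = \<bar>x\<bar> ^ ?n" using j by (simp add: power_add[symmetric])
      also have "\<dots> = x ^ ?n" by (rule power_even_abs) simp
      also have "\<dots> \<le> ?R" using wx aw wx1 by linarith
      finally show ?thesis .
    qed
    finally show ?thesis .
  qed
  have split: "{..?n} = {0, 1} \<union> {2..?n}" by auto
  define T where "T = (\<Sum>j\<in>{2..?n}. real (?n choose j) * (x ^ j * a ^ (?n - j)))"
  have "(a + x) ^ ?n = (\<Sum>j\<le>?n. real (?n choose j) * x ^ j * a ^ (?n - j))"
    by (subst add.commute) (rule binomial_ring)
  also have "\<dots> = a ^ ?n + real ?n * (a ^ (2 * r + 1) * x) + T"
    unfolding split T_def by (subst sum.union_disjoint) (auto simp: mult_ac)
  finally have eq: "(a + x) ^ ?n = a ^ ?n + real ?n * (a ^ (2 * r + 1) * x) + T" .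
  have "T \<le> (\<Sum>j\<in>{2..?n}. real (?n choose j) * ?R)"
    unfolding T_def using term_le by (intro sum_mono mult_left_mono) auto
  also have "\<dots> = (\<Sum>j\<in>{2..?n}. real (?n choose j)) * ?R" by (rule sum_distrib_right[symmetric])
  also have "\<dots> \<le> 4 ^ (r + 1) * ?R"
  proof (rule mult_right_mono[OF _ R])
    have "(\<Sum>j\<in>{2..?n}. real (?n choose j)) \<le> (\<Sum>j\<le>?n. real (?n choose j))"
      by (intro sum_mono2) auto
    also have "\<dots> = real (2 ^ ?n)"
      using choose_row_sum[of ?n] by (metis of_nat_sum)
    also have "\<dots> = 4 ^ (r + 1)" by (simp add: power_mult power_add)
    finally show "(\<Sum>j\<in>{2..?n}. real (?n choose j)) \<le> 4 ^ (r + 1)" .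
  qed
  finally show ?thesis unfolding eq by (rule add_left_mono)
qed

lemma discrete_gronwall:
  fixes m :: "nat \<Rightarrow> real"
  assumes c: "c \<ge> 0" and D: "D \<ge> 0" and m0: "m 0 = 0"
    and step: "\<And>s. s < n \<Longrightarrow> m (Suc s) \<le> (1 + c) * m s + D"
  shows "s \<le> n \<Longrightarrow> m s \<le> real s * D * (1 + c) ^ s"
proof (induct s)
  case 0 show ?case by (simp add: m0)
next
  case (Suc s)
  have "m (Suc s) \<le> (1 + c) * m s + D" using Suc by (intro step) auto
  also have "\<dots> \<le> (1 + c) * (real s * D * (1 + c) ^ s) + D * (1 + c) ^ Suc s"
  proof (rule add_mono)
    show "(1 + c) * m s \<le> (1 + c) * (real s * D * (1 + c) ^ s)" using Suc c by (intro mult_left_mono) auto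
    have "1 \<le> (1 + c) ^ Suc s" using c by (intro one_le_power) auto
    then show "D \<le> D * (1 + c) ^ Suc s" using D by (metis mult.right_neutral mult_left_mono)
  qed
  also have "\<dots> = real (Suc s) * D * (1 + c) ^ Suc s" by (simp add: algebra_simps)
  finally show ?case .
qed

lemma abs_power_le_one_plus: "j \<le> 2 * q \<Longrightarrow> \<bar>x\<bar> ^ j \<le> 1 + (x::real) ^ (2 * q)"
proof (cases "\<bar>x\<bar> \<le> 1")
  case True
  then have "\<bar>x\<bar> ^ j \<le> 1" by (simp add: power_le_one)
  moreover have "0 \<le> x ^ (2 * q)" by (rule zero_le_even_power')
  ultimately show ?thesis by linarith
next
  case False assume "j \<le> 2 * q"
  then have "\<bar>x\<bar> ^ j \<le> \<bar>x\<bar> ^ (2 * q)" using False by (intro power_increasing) auto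
  then show ?thesis by (simp add: power_mult)
qed

lemma (in prob_space) integrable_lower_power:
  fixes f :: "'a \<Rightarrow> real"
  assumes f: "f \<in> borel_measurable M" "integrable M (\<lambda>\<omega>. f \<omega> ^ (2 * q))" and "j \<le> 2 * q"
  shows "integrable M (\<lambda>\<omega>. f \<omega> ^ j)"
proof (rule Bochner_Integration.integrable_bound)
  show "integrable M (\<lambda>\<omega>. 1 + f \<omega> ^ (2 * q))" using f by simp
  show "(\<lambda>\<omega>. f \<omega> ^ j) \<in> borel_measurable M" using f by simp
  show "AE \<omega> in M. norm (f \<omega> ^ j) \<le> norm (1 + f \<omega> ^ (2 * q))"
  proof (rule AE_I2)
    fix \<omega>
    have "norm (f \<omega> ^ j) = \<bar>f \<omega>\<bar> ^ j" by (simp add: power_abs)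
    also have "\<dots> \<le> 1 + f \<omega> ^ (2 * q)" by (rule abs_power_le_one_plus) fact
    finally show "norm (f \<omega> ^ j) \<le> norm (1 + f \<omega> ^ (2 * q))" by simp
  qed
qed

lemma power_even_add_le: "(a + b) ^ (2 * q) \<le> 4 ^ q * (a ^ (2 * q) + (b::real) ^ (2 * q))"
proof -
  have "\<bar>a + b\<bar> \<le> 2 * max \<bar>a\<bar> \<bar>b\<bar>" by linarith
  then have "\<bar>a + b\<bar> ^ (2 * q) \<le> (2 * max \<bar>a\<bar> \<bar>b\<bar>) ^ (2 * q)" by (intro power_mono) auto
  also have "\<dots> = 4 ^ q * max \<bar>a\<bar> \<bar>b\<bar> ^ (2 * q)" by (simp add: power_mult_distrib power_mult)
  also have "\<dots> \<le> 4 ^ q * (a ^ (2 * q) + b ^ (2 * q))"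
    by (intro mult_left_mono) (auto simp: max_def power_mult)
  finally show ?thesis by (simp add: power_mult)
qed

lemma (in prob_space) integrable_power_add:
  fixes f g :: "'a \<Rightarrow> real"
  assumes "f \<in> borel_measurable M" "g \<in> borel_measurable M"
    "integrable M (\<lambda>\<omega>. f \<omega> ^ (2 * q))" "integrable M (\<lambda>\<omega>. g \<omega> ^ (2 * q))"
  shows "integrable M (\<lambda>\<omega>. (f \<omega> + g \<omega>) ^ (2 * q))"
    "expectation (\<lambda>\<omega>. (f \<omega> + g \<omega>) ^ (2 * q)) \<le>
       4 ^ q * (expectation (\<lambda>\<omega>. f \<omega> ^ (2 * q)) + expectation (\<lambda>\<omega>. g \<omega> ^ (2 * q)))"
proof -
  have i: "integrable M (\<lambda>\<omega>. 4 ^ q * (f \<omega> ^ (2 * q) + g \<omega> ^ (2 * q)))" using assms by auto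
  show *: "integrable M (\<lambda>\<omega>. (f \<omega> + g \<omega>) ^ (2 * q))"
    by (rule Bochner_Integration.integrable_bound[OF i])
      (use assms in \<open>auto simp: power_mult intro!: AE_I2 power_even_add_le[unfolded power_mult]\<close>)
  have "expectation (\<lambda>\<omega>. (f \<omega> + g \<omega>) ^ (2 * q)) \<le> expectation (\<lambda>\<omega>. 4 ^ q * (f \<omega> ^ (2 * q) + g \<omega> ^ (2 * q)))"
    by (intro integral_mono * i power_even_add_le)
  then show "expectation (\<lambda>\<omega>. (f \<omega> + g \<omega>) ^ (2 * q)) \<le>
       4 ^ q * (expectation (\<lambda>\<omega>. f \<omega> ^ (2 * q)) + expectation (\<lambda>\<omega>. g \<omega> ^ (2 * q)))"
    using assms by simp
qed

section \<open>Martingale transforms of an innovation sequence\<close>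

text \<open>
  A sequence \<open>X\<close> together with a filtration \<open>F\<close> such that \<open>X\<^sub>k\<close> is independent of \<open>F\<^sub>k\<close> and known at time \<open>k + 1\<close>.
  Both the sequence that drives the data and the equation noise are of this kind, for different
  filtrations.
\<close>

locale innovations = prob_space M for M :: "'w measure" +
  fixes F :: "nat \<Rightarrow> 'w measure" and X :: "nat \<Rightarrow> 'w \<Rightarrow> real"
  assumes space_F [simp]: "space (F k) = space M"
    and F_sub: "sets (F k) \<subseteq> sets M"
    and F_Suc: "sets (F k) \<subseteq> sets (F (Suc k))"
    and X_adapted: "X k \<in> borel_measurable (F (Suc k))"
    and indep_past: "indep_set {X k -` S \<inter> space M |S. S \<in> sets borel} (sets (F k))"
begin

lemma adapted_mono: "f \<in> measurable (F j) N \<Longrightarrow> j \<le> k \<Longrightarrow> f \<in> measurable (F k) N"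
  using lift_Suc_mono_le[of "\<lambda>k. sets (F k)", OF F_Suc, of j k] by (auto simp: measurable_def)

lemma adapted_measurable: "f \<in> measurable (F k) N \<Longrightarrow> f \<in> measurable M N"
  using F_sub[of k] by (auto simp: measurable_def)

lemma X_measurable [measurable]: "X k \<in> borel_measurable M"
  using adapted_measurable[OF X_adapted] .

lemma indep_var_past:
  fixes U :: "'w \<Rightarrow> real"
  assumes U: "U \<in> measurable (F k) N"
  shows "indep_var N U borel (X k)"
proof -
  have "indep_set {U -` A \<inter> space M |A. A \<in> sets N} {X k -` A \<inter> space M |A. A \<in> sets borel}"
  proof (rule indep_setI)
    have UF: "U -` A \<inter> space M \<in> sets (F k)" if "A \<in> sets N" for A
      using measurable_sets[OF U that] by simp
    show "{U -` A \<inter> space M |A. A \<in> sets N} \<subseteq> events" using UF F_sub by blast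
    show "{X k -` A \<inter> space M |A. A \<in> sets borel} \<subseteq> events" by (auto intro: measurable_sets)
    fix a b assume "a \<in> {U -` A \<inter> space M |A. A \<in> sets N}" "b \<in> {X k -` A \<inter> space M |A. A \<in> sets borel}"
    then have "prob (b \<inter> a) = prob b * prob a" using indep_setD[OF indep_past] UF by blast
    then show "prob (a \<inter> b) = prob a * prob b" by (simp add: Int_commute mult.commute)
  qed
  moreover have "(\<lambda>i. {case_bool U (X k) i -` A \<inter> space M |A. A \<in> sets (case_bool N borel i)}) =
     case_bool {U -` A \<inter> space M |A. A \<in> sets N} {X k -` A \<inter> space M |A. A \<in> sets borel}"
    by (intro ext) (auto split: bool.split)
  moreover have "case_bool U (X k) i \<in> measurable M (case_bool N borel i)" for i
    using adapted_measurable[OF U] by (cases i) auto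
  ultimately show ?thesis
    unfolding indep_var_def indep_vars_def2 indep_set_def by simp
qed

lemma innovations_compose:
  assumes [measurable]: "\<psi> \<in> borel_measurable borel"
  shows "innovations M F (\<lambda>k \<omega>. \<psi> (X k \<omega>))"
proof
  fix k
  show "(\<lambda>\<omega>. \<psi> (X k \<omega>)) \<in> borel_measurable (F (Suc k))"
    using measurable_compose[OF X_adapted assms] .
  have "(\<lambda>\<omega>. \<psi> (X k \<omega>)) -` S \<inter> space M \<in> {X k -` S \<inter> space M |S. S \<in> sets borel}"
    if "S \<in> sets borel" for S
    using measurable_sets_borel[OF assms that] by (auto intro!: exI[of _ "\<psi> -` S"])
  then show "indep_set {(\<lambda>\<omega>. \<psi> (X k \<omega>)) -` S \<inter> space M |S. S \<in> sets borel} (sets (F k))"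
    using indep_past unfolding indep_set_def
    by (rule_tac indep_sets_mono_sets) (auto split: bool.split)
qed (use F_sub F_Suc in auto)

lemma product_past:
  assumes U: "U \<in> borel_measurable (F k)" "integrable M U" and "integrable M (X k)"
  shows "integrable M (\<lambda>\<omega>. U \<omega> * X k \<omega>)"
    "expectation (\<lambda>\<omega>. U \<omega> * X k \<omega>) = expectation U * expectation (X k)"
  using indep_var_integrable[OF indep_var_past[OF U(1)]] indep_var_lebesgue_integral[OF indep_var_past[OF U(1)]] assms
  by auto

text \<open>
  Independence makes the joint law of the past quantity \<open>U\<close> and of \<open>X\<^sub>k\<close> a product, so the expectation over \<open>X\<^sub>k\<close>
  can be taken first with \<open>U\<close> held fixed.
\<close>

lemma expectation_freeze_past:
  fixes g :: "'u \<times> real \<Rightarrow> 'b::{banach, second_countable_topology}"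
  assumes U: "U \<in> measurable (F k) N" and g [measurable]: "g \<in> borel_measurable (N \<Otimes>\<^sub>M borel)"
    and int: "integrable M (\<lambda>\<omega>. g (U \<omega>, X k \<omega>))"
  shows "(\<integral>\<omega>. g (U \<omega>, X k \<omega>) \<partial>M) = (\<integral>\<omega>. (\<integral>\<omega>'. g (U \<omega>, X k \<omega>') \<partial>M) \<partial>M)"
proof -
  have [measurable]: "U \<in> measurable M N" by (rule adapted_measurable[OF U])
  let ?A = "distr M N U" and ?B = "distr M borel (X k)"
  interpret A: prob_space ?A by (rule prob_space_distr) simp
  interpret B: prob_space ?B by (rule prob_space_distr) simp
  interpret AB: pair_prob_space ?A ?B ..
  have d: "?A \<Otimes>\<^sub>M ?B = distr M (N \<Otimes>\<^sub>M borel) (\<lambda>\<omega>. (U \<omega>, X k \<omega>))"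
  proof (rule pair_measure_eqI)
    fix A B assume A: "A \<in> sets ?A" and B: "B \<in> sets ?B"
    then have UA: "U -` A \<inter> space M \<in> sets (F k)" using measurable_sets[OF U, of A] by simp
    then have "U -` A \<inter> space M \<in> sets M" using F_sub by blast
    moreover have "X k -` B \<inter> space M \<in> sets M" using B by (auto intro: measurable_sets)
    moreover have "prob ((X k -` B \<inter> space M) \<inter> (U -` A \<inter> space M)) = prob (X k -` B \<inter> space M) * prob (U -` A \<inter> space M)"
      using B by (intro indep_setD[OF indep_past _ UA]) auto
    moreover have "(\<lambda>\<omega>. (U \<omega>, X k \<omega>)) -` (A \<times> B) \<inter> space M = (X k -` B \<inter> space M) \<inter> (U -` A \<inter> space M)" by auto
    ultimately show "emeasure ?A A * emeasure ?B B = emeasure (distr M (N \<Otimes>\<^sub>M borel) (\<lambda>\<omega>. (U \<omega>, X k \<omega>))) (A \<times> B)"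
      using A B by (simp add: emeasure_distr emeasure_eq_measure ennreal_mult[symmetric] mult.commute)
  qed (auto intro: A.sigma_finite_measure_axioms B.sigma_finite_measure_axioms)
  have "integrable (?A \<Otimes>\<^sub>M ?B) g"
    unfolding d using int by (subst integrable_distr_eq) auto
  then have "integrable (?A \<Otimes>\<^sub>M ?B) (\<lambda>(x, y). g (x, y))" by simp
  from AB.integral_fst[OF this]
  have "(\<integral>x. (\<integral>y. g (x, y) \<partial>?B) \<partial>?A) = integral\<^sup>L (?A \<Otimes>\<^sub>M ?B) g" by simp
  also have "\<dots> = (\<integral>\<omega>. g (U \<omega>, X k \<omega>) \<partial>M)" unfolding d by (rule integral_distr) auto
  finally have "(\<integral>\<omega>. g (U \<omega>, X k \<omega>) \<partial>M) = (\<integral>x. (\<integral>y. g (x, y) \<partial>?B) \<partial>?A)" by simp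
  also have "\<dots> = (\<integral>\<omega>. (\<integral>y. g (U \<omega>, y) \<partial>?B) \<partial>M)" by (rule integral_distr) auto
  also have "\<dots> = (\<integral>\<omega>. (\<integral>\<omega>'. g (U \<omega>, X k \<omega>') \<partial>M) \<partial>M)"
  proof (rule Bochner_Integration.integral_cong[OF refl])
    fix \<omega> assume "\<omega> \<in> space M"
    then have "U \<omega> \<in> space N" using measurable_space[of U M N] by simp
    then have "(\<lambda>y. g (U \<omega>, y)) \<in> borel_measurable borel" by simp
    then show "(\<integral>y. g (U \<omega>, y) \<partial>?B) = (\<integral>\<omega>'. g (U \<omega>, X k \<omega>') \<partial>M)" by (intro integral_distr) auto
  qed
  finally show ?thesis .
qed

lemma transform_adapted:
  assumes "\<And>s. s < n \<Longrightarrow> z s \<in> borel_measurable (F s)"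
  shows "(\<lambda>\<omega>. \<Sum>s<n. z s \<omega> * X s \<omega>) \<in> borel_measurable (F n)"
proof (intro borel_measurable_sum borel_measurable_times)
  fix s assume "s \<in> {..<n}"
  then show "z s \<in> borel_measurable (F n)" "X s \<in> borel_measurable (F n)"
    using adapted_mono[OF assms, of s n] adapted_mono[OF X_adapted, of s n] by auto
qed

lemma product_power_past:
  fixes U :: "'w \<Rightarrow> real"
  assumes U: "U \<in> borel_measurable (F k)" "integrable M (\<lambda>\<omega>. U \<omega> ^ j)" and X: "integrable M (\<lambda>\<omega>. X k \<omega> ^ j)"
  shows "integrable M (\<lambda>\<omega>. (U \<omega> * X k \<omega>) ^ j)"
    "expectation (\<lambda>\<omega>. (U \<omega> * X k \<omega>) ^ j) = expectation (\<lambda>\<omega>. U \<omega> ^ j) * expectation (\<lambda>\<omega>. X k \<omega> ^ j)"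
proof -
  interpret J: innovations M F "\<lambda>k \<omega>. X k \<omega> ^ j" by (rule innovations_compose) simp
  show "integrable M (\<lambda>\<omega>. (U \<omega> * X k \<omega>) ^ j)"
    "expectation (\<lambda>\<omega>. (U \<omega> * X k \<omega>) ^ j) = expectation (\<lambda>\<omega>. U \<omega> ^ j) * expectation (\<lambda>\<omega>. X k \<omega> ^ j)"
    using J.product_past[of "\<lambda>\<omega>. U \<omega> ^ j" k] U X by (simp_all add: power_mult_distrib)
qed

text \<open>
  With \<open>m\<^sub>k\<close> for the \<open>2q\<close>-th moment of the partial sum up to \<open>k\<close>, the second-order expansion of the power with
  weight \<open>n\<close> gives \<open>m\<^bsub>k+1\<^esub> \<le> (1 + 4\<^sup>q / n) m\<^sub>k + O(n\<^bsup>q-1\<^esup>)\<close>, because the first-order term has expectation zero.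
  Over \<open>n\<close> steps the factors stay below \<open>exp (4\<^sup>q)\<close> and the increments add up to \<open>O(n\<^sup>q)\<close>.
\<close>

lemma martingale_transform_moment:
  assumes q: "q \<ge> 1"
    and z: "\<And>s. s < n \<Longrightarrow> z s \<in> borel_measurable (F s)"
    and zi: "\<And>s. s < n \<Longrightarrow> integrable M (\<lambda>\<omega>. z s \<omega> ^ (2 * q))"
    and zB: "\<And>s. s < n \<Longrightarrow> expectation (\<lambda>\<omega>. z s \<omega> ^ (2 * q)) \<le> B"
    and Xi: "\<And>s. s < n \<Longrightarrow> integrable M (\<lambda>\<omega>. X s \<omega> ^ (2 * q))"
    and XB: "\<And>s. s < n \<Longrightarrow> expectation (\<lambda>\<omega>. X s \<omega> ^ (2 * q)) \<le> B'"
    and X0: "\<And>s. s < n \<Longrightarrow> expectation (X s) = 0"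
  shows "integrable M (\<lambda>\<omega>. (\<Sum>s<n. z s \<omega> * X s \<omega>) ^ (2 * q))"
    "expectation (\<lambda>\<omega>. (\<Sum>s<n. z s \<omega> * X s \<omega>) ^ (2 * q)) \<le> 2 * 4 ^ q * exp (4 ^ q) * (B * B') * real n ^ q"
    "integrable M (\<lambda>\<omega>. \<Sum>s<n. z s \<omega> * X s \<omega>)" "expectation (\<lambda>\<omega>. \<Sum>s<n. z s \<omega> * X s \<omega>) = 0"
proof -
  obtain r where r: "q = r + 1" using q by (metis add.commute le_iff_add)
  have q2: "2 * q = 2 * r + 2" by (simp add: r)
  define S where "S = (\<lambda>k \<omega>. \<Sum>s<k. z s \<omega> * X s \<omega>)"
  have SF: "S k \<in> borel_measurable (F k)" if "k \<le> n" for k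
    unfolding S_def using that by (intro transform_adapted z) auto
  have SM: "S k \<in> borel_measurable M" if "k \<le> n" for k using adapted_measurable[OF SF[OF that]] .
  have zM: "z s \<in> borel_measurable M" if "s < n" for s using adapted_measurable[OF z[OF that]] .
  have zX: "integrable M (\<lambda>\<omega>. (z s \<omega> * X s \<omega>) ^ (2 * q))"
    "expectation (\<lambda>\<omega>. (z s \<omega> * X s \<omega>) ^ (2 * q)) \<le> B * B'" if "s < n" for s
  proof -
    note p = product_power_past[OF z[OF that] zi[OF that] Xi[OF that]]
    show "integrable M (\<lambda>\<omega>. (z s \<omega> * X s \<omega>) ^ (2 * q))" by (rule p(1))
    have "0 \<le> expectation (\<lambda>\<omega>. z s \<omega> ^ (2 * q))" "0 \<le> expectation (\<lambda>\<omega>. X s \<omega> ^ (2 * q))"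
      by (simp_all add: power_mult)
    then show "expectation (\<lambda>\<omega>. (z s \<omega> * X s \<omega>) ^ (2 * q)) \<le> B * B'"
      unfolding p(2) using zB[OF that] XB[OF that] by (intro mult_mono) linarith+
  qed
  have Si: "integrable M (\<lambda>\<omega>. S k \<omega> ^ (2 * q))" if "k \<le> n" for k
    using that
  proof (induct k)
    case 0 then show ?case using q by (simp add: S_def)
  next
    case (Suc k)
    have "integrable M (\<lambda>\<omega>. (S k \<omega> + z k \<omega> * X k \<omega>) ^ (2 * q))"
      using Suc zX(1)[of k] SM[of k] zM[of k] by (intro integrable_power_add) auto
    then show ?case by (simp add: S_def add.commute)
  qed
  have X1: "integrable M (X s)" if "s < n" for s
    using integrable_lower_power[of "X s" q 1] Xi[OF that] q by simp
  have z1: "integrable M (z s)" if "s < n" for s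
    using integrable_lower_power[of "z s" q 1] zi[OF that] zM[OF that] q by simp
  have cross: "integrable M (\<lambda>\<omega>. S k \<omega> ^ (2 * r + 1) * (z k \<omega> * X k \<omega>))"
    "expectation (\<lambda>\<omega>. S k \<omega> ^ (2 * r + 1) * (z k \<omega> * X k \<omega>)) = 0" if "k < n" for k
  proof -
    let ?U = "\<lambda>\<omega>. S k \<omega> ^ (2 * r + 1) * z k \<omega>"
    have UF: "?U \<in> borel_measurable (F k)" using SF[of k] z[of k] that by auto
    have "integrable M (\<lambda>\<omega>. S k \<omega> ^ (2 * q) + z k \<omega> ^ (2 * q))" using Si[of k] zi[of k] that by auto
    then have UI: "integrable M ?U"
    proof (rule Bochner_Integration.integrable_bound)
      show "?U \<in> borel_measurable M" by (rule adapted_measurable[OF UF])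
      have "norm (a ^ (2 * r + 1) * x) \<le> norm (a ^ (2 * q) + x ^ (2 * q))" for a x :: real
      proof -
        let ?m = "max \<bar>a\<bar> \<bar>x\<bar>"
        have "norm (a ^ (2 * r + 1) * x) = \<bar>a\<bar> ^ (2 * r + 1) * \<bar>x\<bar>" by (simp add: abs_mult power_abs)
        also have "\<dots> \<le> ?m ^ (2 * r + 1) * ?m" by (intro mult_mono power_mono) auto
        also have "\<dots> = ?m ^ (2 * q)" by (simp add: r)
        also have "\<dots> \<le> a ^ (2 * q) + x ^ (2 * q)" by (auto simp: max_def power_mult)
        finally show ?thesis by simp
      qed
      then show "AE \<omega> in M. norm (?U \<omega>) \<le> norm (S k \<omega> ^ (2 * q) + z k \<omega> ^ (2 * q))" by simp
    qed
    show "integrable M (\<lambda>\<omega>. S k \<omega> ^ (2 * r + 1) * (z k \<omega> * X k \<omega>))"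
      "expectation (\<lambda>\<omega>. S k \<omega> ^ (2 * r + 1) * (z k \<omega> * X k \<omega>)) = 0"
      using product_past[OF UF UI X1[OF that]] X0[OF that] by (simp_all add: mult.assoc)
  qed
  show int: "integrable M (\<lambda>\<omega>. (\<Sum>s<n. z s \<omega> * X s \<omega>) ^ (2 * q))"
    using Si[of n] by (simp add: S_def)
  have zX1: "integrable M (\<lambda>\<omega>. z s \<omega> * X s \<omega>)" "expectation (\<lambda>\<omega>. z s \<omega> * X s \<omega>) = 0" if "s < n" for s
    using product_past[OF z[OF that] z1[OF that] X1[OF that]] X0[OF that] by simp_all
  show "integrable M (\<lambda>\<omega>. \<Sum>s<n. z s \<omega> * X s \<omega>)"
    using zX1(1) by (intro Bochner_Integration.integrable_sum) auto
  show "expectation (\<lambda>\<omega>. \<Sum>s<n. z s \<omega> * X s \<omega>) = 0" using zX1 by simp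
  show "expectation (\<lambda>\<omega>. (\<Sum>s<n. z s \<omega> * X s \<omega>) ^ (2 * q)) \<le> 2 * 4 ^ q * exp (4 ^ q) * (B * B') * real n ^ q"
  proof (cases "n = 0")
    case True then show ?thesis using q by (simp add: power_0_left)
  next
    case False
    then have n: "real n \<ge> 1" by simp
    \<comment> \<open>the recursion for the moments, with the number of steps as weight\<close>
    define m where "m = (\<lambda>k. expectation (\<lambda>\<omega>. S k \<omega> ^ (2 * q)))"
    let ?c = "4 ^ q / real n" and ?D = "4 ^ q * ((real n ^ r + 1) * (B * B'))"
    have "0 \<le> expectation (\<lambda>\<omega>. (z 0 \<omega> * X 0 \<omega>) ^ (2 * q))" by (simp add: power_mult)
    then have BB: "B * B' \<ge> 0" using zX(2)[of 0] False by linarith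
    have step: "m (Suc k) \<le> (1 + ?c) * m k + ?D" if k: "k < n" for k
    proof -
      let ?x = "\<lambda>\<omega>. z k \<omega> * X k \<omega>"
      let ?rhs = "\<lambda>\<omega>. S k \<omega> ^ (2 * q) + real (2 * r + 2) * (S k \<omega> ^ (2 * r + 1) * ?x \<omega>)
         + 4 ^ q * (S k \<omega> ^ (2 * q) / real n + (real n ^ r + 1) * ?x \<omega> ^ (2 * q))"
      note I = Si[of k] cross(1)[OF k] zX(1)[OF k]
      have "m (Suc k) = expectation (\<lambda>\<omega>. (S k \<omega> + ?x \<omega>) ^ (2 * q))"
        by (simp add: m_def S_def add.commute)
      also have "\<dots> \<le> expectation ?rhs"
      proof (rule integral_mono)
        show "integrable M (\<lambda>\<omega>. (S k \<omega> + ?x \<omega>) ^ (2 * q))"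
          using Si[of "Suc k"] k by (simp add: S_def add.commute)
        show "integrable M ?rhs" using I k by auto
        show "(S k \<omega> + ?x \<omega>) ^ (2 * q) \<le> ?rhs \<omega>" for \<omega>
          using power_add_second_order[of "real n" "S k \<omega>" "?x \<omega>" r] n unfolding q2[symmetric] r[symmetric] by simp
      qed
      also have "\<dots> = m k + 4 ^ q * (m k / real n + (real n ^ r + 1) * expectation (\<lambda>\<omega>. ?x \<omega> ^ (2 * q)))"
        using I k cross(2)[OF k] by (simp add: m_def)
      also have "\<dots> \<le> m k + 4 ^ q * (m k / real n + (real n ^ r + 1) * (B * B'))"
        using zX(2)[OF k] by (intro add_left_mono mult_left_mono) auto
      also have "\<dots> = (1 + ?c) * m k + ?D" by (simp add: algebra_simps)
      finally show ?thesis .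
    qed
    have "m n \<le> real n * ?D * (1 + ?c) ^ n"
    proof (rule discrete_gronwall[where n = n])
      show "m 0 = 0" using q by (simp add: m_def S_def)
    qed (use step BB in auto)
    also have "\<dots> \<le> real n * (4 ^ q * ((2 * real n ^ r) * (B * B'))) * exp (4 ^ q)"
    proof -
      have "1 \<le> real n ^ r" using n by (simp add: one_le_power)
      then have D: "?D \<le> 4 ^ q * ((2 * real n ^ r) * (B * B'))"
        using BB by (intro mult_left_mono mult_right_mono) auto
      have D0: "0 \<le> 4 ^ q * ((2 * real n ^ r) * (B * B'))" by (rule mult_nonneg_nonneg[OF _ mult_nonneg_nonneg[OF _ BB]]) auto
      have "(1 + ?c) ^ n \<le> exp ?c ^ n" by (intro power_mono exp_ge_add_one_self) auto
      also have "\<dots> = exp (4 ^ q)" using False by (simp add: exp_of_nat_mult[symmetric])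
      finally have c: "(1 + ?c) ^ n \<le> exp (4 ^ q)" .
      show ?thesis by (rule mult_mono[OF mult_left_mono[OF D] c]) (use D0 in auto)
    qed
    also have "\<dots> = 2 * 4 ^ q * exp (4 ^ q) * (B * B') * real n ^ q" by (simp add: r algebra_simps)
    finally show ?thesis by (simp add: m_def S_def)
  qed
qed

text \<open>
  Given the past, the factor \<open>iexp (z\<^sub>s X\<^sub>s)\<close> has expectation \<open>exp (- v z\<^sub>s\<^sup>2 / 2)\<close>, which the other factor of
  step \<open>s\<close> cancels. The bound \<open>T\<close> is for integrability.
\<close>

lemma gaussian_exponential_martingale:
  assumes v: "v \<ge> 0" and ch: "\<And>s t. s < n \<Longrightarrow> (CLINT \<omega>|M. iexp (t * X s \<omega>)) = complex_of_real (exp (- (v * t\<^sup>2) / 2))"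
    and z: "\<And>s. s < n \<Longrightarrow> z s \<in> borel_measurable (F s)"
    and T: "\<And>\<omega>. \<omega> \<in> space M \<Longrightarrow> (\<Sum>s<n. (z s \<omega>)\<^sup>2) \<le> T"
  shows "(CLINT \<omega>|M. iexp (\<Sum>s<n. z s \<omega> * X s \<omega>) * complex_of_real (exp (v / 2 * (\<Sum>s<n. (z s \<omega>)\<^sup>2)))) = 1"
  using assms(2-)
proof (induct n)
  case 0 show ?case by (simp add: prob_space)
next
  case (Suc n)
  let ?U = "\<lambda>\<omega>. (iexp (\<Sum>s<n. z s \<omega> * X s \<omega>) * complex_of_real (exp (v / 2 * (\<Sum>s<Suc n. (z s \<omega>)\<^sup>2))), z n \<omega>)"
  let ?g = "\<lambda>p. fst (fst p) * iexp (snd (fst p) * snd p) :: complex"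
  have zF: "z s \<in> borel_measurable (F n)" if "s < Suc n" for s
    using adapted_mono[OF Suc.prems(2)[OF that], of n] that by auto
  have SF: "(\<lambda>\<omega>. \<Sum>s<n. z s \<omega> * X s \<omega>) \<in> borel_measurable (F n)"
    by (rule transform_adapted) (use Suc.prems in auto)
  have QF: "(\<lambda>\<omega>. \<Sum>s<Suc n. (z s \<omega>)\<^sup>2) \<in> borel_measurable (F n)"
    using zF by (intro borel_measurable_sum borel_measurable_power) auto
  have U: "?U \<in> measurable (F n) (borel \<Otimes>\<^sub>M borel)"
  proof -
    have "(\<lambda>\<omega>. iexp (\<Sum>s<n. z s \<omega> * X s \<omega>)) \<in> borel_measurable (F n)"
      by (rule measurable_compose[OF SF]) measurable
    moreover have "(\<lambda>\<omega>. complex_of_real (exp (v / 2 * (\<Sum>s<Suc n. (z s \<omega>)\<^sup>2)))) \<in> borel_measurable (F n)"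
      by (rule measurable_compose[OF QF]) measurable
    ultimately show ?thesis using zF[of n] by (intro measurable_Pair borel_measurable_times) auto
  qed
  have g: "?g \<in> borel_measurable ((borel \<Otimes>\<^sub>M borel) \<Otimes>\<^sub>M borel)" by measurable
  have split: "iexp (\<Sum>s<Suc n. z s \<omega> * X s \<omega>) * complex_of_real (exp (v / 2 * (\<Sum>s<Suc n. (z s \<omega>)\<^sup>2))) = ?g (?U \<omega>, X n \<omega>)" for \<omega>
    by (simp add: exp_add distrib_left mult_ac)
  have int: "integrable M (\<lambda>\<omega>. ?g (?U \<omega>, X n \<omega>))"
  proof (rule integrable_const_bound)
    show "(\<lambda>\<omega>. ?g (?U \<omega>, X n \<omega>)) \<in> borel_measurable M"
      using g adapted_measurable[OF U] by measurable
    show "AE \<omega> in M. norm (?g (?U \<omega>, X n \<omega>)) \<le> exp (v / 2 * T)"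
    proof (rule AE_I2)
      fix \<omega> assume "\<omega> \<in> space M"
      then have "v / 2 * (\<Sum>s<Suc n. (z s \<omega>)\<^sup>2) \<le> v / 2 * T" using Suc.prems(3) v by (intro mult_left_mono) auto
      then show "norm (?g (?U \<omega>, X n \<omega>)) \<le> exp (v / 2 * T)"
        by (simp add: norm_mult del: sum.lessThan_Suc)
    qed
  qed
  have "(CLINT \<omega>|M. ?g (?U \<omega>, X n \<omega>)) = (CLINT \<omega>|M. (CLINT \<omega>'|M. ?g (?U \<omega>, X n \<omega>')))"
    by (rule expectation_freeze_past[OF U g int])
  also have "\<dots> = (CLINT \<omega>|M. iexp (\<Sum>s<n. z s \<omega> * X s \<omega>) * complex_of_real (exp (v / 2 * (\<Sum>s<n. (z s \<omega>)\<^sup>2))))"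
  proof (rule Bochner_Integration.integral_cong[OF refl])
    fix \<omega>
    have "(CLINT \<omega>'|M. ?g (?U \<omega>, X n \<omega>')) = fst (?U \<omega>) * (CLINT \<omega>'|M. iexp (z n \<omega> * X n \<omega>'))"
      by (simp del: sum.lessThan_Suc of_real_mult)
    also have "\<dots> = fst (?U \<omega>) * complex_of_real (exp (- (v * (z n \<omega>)\<^sup>2) / 2))"
      by (subst Suc.prems(1)) auto
    also have "\<dots> = iexp (\<Sum>s<n. z s \<omega> * X s \<omega>) * complex_of_real (exp (v / 2 * (\<Sum>s<Suc n. (z s \<omega>)\<^sup>2)) * exp (- (v * (z n \<omega>)\<^sup>2) / 2))"
      by (simp del: sum.lessThan_Suc)
    also have "exp (v / 2 * (\<Sum>s<Suc n. (z s \<omega>)\<^sup>2)) * exp (- (v * (z n \<omega>)\<^sup>2) / 2) = exp (v / 2 * (\<Sum>s<n. (z s \<omega>)\<^sup>2))"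
      by (simp add: exp_add[symmetric] algebra_simps)
    finally show "(CLINT \<omega>'|M. ?g (?U \<omega>, X n \<omega>')) = iexp (\<Sum>s<n. z s \<omega> * X s \<omega>) * complex_of_real (exp (v / 2 * (\<Sum>s<n. (z s \<omega>)\<^sup>2)))" .
  qed
  also have "\<dots> = 1"
  proof (rule Suc.hyps)
    fix \<omega> assume "\<omega> \<in> space M"
    have "(\<Sum>s<n. (z s \<omega>)\<^sup>2) \<le> (\<Sum>s<Suc n. (z s \<omega>)\<^sup>2)" by simp
    then show "(\<Sum>s<n. (z s \<omega>)\<^sup>2) \<le> T" using Suc.prems(3)[OF \<open>\<omega> \<in> space M\<close>] by linarith
  qed (use Suc.prems in auto)
  finally show ?case unfolding split .
qed

end


section \<open>Quadratic forms of filtered innovations\<close>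

lemma sum_square_split:
  fixes a :: "nat \<Rightarrow> nat \<Rightarrow> 'a::comm_monoid_add"
  shows "(\<Sum>s<n. \<Sum>t<n. a s t) = (\<Sum>s<n. a s s) + (\<Sum>s<n. \<Sum>t<s. a s t + a t s)"
proof (induct n)
  case (Suc n)
  have "(\<Sum>s<Suc n. \<Sum>t<Suc n. a s t) = (\<Sum>s<n. \<Sum>t<n. a s t) + (\<Sum>s<n. a s n) + ((\<Sum>t<n. a n t) + a n n)"
    by (simp add: sum.distrib ac_simps)
  then show ?case unfolding Suc by (simp add: sum.distrib ac_simps)
qed simp

text \<open>
  Convexity of the even power, applied to the average with the weights \<open>|\<alpha>\<^sub>i| / A\<close>.
\<close>

lemma weighted_sum_power_le:
  fixes \<alpha> x :: "'i \<Rightarrow> real"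
  assumes I: "finite I" and q: "q \<ge> 1"
  defines "A \<equiv> \<Sum>i\<in>I. \<bar>\<alpha> i\<bar>"
  shows "(\<Sum>i\<in>I. \<alpha> i * x i) ^ (2 * q) \<le> (\<Sum>i\<in>I. \<bar>\<alpha> i\<bar> / A * (A ^ (2 * q) * x i ^ (2 * q)))"
proof (cases "A = 0")
  case True
  then have "\<forall>i\<in>I. \<alpha> i = 0" using I by (simp add: A_def sum_nonneg_eq_0_iff)
  then show ?thesis using q by (simp add: power_0_left)
next
  case False
  then have A: "A > 0" by (simp add: A_def less_le sum_nonneg)
  have ne: "I \<noteq> {}" using False by (auto simp: A_def)
  have "(\<Sum>i\<in>I. (\<bar>\<alpha> i\<bar> / A) *\<^sub>R (A * (sgn (\<alpha> i) * x i))) ^ (2 * q) \<le>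
     (\<Sum>i\<in>I. (\<bar>\<alpha> i\<bar> / A) * (A * (sgn (\<alpha> i) * x i)) ^ (2 * q))"
  proof (rule convex_on_sum[OF I ne])
    show "convex_on UNIV (\<lambda>x::real. x ^ (2 * q))" by (rule convex_power_even) simp
    show "(\<Sum>i\<in>I. \<bar>\<alpha> i\<bar> / A) = 1" using False by (simp add: A_def sum_divide_distrib[symmetric])
  qed (use A in auto)
  also have "(\<Sum>i\<in>I. (\<bar>\<alpha> i\<bar> / A) *\<^sub>R (A * (sgn (\<alpha> i) * x i))) = (\<Sum>i\<in>I. \<alpha> i * x i)"
    using A by (intro sum.cong) (auto simp: mult.assoc[symmetric] abs_mult_sgn)
  also have "(\<Sum>i\<in>I. (\<bar>\<alpha> i\<bar> / A) * (A * (sgn (\<alpha> i) * x i)) ^ (2 * q)) \<le> (\<Sum>i\<in>I. \<bar>\<alpha> i\<bar> / A * (A ^ (2 * q) * x i ^ (2 * q)))"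
  proof (rule sum_mono)
    fix i
    have "sgn (\<alpha> i) ^ (2 * q) \<le> 1" by (auto simp: sgn_real_def power_mult power_0_left)
    then have "sgn (\<alpha> i) ^ (2 * q) * x i ^ (2 * q) \<le> 1 * x i ^ (2 * q)"
      by (intro mult_right_mono) (auto simp: power_mult)
    then show "(\<bar>\<alpha> i\<bar> / A) * (A * (sgn (\<alpha> i) * x i)) ^ (2 * q) \<le> \<bar>\<alpha> i\<bar> / A * (A ^ (2 * q) * x i ^ (2 * q))"
      unfolding power_mult_distrib using A by (intro mult_left_mono) (auto simp: power_mult)
  qed
  finally show ?thesis .
qed

lemma (in prob_space) linear_combination_moment:
  fixes X :: "nat \<Rightarrow> 'a \<Rightarrow> real"
  assumes q: "q \<ge> 1" and X: "\<And>s. s < n \<Longrightarrow> X s \<in> borel_measurable M"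
    and Xi: "\<And>s. s < n \<Longrightarrow> integrable M (\<lambda>\<omega>. X s \<omega> ^ (2 * q))"
    and XB: "\<And>s. s < n \<Longrightarrow> expectation (\<lambda>\<omega>. X s \<omega> ^ (2 * q)) \<le> K"
    and A: "(\<Sum>s<n. \<bar>\<alpha> s\<bar>) \<le> H" and K: "K \<ge> 0"
  shows "integrable M (\<lambda>\<omega>. (\<Sum>s<n. \<alpha> s * X s \<omega>) ^ (2 * q))"
    "expectation (\<lambda>\<omega>. (\<Sum>s<n. \<alpha> s * X s \<omega>) ^ (2 * q)) \<le> H ^ (2 * q) * K"
proof -
  define a where "a = (\<Sum>s<n. \<bar>\<alpha> s\<bar>)"
  have a: "0 \<le> a" "a \<le> H" using A by (auto simp: a_def sum_nonneg)
  have pw: "(\<Sum>s<n. \<alpha> s * X s \<omega>) ^ (2 * q) \<le> (\<Sum>s<n. \<bar>\<alpha> s\<bar> / a * (a ^ (2 * q) * X s \<omega> ^ (2 * q)))" for \<omega>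
    using weighted_sum_power_le[of "{..<n}" q \<alpha> "\<lambda>s. X s \<omega>"] q by (simp add: a_def)
  have int: "integrable M (\<lambda>\<omega>. \<Sum>s<n. \<bar>\<alpha> s\<bar> / a * (a ^ (2 * q) * X s \<omega> ^ (2 * q)))"
    using Xi by (intro Bochner_Integration.integrable_sum) auto
  show i: "integrable M (\<lambda>\<omega>. (\<Sum>s<n. \<alpha> s * X s \<omega>) ^ (2 * q))"
  proof (rule Bochner_Integration.integrable_bound[OF int])
    show "(\<lambda>\<omega>. (\<Sum>s<n. \<alpha> s * X s \<omega>) ^ (2 * q)) \<in> borel_measurable M"
      using X by (intro borel_measurable_power borel_measurable_sum borel_measurable_times) auto
    show "AE \<omega> in M. norm ((\<Sum>s<n. \<alpha> s * X s \<omega>) ^ (2 * q)) \<le> norm (\<Sum>s<n. \<bar>\<alpha> s\<bar> / a * (a ^ (2 * q) * X s \<omega> ^ (2 * q)))"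
    proof (rule AE_I2)
      fix \<omega>
      have "0 \<le> (\<Sum>s<n. \<alpha> s * X s \<omega>) ^ (2 * q)" by (rule zero_le_even_power')
      then show "norm ((\<Sum>s<n. \<alpha> s * X s \<omega>) ^ (2 * q)) \<le> norm (\<Sum>s<n. \<bar>\<alpha> s\<bar> / a * (a ^ (2 * q) * X s \<omega> ^ (2 * q)))"
        using pw[of \<omega>] unfolding real_norm_def by linarith
    qed
  qed
  have "expectation (\<lambda>\<omega>. (\<Sum>s<n. \<alpha> s * X s \<omega>) ^ (2 * q)) \<le> expectation (\<lambda>\<omega>. \<Sum>s<n. \<bar>\<alpha> s\<bar> / a * (a ^ (2 * q) * X s \<omega> ^ (2 * q)))"
    by (rule integral_mono[OF i int pw])
  also have "\<dots> = (\<Sum>s<n. \<bar>\<alpha> s\<bar> / a * (a ^ (2 * q) * expectation (\<lambda>\<omega>. X s \<omega> ^ (2 * q))))"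
    using Xi by (subst Bochner_Integration.integral_sum) auto
  also have "\<dots> \<le> (\<Sum>s<n. \<bar>\<alpha> s\<bar> / a * (a ^ (2 * q) * K))"
    using XB a by (intro sum_mono mult_left_mono) auto
  also have "\<dots> = (\<Sum>s<n. \<bar>\<alpha> s\<bar>) / a * (a ^ (2 * q) * K)"
    by (simp only: sum_divide_distrib sum_distrib_right)
  also have "\<dots> \<le> a ^ (2 * q) * K" using K a by (simp add: a_def[symmetric])
  also have "\<dots> \<le> H ^ (2 * q) * K" using a K by (intro mult_right_mono power_mono) auto
  finally show "expectation (\<lambda>\<omega>. (\<Sum>s<n. \<alpha> s * X s \<omega>) ^ (2 * q)) \<le> H ^ (2 * q) * K" .
qed

lemma (in prob_space) moment_le_one_plus:
  fixes f :: "'a \<Rightarrow> real"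
  assumes f: "f \<in> borel_measurable M" "integrable M (\<lambda>\<omega>. f \<omega> ^ (2 * q))" and r: "2 * r \<le> 2 * q"
  shows "expectation (\<lambda>\<omega>. f \<omega> ^ (2 * r)) \<le> 1 + expectation (\<lambda>\<omega>. f \<omega> ^ (2 * q))"
proof -
  have "expectation (\<lambda>\<omega>. f \<omega> ^ (2 * r)) \<le> expectation (\<lambda>\<omega>. 1 + f \<omega> ^ (2 * q))"
  proof (rule integral_mono)
    show "f \<omega> ^ (2 * r) \<le> 1 + f \<omega> ^ (2 * q)" for \<omega>
      using abs_power_le_one_plus[OF r, of "f \<omega>"] by (simp add: power_mult)
  qed (use f integrable_lower_power[OF f r] in auto)
  then show ?thesis using f by (simp add: prob_space)
qed

lemma abs_sum_product_le:
  fixes f g :: "'i \<Rightarrow> nat \<Rightarrow> real"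
  assumes "\<And>l. l \<in> I \<Longrightarrow> (\<Sum>t<n. \<bar>g l t\<bar>) \<le> H" "(\<Sum>l\<in>I. \<bar>f l s\<bar>) \<le> H"
  shows "(\<Sum>t<n. \<bar>\<Sum>l\<in>I. f l s * g l t\<bar>) \<le> H * H"
proof (cases "I = {}")
  case True then show ?thesis by simp
next
  case False
  then obtain l where "l \<in> I" by auto
  have H: "H \<ge> 0" using assms(1)[OF \<open>l \<in> I\<close>] by (meson abs_ge_zero order_trans sum_nonneg)
  have "(\<Sum>t<n. \<bar>\<Sum>l\<in>I. f l s * g l t\<bar>) \<le> (\<Sum>t<n. \<Sum>l\<in>I. \<bar>f l s\<bar> * \<bar>g l t\<bar>)"
    by (intro sum_mono) (simp add: abs_mult[symmetric])
  also have "\<dots> = (\<Sum>l\<in>I. \<bar>f l s\<bar> * (\<Sum>t<n. \<bar>g l t\<bar>))"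
    by (subst sum.swap) (simp add: sum_distrib_left)
  also have "\<dots> \<le> (\<Sum>l\<in>I. \<bar>f l s\<bar> * H)" using assms(1) by (intro sum_mono mult_left_mono) auto
  also have "\<dots> = (\<Sum>l\<in>I. \<bar>f l s\<bar>) * H" by (simp add: sum_distrib_right)
  also have "\<dots> \<le> H * H" using assms(2) H by (intro mult_right_mono) auto
  finally show ?thesis .
qed

context innovations
begin

definition filtered :: "(nat \<Rightarrow> real) \<Rightarrow> (nat \<Rightarrow> nat \<Rightarrow> real) \<Rightarrow> nat \<Rightarrow> nat \<Rightarrow> 'w \<Rightarrow> real" where
  "filtered D \<Phi> n l \<omega> = D l + (\<Sum>s<n. \<Phi> l s * X s \<omega>)"

lemma filtered_measurable [measurable]: "filtered D \<Phi> n l \<in> borel_measurable M"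
  unfolding filtered_def[abs_def] by measurable

lemma filtered_moment:
  assumes q: "q \<ge> 1"
    and Xi: "\<And>s. s < n \<Longrightarrow> integrable M (\<lambda>\<omega>. X s \<omega> ^ (2 * q))"
    and XB: "\<And>s. s < n \<Longrightarrow> expectation (\<lambda>\<omega>. X s \<omega> ^ (2 * q)) \<le> K" and K: "K \<ge> 0"
    and D: "\<bar>D l\<bar> \<le> D0" and H: "(\<Sum>s<n. \<bar>\<Phi> l s\<bar>) \<le> H"
  shows "integrable M (\<lambda>\<omega>. filtered D \<Phi> n l \<omega> ^ (2 * q))"
    "expectation (\<lambda>\<omega>. filtered D \<Phi> n l \<omega> ^ (2 * q)) \<le> 4 ^ q * (D0 ^ (2 * q) + H ^ (2 * q) * K)"
proof -
  note lin = linear_combination_moment[where \<alpha> = "\<Phi> l", OF q X_measurable Xi XB H K]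
  note add = integrable_power_add[of "\<lambda>_. D l" "\<lambda>\<omega>. \<Sum>s<n. \<Phi> l s * X s \<omega>" q, OF _ _ _ lin(1)]
  show "integrable M (\<lambda>\<omega>. filtered D \<Phi> n l \<omega> ^ (2 * q))"
    unfolding filtered_def using add(1) by simp
  have "expectation (\<lambda>\<omega>. filtered D \<Phi> n l \<omega> ^ (2 * q)) \<le>
      4 ^ q * (D l ^ (2 * q) + expectation (\<lambda>\<omega>. (\<Sum>s<n. \<Phi> l s * X s \<omega>) ^ (2 * q)))"
    unfolding filtered_def using add(2) by (simp add: prob_space)
  also have "\<dots> \<le> 4 ^ q * (D0 ^ (2 * q) + H ^ (2 * q) * K)"
  proof -
    have "D l ^ (2 * q) \<le> D0 ^ (2 * q)"
      using power_mono[OF D, of "2 * q"] by (simp add: power_mult)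
    then show ?thesis using lin(2) by (intro mult_left_mono add_mono) auto
  qed
  finally show "expectation (\<lambda>\<omega>. filtered D \<Phi> n l \<omega> ^ (2 * q)) \<le> 4 ^ q * (D0 ^ (2 * q) + H ^ (2 * q) * K)" .
qed

text \<open>
  The constant of the next lemma. Its two summands belong to the two martingales into which the quadratic
  form splits; what matters is that it does not depend on the number of terms.
\<close>

definition covariance_rate :: "nat \<Rightarrow> real \<Rightarrow> real \<Rightarrow> real \<Rightarrow> real \<Rightarrow> real" where
  "covariance_rate q K v D0 H = 4 ^ q *
     (2 * 4 ^ q * exp (4 ^ q) * (4 ^ q * ((2 * (D0 * H)) ^ (2 * q) + (2 * (H * H)) ^ (2 * q) * (1 + K)) * (1 + K))
    + 2 * 4 ^ q * exp (4 ^ q) * ((H * H) ^ (2 * q) * (4 ^ q * (K + v ^ (2 * q)))))"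

text \<open>
  With \<open>C\<^sub>s\<^sub>t = \<Sum>\<^sub>l \<Phi>\<^sub>l\<^sub>s \<Phi>'\<^sub>l\<^sub>t\<close>, the sum of products is a constant plus the martingale transforms \<open>\<Sum> z\<^sub>s X\<^sub>s\<close> and
  \<open>\<Sum> C\<^sub>s\<^sub>s (X\<^sub>s\<^sup>2 - v)\<close>. Here \<open>z\<^sub>s\<close> collects the linear terms and the terms \<open>(C\<^sub>s\<^sub>t + C\<^sub>t\<^sub>s) X\<^sub>t\<close> with \<open>t < s\<close>. The row sums of
  \<open>C\<close> are at most \<open>H\<^sup>2\<close>, so the coefficients have bounded moments.
\<close>

lemma filtered_covariance_moment:
  assumes q: "q \<ge> 1"
    and X0: "\<And>s. s < n \<Longrightarrow> expectation (X s) = 0" and Xv: "\<And>s. s < n \<Longrightarrow> expectation (\<lambda>\<omega>. (X s \<omega>)\<^sup>2) = v"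
    and Xi: "\<And>s. s < n \<Longrightarrow> integrable M (\<lambda>\<omega>. X s \<omega> ^ (4 * q))"
    and XB: "\<And>s. s < n \<Longrightarrow> expectation (\<lambda>\<omega>. X s \<omega> ^ (4 * q)) \<le> K" and K: "K \<ge> 0"
    and I: "finite I" and D0: "D0 \<ge> 0"
    and D: "\<And>l. l \<in> I \<Longrightarrow> \<bar>D l\<bar> \<le> D0" and D': "\<And>l. l \<in> I \<Longrightarrow> \<bar>D' l\<bar> \<le> D0"
    and row: "\<And>l. l \<in> I \<Longrightarrow> (\<Sum>s<n. \<bar>\<Phi> l s\<bar>) \<le> H" and row': "\<And>l. l \<in> I \<Longrightarrow> (\<Sum>s<n. \<bar>\<Phi>' l s\<bar>) \<le> H"
    and col: "\<And>s. s < n \<Longrightarrow> (\<Sum>l\<in>I. \<bar>\<Phi> l s\<bar>) \<le> H" and col': "\<And>s. s < n \<Longrightarrow> (\<Sum>l\<in>I. \<bar>\<Phi>' l s\<bar>) \<le> H"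
  defines "W \<equiv> \<lambda>\<omega>. \<Sum>l\<in>I. filtered D \<Phi> n l \<omega> * filtered D' \<Phi>' n l \<omega>"
  shows "integrable M W" "integrable M (\<lambda>\<omega>. (W \<omega> - expectation W) ^ (2 * q))"
    "expectation (\<lambda>\<omega>. (W \<omega> - expectation W) ^ (2 * q)) \<le> covariance_rate q K v D0 H * real n ^ q"
proof -
  define c where "c = (\<lambda>s. \<Sum>l\<in>I. D l * \<Phi>' l s + D' l * \<Phi> l s)"
  define C where "C = (\<lambda>s t. \<Sum>l\<in>I. \<Phi> l s * \<Phi>' l t)"
  define z where "z = (\<lambda>s \<omega>. c s + (\<Sum>t<s. (C s t + C t s) * X t \<omega>))"
  define k0 where "k0 = (\<Sum>l\<in>I. D l * D' l) + (\<Sum>s<n. C s s * v)"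
  define M1 where "M1 = (\<lambda>\<omega>. \<Sum>s<n. z s \<omega> * X s \<omega>)"
  define M2 where "M2 = (\<lambda>\<omega>. \<Sum>s<n. C s s * ((X s \<omega>)\<^sup>2 - v))"
  have W: "W \<omega> = k0 + M1 \<omega> + M2 \<omega>" for \<omega>
  proof -
    have "W \<omega> = (\<Sum>l\<in>I. D l * D' l + (\<Sum>s<n. (D l * \<Phi>' l s + D' l * \<Phi> l s) * X s \<omega>)
         + (\<Sum>s<n. \<Sum>t<n. \<Phi> l s * \<Phi>' l t * (X s \<omega> * X t \<omega>)))"
      unfolding W_def filtered_def
    proof (rule sum.cong[OF refl])
      fix l
      have "(\<Sum>s<n. \<Phi> l s * X s \<omega>) * (\<Sum>t<n. \<Phi>' l t * X t \<omega>) = (\<Sum>s<n. \<Sum>t<n. \<Phi> l s * \<Phi>' l t * (X s \<omega> * X t \<omega>))"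
        by (simp add: sum_product mult_ac)
      moreover have "D l * (\<Sum>t<n. \<Phi>' l t * X t \<omega>) + D' l * (\<Sum>t<n. \<Phi> l t * X t \<omega>) = (\<Sum>s<n. (D l * \<Phi>' l s + D' l * \<Phi> l s) * X s \<omega>)"
        by (simp add: sum_distrib_left sum.distrib algebra_simps)
      ultimately show "(D l + (\<Sum>s<n. \<Phi> l s * X s \<omega>)) * (D' l + (\<Sum>s<n. \<Phi>' l s * X s \<omega>)) =
        D l * D' l + (\<Sum>s<n. (D l * \<Phi>' l s + D' l * \<Phi> l s) * X s \<omega>)
         + (\<Sum>s<n. \<Sum>t<n. \<Phi> l s * \<Phi>' l t * (X s \<omega> * X t \<omega>))"
        by (simp add: algebra_simps)
    qed
    also have "\<dots> = (\<Sum>l\<in>I. D l * D' l) + (\<Sum>s<n. c s * X s \<omega>) + (\<Sum>s<n. \<Sum>t<n. C s t * (X s \<omega> * X t \<omega>))"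
    proof -
      have "(\<Sum>l\<in>I. \<Sum>s<n. (D l * \<Phi>' l s + D' l * \<Phi> l s) * X s \<omega>) = (\<Sum>s<n. c s * X s \<omega>)"
        by (subst sum.swap) (simp add: c_def sum_distrib_right)
      moreover have "(\<Sum>l\<in>I. \<Sum>s<n. \<Sum>t<n. \<Phi> l s * \<Phi>' l t * (X s \<omega> * X t \<omega>)) = (\<Sum>s<n. \<Sum>t<n. C s t * (X s \<omega> * X t \<omega>))"
        by (subst sum.swap, rule sum.cong[OF refl], subst sum.swap) (simp add: C_def sum_distrib_right)
      ultimately show ?thesis by (simp add: sum.distrib)
    qed
    also have "(\<Sum>s<n. \<Sum>t<n. C s t * (X s \<omega> * X t \<omega>)) =
       (\<Sum>s<n. C s s * (X s \<omega>)\<^sup>2) + (\<Sum>s<n. (\<Sum>t<s. (C s t + C t s) * X t \<omega>) * X s \<omega>)"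
      unfolding sum_square_split by (simp add: power2_eq_square sum_distrib_left algebra_simps)
    finally show ?thesis
      by (simp add: k0_def M1_def M2_def z_def sum.distrib sum_subtractf distrib_right right_diff_distrib)
  qed
  have HH: "(\<Sum>t<n. \<bar>C s t\<bar>) \<le> H * H" "(\<Sum>t<n. \<bar>C t s\<bar>) \<le> H * H" if "s < n" for s
    using abs_sum_product_le[where I = I and n = n and g = \<Phi>' and H = H and f = \<Phi> and s = s]
      abs_sum_product_le[where I = I and n = n and g = \<Phi> and H = H and f = \<Phi>' and s = s] row row' col[OF that] col'[OF that]
    unfolding C_def by (simp_all add: mult.commute)
  have H0: "H \<ge> 0" if "s < n" for s
  proof -
    have "0 \<le> (\<Sum>l\<in>I. \<bar>\<Phi> l s\<bar>)" by (simp add: sum_nonneg)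
    then show ?thesis using col[OF that] by linarith
  qed
  have cs: "\<bar>c s\<bar> \<le> 2 * (D0 * H)" if "s < n" for s
  proof -
    have "\<bar>c s\<bar> \<le> (\<Sum>l\<in>I. \<bar>D l * \<Phi>' l s + D' l * \<Phi> l s\<bar>)" unfolding c_def by (rule sum_abs)
    also have "\<dots> \<le> (\<Sum>l\<in>I. D0 * \<bar>\<Phi>' l s\<bar> + D0 * \<bar>\<Phi> l s\<bar>)"
    proof (rule sum_mono)
      fix l assume l: "l \<in> I"
      have "\<bar>D l * \<Phi>' l s + D' l * \<Phi> l s\<bar> \<le> \<bar>D l\<bar> * \<bar>\<Phi>' l s\<bar> + \<bar>D' l\<bar> * \<bar>\<Phi> l s\<bar>"
        by (metis abs_mult abs_triangle_ineq)
      also have "\<dots> \<le> D0 * \<bar>\<Phi>' l s\<bar> + D0 * \<bar>\<Phi> l s\<bar>"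
        using D[OF l] D'[OF l] by (intro add_mono mult_right_mono) auto
      finally show "\<bar>D l * \<Phi>' l s + D' l * \<Phi> l s\<bar> \<le> D0 * \<bar>\<Phi>' l s\<bar> + D0 * \<bar>\<Phi> l s\<bar>" .
    qed
    also have "\<dots> = D0 * (\<Sum>l\<in>I. \<bar>\<Phi>' l s\<bar>) + D0 * (\<Sum>l\<in>I. \<bar>\<Phi> l s\<bar>)"
      by (simp add: sum.distrib sum_distrib_left)
    also have "\<dots> \<le> D0 * H + D0 * H" using col[OF that] col'[OF that] D0 by (intro add_mono mult_left_mono) auto
    finally show ?thesis by simp
  qed
  have Xi2: "integrable M (\<lambda>\<omega>. X s \<omega> ^ (2 * q))" "expectation (\<lambda>\<omega>. X s \<omega> ^ (2 * q)) \<le> 1 + K" if "s < n" for s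
    using integrable_lower_power[of "X s" "2 * q" "2 * q"] moment_le_one_plus[of "X s" "2 * q" q] Xi[OF that] XB[OF that]
    by auto
  define Bz where "Bz = 4 ^ q * ((2 * (D0 * H)) ^ (2 * q) + (2 * (H * H)) ^ (2 * q) * (1 + K))"
  have zF: "z s \<in> borel_measurable (F s)" for s
  proof -
    have "X t \<in> borel_measurable (F s)" if "t < s" for t
      using adapted_mono[OF X_adapted, of t s] that by auto
    then show ?thesis unfolding z_def
      by (intro borel_measurable_add borel_measurable_sum borel_measurable_times) auto
  qed
  have zm: "integrable M (\<lambda>\<omega>. z s \<omega> ^ (2 * q))" "expectation (\<lambda>\<omega>. z s \<omega> ^ (2 * q)) \<le> Bz" if s: "s < n" for s
  proof -
    have "(\<Sum>t<s. \<bar>C s t + C t s\<bar>) \<le> (\<Sum>t<n. \<bar>C s t + C t s\<bar>)" using s by (intro sum_mono2) auto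
    also have "\<dots> \<le> (\<Sum>t<n. \<bar>C s t\<bar> + \<bar>C t s\<bar>)" by (intro sum_mono) simp
    also have "\<dots> \<le> 2 * (H * H)" using HH[OF s] by (simp add: sum.distrib)
    finally have rows: "(\<Sum>t<s. \<bar>C s t + C t s\<bar>) \<le> 2 * (H * H)" .
    have eq: "z s = filtered c (\<lambda>s t. C s t + C t s) s s" by (simp add: z_def filtered_def fun_eq_iff)
    have lt: "t < s \<Longrightarrow> t < n" for t using s by simp
    note fm = filtered_moment[where n = s and l = s and D = c and \<Phi> = "\<lambda>s t. C s t + C t s",
        OF q Xi2(1)[OF lt] Xi2(2)[OF lt] _ cs[OF s] rows]
    show "integrable M (\<lambda>\<omega>. z s \<omega> ^ (2 * q))" unfolding eq by (rule fm(1)) (use K in auto)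
    show "expectation (\<lambda>\<omega>. z s \<omega> ^ (2 * q)) \<le> Bz" unfolding eq Bz_def by (rule fm(2)) (use K in auto)
  qed
  note m1' = martingale_transform_moment[where z = z and n = n, OF q zF zm Xi2 X0]
  have "integrable M (\<lambda>\<omega>. M1 \<omega> ^ (2 * q))" unfolding M1_def by (rule m1'(1))
  moreover have "expectation (\<lambda>\<omega>. M1 \<omega> ^ (2 * q)) \<le> 2 * 4 ^ q * exp (4 ^ q) * (Bz * (1 + K)) * real n ^ q"
    unfolding M1_def by (rule m1'(2))
  moreover have "integrable M M1" unfolding M1_def by (rule m1'(3))
  moreover have "expectation M1 = 0" unfolding M1_def by (rule m1'(4))
  ultimately have m1: "integrable M (\<lambda>\<omega>. M1 \<omega> ^ (2 * q))"
    "expectation (\<lambda>\<omega>. M1 \<omega> ^ (2 * q)) \<le> 2 * 4 ^ q * exp (4 ^ q) * (Bz * (1 + K)) * real n ^ q"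
    "integrable M M1" "expectation M1 = 0" by blast+
  interpret J: innovations M F "\<lambda>k \<omega>. (X k \<omega>)\<^sup>2 - v" by (rule innovations_compose) simp
  have sq: "integrable M (\<lambda>\<omega>. (X s \<omega>)\<^sup>2)" if "s < n" for s
    using integrable_lower_power[of "X s" "2 * q" 2] Xi[OF that] q by simp
  have sqm: "integrable M (\<lambda>\<omega>. ((X s \<omega>)\<^sup>2 - v) ^ (2 * q))"
    "expectation (\<lambda>\<omega>. ((X s \<omega>)\<^sup>2 - v) ^ (2 * q)) \<le> 4 ^ q * (K + v ^ (2 * q))" if s: "s < n" for s
  proof -
    have p: "(\<lambda>\<omega>. ((X s \<omega>)\<^sup>2) ^ (2 * q)) = (\<lambda>\<omega>. X s \<omega> ^ (4 * q))" by (simp add: power_mult[symmetric])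
    note add = integrable_power_add[of "\<lambda>\<omega>. (X s \<omega>)\<^sup>2" "\<lambda>_. - v" q]
    show "integrable M (\<lambda>\<omega>. ((X s \<omega>)\<^sup>2 - v) ^ (2 * q))" using add(1) Xi[OF s] by (simp add: p)
    have "expectation (\<lambda>\<omega>. ((X s \<omega>)\<^sup>2 - v) ^ (2 * q)) \<le> 4 ^ q * (expectation (\<lambda>\<omega>. X s \<omega> ^ (4 * q)) + v ^ (2 * q))"
      using add(2) Xi[OF s] by (simp add: p prob_space)
    also have "\<dots> \<le> 4 ^ q * (K + v ^ (2 * q))" using XB[OF s] by (intro mult_left_mono) auto
    finally show "expectation (\<lambda>\<omega>. ((X s \<omega>)\<^sup>2 - v) ^ (2 * q)) \<le> 4 ^ q * (K + v ^ (2 * q))" .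
  qed
  have Css: "C s s ^ (2 * q) \<le> (H * H) ^ (2 * q)" if s: "s < n" for s
  proof -
    have "\<bar>C s s\<bar> \<le> (\<Sum>t<n. \<bar>C s t\<bar>)" using s by (intro member_le_sum) auto
    then have "\<bar>C s s\<bar> \<le> H * H" using HH[OF s] by linarith
    from power_mono[OF this, of "2 * q"] show ?thesis by (simp add: power_mult)
  qed
  have E0: "expectation (\<lambda>\<omega>. (X s \<omega>)\<^sup>2 - v) = 0" if "s < n" for s
    using sq[OF that] Xv[OF that] by (simp add: prob_space)
  have Cm: "expectation (\<lambda>_. C s s ^ (2 * q)) \<le> (H * H) ^ (2 * q)" if "s < n" for s
    using Css[OF that] by (simp add: prob_space)
  note m2' = J.martingale_transform_moment[where z = "\<lambda>s _. C s s" and n = n,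
      OF q borel_measurable_const integrable_const Cm sqm E0]
  have "integrable M (\<lambda>\<omega>. M2 \<omega> ^ (2 * q))" unfolding M2_def by (rule m2'(1))
  moreover have "expectation (\<lambda>\<omega>. M2 \<omega> ^ (2 * q)) \<le> 2 * 4 ^ q * exp (4 ^ q) * ((H * H) ^ (2 * q) * (4 ^ q * (K + v ^ (2 * q)))) * real n ^ q"
    unfolding M2_def by (rule m2'(2))
  moreover have "integrable M M2" unfolding M2_def by (rule m2'(3))
  moreover have "expectation M2 = 0" unfolding M2_def by (rule m2'(4))
  ultimately have m2: "integrable M (\<lambda>\<omega>. M2 \<omega> ^ (2 * q))"
    "expectation (\<lambda>\<omega>. M2 \<omega> ^ (2 * q)) \<le> 2 * 4 ^ q * exp (4 ^ q) * ((H * H) ^ (2 * q) * (4 ^ q * (K + v ^ (2 * q)))) * real n ^ q"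
    "integrable M M2" "expectation M2 = 0" by blast+
  show "integrable M W" unfolding W[abs_def] using m1 m2 by simp
  have EW: "expectation W = k0" unfolding W[abs_def] using m1 m2 by (simp add: prob_space)
  have dev: "W \<omega> - expectation W = M1 \<omega> + M2 \<omega>" for \<omega> unfolding EW by (simp add: W)
  have meas: "M1 \<in> borel_measurable M" "M2 \<in> borel_measurable M" using m1 m2 by auto
  note add = integrable_power_add[OF meas m1(1) m2(1)]
  show "integrable M (\<lambda>\<omega>. (W \<omega> - expectation W) ^ (2 * q))" unfolding dev by (rule add(1))
  have "expectation (\<lambda>\<omega>. (W \<omega> - expectation W) ^ (2 * q)) \<le> 4 ^ q *
    (2 * 4 ^ q * exp (4 ^ q) * (Bz * (1 + K)) * real n ^ q +
     2 * 4 ^ q * exp (4 ^ q) * ((H * H) ^ (2 * q) * (4 ^ q * (K + v ^ (2 * q)))) * real n ^ q)"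
    unfolding dev by (rule order_trans[OF add(2)]) (intro mult_left_mono add_mono m1 m2, simp)
  also have "\<dots> = covariance_rate q K v D0 H * real n ^ q"
    by (simp add: covariance_rate_def Bz_def algebra_simps)
  finally show "expectation (\<lambda>\<omega>. (W \<omega> - expectation W) ^ (2 * q)) \<le> covariance_rate q K v D0 H * real n ^ q" .
qed

end


section \<open>Random vectors and matrices\<close>

lemma vec_borel_measurableI:
  fixes f :: "'w \<Rightarrow> 'b::euclidean_space^'p"
  assumes "\<And>i. (\<lambda>\<omega>. f \<omega> $ i) \<in> borel_measurable M"
  shows "f \<in> borel_measurable M"
  unfolding borel_measurable_euclidean_space[of f]
proof
  fix b :: "'b^'p" assume "b \<in> Basis"
  then obtain i c where "b = axis i c" by (auto simp: Basis_vec_def)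
  then have "(\<lambda>\<omega>. f \<omega> \<bullet> b) = (\<lambda>\<omega>. f \<omega> $ i \<bullet> c)" by (simp add: inner_axis)
  then show "(\<lambda>\<omega>. f \<omega> \<bullet> b) \<in> borel_measurable M" using assms[of i] by simp
qed

lemma vec_nth_borel_measurable [measurable]: "(\<lambda>x::'b::euclidean_space^'p. x $ i) \<in> borel_measurable borel"
  by (intro borel_measurable_continuous_onI continuous_intros)

lemma outer_nth: "outer x y $ i $ j = x $ i * y $ j"
  by (simp add: outer_def)

lemma outer_borel_measurable:
  assumes "f \<in> borel_measurable M" "g \<in> borel_measurable M"
  shows "(\<lambda>\<omega>. outer (f \<omega>) (g \<omega>)) \<in> borel_measurable M"
  using assms by (intro vec_borel_measurableI) (simp add: outer_nth)

lemma matrix_vector_borel_measurable: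
  fixes f :: "'w \<Rightarrow> real^'p^'q"
  assumes "f \<in> borel_measurable M" "g \<in> borel_measurable M"
  shows "(\<lambda>\<omega>. f \<omega> *v g \<omega>) \<in> borel_measurable M"
  using assms by (intro vec_borel_measurableI) (simp add: matrix_vector_mult_def)

lemma matrix_matrix_borel_measurable:
  fixes f :: "'w \<Rightarrow> real^'q^'r" and g :: "'w \<Rightarrow> real^'p^'q"
  assumes "f \<in> borel_measurable M" "g \<in> borel_measurable M"
  shows "(\<lambda>\<omega>. f \<omega> ** g \<omega>) \<in> borel_measurable M"
  using assms by (intro vec_borel_measurableI) (simp add: matrix_matrix_mult_def)

lemma integral_entry:
  fixes f :: "'w \<Rightarrow> real^'p^'q"
  assumes "integrable M f"
  shows "integrable M (\<lambda>\<omega>. f \<omega> $ i $ j)" "(\<integral>\<omega>. f \<omega> \<partial>M) $ i $ j = (\<integral>\<omega>. f \<omega> $ i $ j \<partial>M)"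
proof -
  have b: "bounded_linear (\<lambda>A::real^'p^'q. A $ i $ j)"
    by (rule bounded_linear_compose[OF bounded_linear_vec_nth bounded_linear_vec_nth])
  show "integrable M (\<lambda>\<omega>. f \<omega> $ i $ j)" by (rule integrable_bounded_linear[OF b assms])
  show "(\<integral>\<omega>. f \<omega> \<partial>M) $ i $ j = (\<integral>\<omega>. f \<omega> $ i $ j \<partial>M)"
    by (rule integral_bounded_linear[OF b assms, symmetric])
qed

lemma norm_matrix_le_sum: "norm (A::real^'p^'q) \<le> (\<Sum>(i, j)\<in>UNIV. \<bar>A $ i $ j\<bar>)"
proof -
  have "norm A \<le> (\<Sum>i\<in>UNIV. norm (A $ i))" unfolding norm_vec_def[of A] by (rule L2_set_le_sum) simp
  also have "\<dots> \<le> (\<Sum>i\<in>UNIV. \<Sum>j\<in>UNIV. \<bar>A $ i $ j\<bar>)" by (intro sum_mono norm_le_l1_cart)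
  finally show ?thesis by (simp add: sum.cartesian_product flip: UNIV_Times_UNIV)
qed

lemma integrable_matrixI:
  fixes f :: "'w \<Rightarrow> real^'p^'q"
  assumes "\<And>i j. integrable M (\<lambda>\<omega>. f \<omega> $ i $ j)"
  shows "integrable M f"
proof (rule Bochner_Integration.integrable_bound)
  show "integrable M (\<lambda>\<omega>. \<Sum>(i, j)\<in>UNIV. \<bar>f \<omega> $ i $ j\<bar>)"
    using assms by (intro Bochner_Integration.integrable_sum) auto
  show "f \<in> borel_measurable M"
    using assms by (intro vec_borel_measurableI) auto
  show "AE \<omega> in M. norm (f \<omega>) \<le> norm (\<Sum>(i, j)\<in>UNIV. \<bar>f \<omega> $ i $ j\<bar>)"
  proof (rule AE_I2)
    fix \<omega>
    show "norm (f \<omega>) \<le> norm (\<Sum>(i, j)\<in>UNIV. \<bar>f \<omega> $ i $ j\<bar>)"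
      using norm_matrix_le_sum[of "f \<omega>"] unfolding real_norm_def by linarith
  qed
qed

lemma tendsto_matrixI:
  fixes f :: "'k \<Rightarrow> real^'p^'q"
  assumes "\<And>i j. ((\<lambda>k. f k $ i $ j) \<longlongrightarrow> L $ i $ j) Fl"
  shows "(f \<longlongrightarrow> L) Fl"
  using assms by (intro vec_tendstoI) auto

lemma sum_power_le_card:
  fixes a :: "'i \<Rightarrow> real"
  assumes "finite I" "\<And>i. i \<in> I \<Longrightarrow> a i \<ge> 0" "m \<ge> 1"
  shows "(\<Sum>i\<in>I. a i) ^ m \<le> real (card I) ^ m * (\<Sum>i\<in>I. a i ^ m)"
proof (cases "I = {}")
  case True then show ?thesis using assms by (simp add: power_0_left)
next
  case False
  define t where "t = Max (a ` I)"
  have "t \<in> a ` I" using assms False unfolding t_def by (intro Max_in) auto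
  then obtain j where j: "j \<in> I" "t = a j" by auto
  have le: "a i \<le> t" if "i \<in> I" for i using assms(1) that by (simp add: t_def)
  have "(\<Sum>i\<in>I. a i) \<le> real (card I) * t" using sum_bounded_above[of I a t] le by simp
  then have "(\<Sum>i\<in>I. a i) ^ m \<le> (real (card I) * t) ^ m"
    using assms by (intro power_mono sum_nonneg) auto
  also have "\<dots> = real (card I) ^ m * a j ^ m" by (simp add: power_mult_distrib j)
  also have "\<dots> \<le> real (card I) ^ m * (\<Sum>i\<in>I. a i ^ m)"
    using assms j by (intro mult_left_mono member_le_sum) auto
  finally show ?thesis .
qed

context prob_space
begin

lemma integrable_mult_of_squares:
  fixes f g :: "'a \<Rightarrow> real"
  assumes "f \<in> borel_measurable M" "g \<in> borel_measurable M"
    "integrable M (\<lambda>\<omega>. (f \<omega>)\<^sup>2)" "integrable M (\<lambda>\<omega>. (g \<omega>)\<^sup>2)"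
  shows "integrable M (\<lambda>\<omega>. f \<omega> * g \<omega>)"
proof (rule Bochner_Integration.integrable_bound)
  show "integrable M (\<lambda>\<omega>. (f \<omega>)\<^sup>2 + (g \<omega>)\<^sup>2)" using assms by simp
  have "\<bar>a * b\<bar> \<le> a\<^sup>2 + b\<^sup>2" for a b :: real
  proof -
    have "0 \<le> \<bar>a\<bar> * \<bar>b\<bar>" by simp
    moreover have "2 * (\<bar>a\<bar> * \<bar>b\<bar>) \<le> a\<^sup>2 + b\<^sup>2" using sum_squares_bound[of "\<bar>a\<bar>" "\<bar>b\<bar>"] by simp
    ultimately show ?thesis unfolding abs_mult by linarith
  qed
  then show "AE \<omega> in M. norm (f \<omega> * g \<omega>) \<le> norm ((f \<omega>)\<^sup>2 + (g \<omega>)\<^sup>2)" by simp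
qed (use assms in simp)

lemma expectation_cauchy_schwarz:
  fixes f g :: "'a \<Rightarrow> real"
  assumes m: "f \<in> borel_measurable M" "g \<in> borel_measurable M"
    and i: "integrable M (\<lambda>\<omega>. (f \<omega>)\<^sup>2)" "integrable M (\<lambda>\<omega>. (g \<omega>)\<^sup>2)"
    and b: "expectation (\<lambda>\<omega>. (f \<omega>)\<^sup>2) \<le> a" "expectation (\<lambda>\<omega>. (g \<omega>)\<^sup>2) \<le> c"
  shows "\<bar>expectation (\<lambda>\<omega>. f \<omega> * g \<omega>)\<bar> \<le> sqrt a * sqrt c"
proof -
  note fg = integrable_mult_of_squares[OF m i]
  let ?F = "expectation (\<lambda>\<omega>. (f \<omega>)\<^sup>2)" and ?G = "expectation (\<lambda>\<omega>. (g \<omega>)\<^sup>2)" and ?H = "expectation (\<lambda>\<omega>. f \<omega> * g \<omega>)"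
  have q: "0 \<le> ?F - 2 * t * ?H + t\<^sup>2 * ?G" for t
  proof -
    have "0 \<le> expectation (\<lambda>\<omega>. (f \<omega> - t * g \<omega>)\<^sup>2)" by simp
    moreover have "(\<lambda>\<omega>. (f \<omega> - t * g \<omega>)\<^sup>2) = (\<lambda>\<omega>. (f \<omega>)\<^sup>2 - 2 * t * (f \<omega> * g \<omega>) + t\<^sup>2 * (g \<omega>)\<^sup>2)"
      by (simp add: power2_eq_square algebra_simps)
    ultimately show ?thesis using fg i by simp
  qed
  have "?H\<^sup>2 \<le> ?F * ?G"
  proof (cases "?G = 0")
    case True
    have "?H = 0"
    proof (rule ccontr)
      assume "?H \<noteq> 0"
      then have "?F - 2 * ((?F + 1) / (2 * ?H)) * ?H = - 1" by (simp add: field_simps)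
      then show False using q[of "(?F + 1) / (2 * ?H)"] True by simp
    qed
    then show ?thesis using True by simp
  next
    case False
    then have G: "?G > 0" by (simp add: less_le)
    have "0 \<le> ?F - 2 * (?H / ?G) * ?H + (?H / ?G)\<^sup>2 * ?G" by (rule q)
    also have "\<dots> = ?F - ?H\<^sup>2 / ?G" using G by (simp add: power2_eq_square field_simps)
    finally show ?thesis using G by (simp add: field_simps)
  qed
  also have "\<dots> \<le> a * c" using b by (intro mult_mono) (auto intro: order_trans[OF _ b(1)])
  finally have "sqrt (?H\<^sup>2) \<le> sqrt (a * c)" by (rule real_sqrt_le_mono)
  then show ?thesis by (simp add: real_sqrt_mult)
qed

end

lemma one_minus_exp_le:
  assumes "y \<le> (c::real)" "c \<ge> 0"
  shows "\<bar>1 - exp y\<bar> \<le> \<bar>y\<bar> * exp c"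
proof (cases "y \<ge> 0")
  case True
  have "1 - y \<le> exp (- y)" using exp_ge_add_one_self[of "- y"] by simp
  then have "(1 - y) * exp y \<le> exp (- y) * exp y" by (intro mult_right_mono) auto
  then have "exp y - 1 \<le> y * exp y" by (simp add: exp_minus algebra_simps)
  also have "\<dots> \<le> y * exp c" using True assms by (intro mult_left_mono) auto
  finally show ?thesis using True by simp
next
  case False
  have "1 + y \<le> exp y" by (rule exp_ge_add_one_self)
  then have "1 - exp y \<le> \<bar>y\<bar> * 1" using False by linarith
  also have "\<dots> \<le> \<bar>y\<bar> * exp c" using assms by (intro mult_left_mono) auto
  finally show ?thesis using False by simp
qed

section \<open>The central limit theorem for Gaussian martingale transforms\<close>

context innovations
begin

text \<open>
  The increments of two martingale transforms are orthogonal at different times.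
\<close>

lemma transform_covariance:
  assumes a: "\<And>s. a s \<in> borel_measurable (F s)" "\<And>s. integrable M (\<lambda>\<omega>. (a s \<omega>)\<^sup>2)"
    and b: "\<And>s. b s \<in> borel_measurable (F s)" "\<And>s. integrable M (\<lambda>\<omega>. (b s \<omega>)\<^sup>2)"
    and X: "\<And>s. integrable M (\<lambda>\<omega>. (X s \<omega>)\<^sup>2)" "\<And>s. expectation (X s) = 0" "\<And>s. expectation (\<lambda>\<omega>. (X s \<omega>)\<^sup>2) = v"
  shows "integrable M (\<lambda>\<omega>. (\<Sum>s<k. a s \<omega> * X s \<omega>)\<^sup>2)"
    "expectation (\<lambda>\<omega>. (\<Sum>s<k. a s \<omega> * X s \<omega>) * (\<Sum>s<k. b s \<omega> * X s \<omega>)) = v * (\<Sum>s<k. expectation (\<lambda>\<omega>. a s \<omega> * b s \<omega>))"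
proof -
  interpret J: innovations M F "\<lambda>k \<omega>. (X k \<omega>)\<^sup>2" by (rule innovations_compose) simp
  have X1: "integrable M (X s)" for s using integrable_lower_power[of "X s" 1 1] X(1)[of s] by simp
  have sq: "integrable M (\<lambda>\<omega>. (\<Sum>s<k. a s \<omega> * X s \<omega>)\<^sup>2)"
    if a: "\<And>s. a s \<in> borel_measurable (F s)" "\<And>s. integrable M (\<lambda>\<omega>. (a s \<omega>)\<^sup>2)" for a k
  proof (induct k)
    case 0 show ?case by simp
  next
    case (Suc k)
    have "integrable M (\<lambda>\<omega>. (a k \<omega> * X k \<omega>)\<^sup>2)" using product_power_past[OF a(1) a(2) X(1)] by simp
    moreover have "(\<lambda>\<omega>. \<Sum>s<k. a s \<omega> * X s \<omega>) \<in> borel_measurable M"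
      by (rule adapted_measurable[OF transform_adapted]) (rule a)
    moreover have "(\<lambda>\<omega>. a k \<omega> * X k \<omega>) \<in> borel_measurable M"
      using adapted_measurable[OF a(1)] by simp
    ultimately show ?case
      using integrable_power_add(1)[of "\<lambda>\<omega>. \<Sum>s<k. a s \<omega> * X s \<omega>" "\<lambda>\<omega>. a k \<omega> * X k \<omega>" 1] Suc by simp
  qed
  show "integrable M (\<lambda>\<omega>. (\<Sum>s<k. a s \<omega> * X s \<omega>)\<^sup>2)" by (rule sq[OF a])
  show "expectation (\<lambda>\<omega>. (\<Sum>s<k. a s \<omega> * X s \<omega>) * (\<Sum>s<k. b s \<omega> * X s \<omega>)) = v * (\<Sum>s<k. expectation (\<lambda>\<omega>. a s \<omega> * b s \<omega>))"
  proof (induct k)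
    case 0 show ?case by simp
  next
    case (Suc k)
    let ?S = "\<lambda>\<omega>. \<Sum>s<k. a s \<omega> * X s \<omega>" and ?T = "\<lambda>\<omega>. \<Sum>s<k. b s \<omega> * X s \<omega>"
    have SF: "?S \<in> borel_measurable (F k)" "?T \<in> borel_measurable (F k)" by (intro transform_adapted a b)+
    have SM: "?S \<in> borel_measurable M" "?T \<in> borel_measurable M"
      "a k \<in> borel_measurable M" "b k \<in> borel_measurable M"
      using adapted_measurable SF a b by blast+
    have i: "integrable M (\<lambda>\<omega>. ?S \<omega> * b k \<omega>)" "integrable M (\<lambda>\<omega>. ?T \<omega> * a k \<omega>)"
      "integrable M (\<lambda>\<omega>. a k \<omega> * b k \<omega>)" "integrable M (\<lambda>\<omega>. ?S \<omega> * ?T \<omega>)"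
      by (intro integrable_mult_of_squares SM sq a b)+
    have m: "(\<lambda>\<omega>. ?S \<omega> * b k \<omega>) \<in> borel_measurable (F k)" "(\<lambda>\<omega>. ?T \<omega> * a k \<omega>) \<in> borel_measurable (F k)"
      "(\<lambda>\<omega>. a k \<omega> * b k \<omega>) \<in> borel_measurable (F k)"
      using SF a(1)[of k] b(1)[of k] by (auto intro: borel_measurable_times)
    note p1 = product_past[OF m(1) i(1) X1] and p2 = product_past[OF m(2) i(2) X1] and p3 = J.product_past[OF m(3) i(3) X(1)]
    have "(\<lambda>\<omega>. (\<Sum>s<Suc k. a s \<omega> * X s \<omega>) * (\<Sum>s<Suc k. b s \<omega> * X s \<omega>)) =
      (\<lambda>\<omega>. ?S \<omega> * ?T \<omega> + ?S \<omega> * b k \<omega> * X k \<omega> + ?T \<omega> * a k \<omega> * X k \<omega> + a k \<omega> * b k \<omega> * (X k \<omega>)\<^sup>2)"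
      by (simp add: fun_eq_iff power2_eq_square algebra_simps)
    then show ?case using p1 p2 p3 i Suc X by (simp add: algebra_simps)
  qed
qed

text \<open>
  Switching the coefficients off as soon as \<open>\<Sum> a\<^sub>s\<^sup>2\<close> would exceed \<open>k (\<sigma> + 1)\<close> gives coefficients \<open>z\<^sub>s\<close> that still
  belong to the past and have a bounded sum of squares, so the exponential martingale applies to them. The
  switched and the original sums differ only where \<open>\<Sum> a\<^sub>s\<^sup>2 / k\<close> is at distance at least \<open>1\<close> from \<open>\<sigma>\<close>, so every
  error is at most a multiple of the distance of \<open>\<Sum> a\<^sub>s\<^sup>2 / k\<close> from \<open>\<sigma>\<close>, whose mean tends to zero.
\<close>

lemma gaussian_martingale_clt:
  assumes v: "v \<ge> 0" and ch: "\<And>s t. (CLINT \<omega>|M. iexp (t * X s \<omega>)) = complex_of_real (exp (- (v * t\<^sup>2) / 2))"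
    and a: "\<And>s. a s \<in> borel_measurable (F s)" and ai: "\<And>s. integrable M (\<lambda>\<omega>. (a s \<omega>)\<^sup>2)"
    and \<sigma>: "\<sigma> \<ge> 0"
    and lim: "(\<lambda>k. expectation (\<lambda>\<omega>. \<bar>(\<Sum>s<k. (a s \<omega>)\<^sup>2) / real k - \<sigma>\<bar>)) \<longlonglongrightarrow> 0"
  shows "(\<lambda>k. CLINT \<omega>|M. iexp ((\<Sum>s<k. a s \<omega> * X s \<omega>) / sqrt (real k))) \<longlonglongrightarrow> complex_of_real (exp (- (v * \<sigma>) / 2))"
proof -
  define L where "L = 1 + exp (v / 2) + v / 2 * exp (v / 2)"
  define c where "c = complex_of_real (exp (- (v * \<sigma>) / 2))"
  have bound: "norm ((CLINT \<omega>|M. iexp ((\<Sum>s<k. a s \<omega> * X s \<omega>) / sqrt (real k))) - c) \<le>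
      L * expectation (\<lambda>\<omega>. \<bar>(\<Sum>s<k. (a s \<omega>)\<^sup>2) / real k - \<sigma>\<bar>)" if k: "k \<ge> 1" for k
  proof -
    define A where "A = (\<lambda>n \<omega>. \<Sum>s<n. (a s \<omega>)\<^sup>2)"
    define T where "T = \<sigma> + 1"
    \<comment> \<open>the sum up to and including \<open>s\<close> is known at time \<open>s\<close>, so the switched coefficients belong to the past\<close>
    define z where "z = (\<lambda>s \<omega>. if A (Suc s) \<omega> \<le> real k * T then a s \<omega> / sqrt (real k) else 0)"
    have T: "T \<ge> 0" using \<sigma> by (simp add: T_def)
    have AF: "A (Suc s) \<in> borel_measurable (F s)" for s
      unfolding A_def using adapted_mono[OF a, of _ s] by (intro borel_measurable_sum borel_measurable_power) auto
    have AM: "A n \<in> borel_measurable M" for n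
      unfolding A_def using adapted_measurable[OF a] by (intro borel_measurable_sum borel_measurable_power) auto
    have zF: "z s \<in> borel_measurable (F s)" for s
      unfolding z_def using AF[of s] a[of s] by measurable
    have z2: "(z s \<omega>)\<^sup>2 \<le> (a s \<omega>)\<^sup>2 / real k" for s \<omega> by (simp add: z_def power_divide)
    have zT: "(\<Sum>s<n. (z s \<omega>)\<^sup>2) \<le> T" for n \<omega>
    proof (induct n)
      case (Suc n)
      show ?case
      proof (cases "A (Suc n) \<omega> \<le> real k * T")
        case True
        have "(\<Sum>s<Suc n. (z s \<omega>)\<^sup>2) \<le> (\<Sum>s<Suc n. (a s \<omega>)\<^sup>2 / real k)" by (intro sum_mono z2)
        also have "\<dots> = A (Suc n) \<omega> / real k" unfolding A_def by (rule sum_divide_distrib[symmetric])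
        also have "\<dots> \<le> T" using True k by (simp add: field_simps)
        finally show ?thesis .
      next
        case False then show ?thesis using Suc by (simp add: z_def)
      qed
    qed (simp add: T)
    let ?S = "\<lambda>\<omega>. (\<Sum>s<k. a s \<omega> * X s \<omega>) / sqrt (real k)"
    let ?Z = "\<lambda>\<omega>. \<Sum>s<k. z s \<omega> * X s \<omega>" and ?Q = "\<lambda>\<omega>. \<Sum>s<k. (z s \<omega>)\<^sup>2"
    let ?E = "\<lambda>\<omega>. iexp (?Z \<omega>) * complex_of_real (exp (v / 2 * ?Q \<omega>))"
    have one: "(CLINT \<omega>|M. ?E \<omega>) = 1"
      by (rule gaussian_exponential_martingale[OF v ch zF zT])
    have pw: "norm (iexp (?S \<omega>) - c * ?E \<omega>) \<le> L * \<bar>A k \<omega> / real k - \<sigma>\<bar>" for \<omega>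
    proof (cases "A k \<omega> \<le> real k * T")
      case True
      have "A (Suc s) \<omega> \<le> real k * T" if "s < k" for s
      proof -
        have "A (Suc s) \<omega> \<le> A k \<omega>" unfolding A_def using that by (intro sum_mono2) auto
        then show ?thesis using True by linarith
      qed
      then have zs: "z s \<omega> = a s \<omega> / sqrt (real k)" if "s < k" for s using that by (simp add: z_def)
      have Z: "?Z \<omega> = ?S \<omega>" using zs by (simp add: sum_divide_distrib)
      have Q: "?Q \<omega> = A k \<omega> / real k" using zs by (simp add: A_def power_divide sum_divide_distrib)
      let ?y = "v / 2 * (A k \<omega> / real k - \<sigma>)"
      have "iexp (?S \<omega>) - c * ?E \<omega> = iexp (?S \<omega>) * complex_of_real (1 - exp ?y)"
      proof -
        have "c * complex_of_real (exp (v / 2 * (A k \<omega> / real k))) = complex_of_real (exp ?y)"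
          unfolding c_def of_real_mult[symmetric] exp_add[symmetric] by (simp add: algebra_simps)
        then show ?thesis unfolding Z Q by (simp add: algebra_simps)
      qed
      then have "norm (iexp (?S \<omega>) - c * ?E \<omega>) = \<bar>1 - exp ?y\<bar>"
        by (simp only: norm_mult norm_exp_i_times norm_of_real mult_1_left)
      also have "\<dots> \<le> \<bar>?y\<bar> * exp (v / 2)"
      proof (rule one_minus_exp_le)
        have "A k \<omega> / real k \<le> T" using True k by (simp add: field_simps)
        then have "v / 2 * (A k \<omega> / real k - \<sigma>) \<le> v / 2 * 1" using v by (intro mult_left_mono) (auto simp: T_def)
        then show "?y \<le> v / 2" by simp
      qed (use v in simp)
      also have "\<dots> = (v / 2 * exp (v / 2)) * \<bar>A k \<omega> / real k - \<sigma>\<bar>" using v by (simp add: abs_mult)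
      also have "\<dots> \<le> L * \<bar>A k \<omega> / real k - \<sigma>\<bar>" by (intro mult_right_mono) (auto simp: L_def)
      finally show ?thesis .
    next
      case False
      then have big: "1 \<le> \<bar>A k \<omega> / real k - \<sigma>\<bar>" using k by (simp add: T_def field_simps)
      have "norm (iexp (?S \<omega>) - c * ?E \<omega>) \<le> norm (iexp (?S \<omega>)) + norm (c * ?E \<omega>)" by (rule norm_triangle_ineq4)
      also have "\<dots> = 1 + exp (- (v * \<sigma>) / 2) * exp (v / 2 * ?Q \<omega>)"
        by (simp add: norm_mult c_def)
      also have "\<dots> \<le> 1 + exp (- (v * \<sigma>) / 2) * exp (v / 2 * T)"
        using v zT by (intro add_left_mono mult_left_mono) (auto intro!: mult_left_mono)
      also have "\<dots> = 1 + exp (v / 2)" unfolding exp_add[symmetric] by (simp add: T_def algebra_simps add_divide_distrib)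
      also have "\<dots> \<le> L * 1" using v by (simp add: L_def)
      also have "\<dots> \<le> L * \<bar>A k \<omega> / real k - \<sigma>\<bar>" using big v by (intro mult_left_mono) (auto simp: L_def)
      finally show ?thesis .
    qed
    have iA: "integrable M (\<lambda>\<omega>. \<bar>A k \<omega> / real k - \<sigma>\<bar>)" unfolding A_def using ai by auto
    have iS: "complex_integrable M (\<lambda>\<omega>. iexp (?S \<omega>))"
    proof (rule integrable_const_bound[of _ 1])
      have "?S \<in> borel_measurable M" using adapted_measurable[OF a] by measurable
      then show "(\<lambda>\<omega>. iexp (?S \<omega>)) \<in> borel_measurable M" by measurable
    qed simp
    have iE: "complex_integrable M ?E"
      using one not_integrable_integral_eq[of M ?E] by auto
    have "(CLINT \<omega>|M. iexp (?S \<omega>)) - c = (CLINT \<omega>|M. iexp (?S \<omega>) - c * ?E \<omega>)"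
      using iS iE one by simp
    then have "norm ((CLINT \<omega>|M. iexp (?S \<omega>)) - c) \<le> expectation (\<lambda>\<omega>. norm (iexp (?S \<omega>) - c * ?E \<omega>))"
      using integral_norm_bound[of M "\<lambda>\<omega>. iexp (?S \<omega>) - c * ?E \<omega>"] by (simp only:)
    also have "\<dots> \<le> expectation (\<lambda>\<omega>. L * \<bar>A k \<omega> / real k - \<sigma>\<bar>)"
      using iS iE iA by (intro integral_mono pw integrable_norm) auto
    also have "\<dots> = L * expectation (\<lambda>\<omega>. \<bar>A k \<omega> / real k - \<sigma>\<bar>)" by simp
    finally show ?thesis by (simp add: A_def)
  qed
  have "(\<lambda>k. (CLINT \<omega>|M. iexp ((\<Sum>s<k. a s \<omega> * X s \<omega>) / sqrt (real k))) - c) \<longlonglongrightarrow> 0"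
  proof (rule Lim_null_comparison)
    show "\<forall>\<^sub>F k in sequentially. norm ((CLINT \<omega>|M. iexp ((\<Sum>s<k. a s \<omega> * X s \<omega>) / sqrt (real k))) - c) \<le>
       L * expectation (\<lambda>\<omega>. \<bar>(\<Sum>s<k. (a s \<omega>)\<^sup>2) / real k - \<sigma>\<bar>)"
      using bound by (auto simp: eventually_sequentially)
    show "(\<lambda>k. L * expectation (\<lambda>\<omega>. \<bar>(\<Sum>s<k. (a s \<omega>)\<^sup>2) / real k - \<sigma>\<bar>)) \<longlonglongrightarrow> 0"
      using tendsto_mult_right_zero[OF lim] .
  qed
  then show ?thesis by (simp add: LIM_zero_iff c_def)
qed

end

lemma iexp_diff_le: "cmod (iexp a - iexp b) \<le> \<bar>a - b\<bar>"
proof -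
  have "iexp a - iexp b = iexp b * (iexp (a - b) - 1)"
    by (simp add: algebra_simps exp_add[symmetric])
  then have "cmod (iexp a - iexp b) = cmod (iexp (a - b) - 1)" by (simp only: norm_mult norm_exp_i_times mult_1_left)
  also have "\<dots> \<le> \<bar>a - b\<bar>" using iexp_approx1[of "a - b" 0] by simp
  finally show ?thesis .
qed


section \<open>Linearisation of the estimation error\<close>

text \<open>
  Least squares with regressors \<open>x\<^sub>s\<close> that belong to the past of the Gaussian noise \<open>X\<^sub>s\<close>. Time starts at \<open>0\<close>, so \<open>x\<^sub>s\<close>
  and \<open>X\<^sub>s\<close> stand for \<open>\<phi>\<^bsub>s+1\<^esub>\<close> and \<open>d\<^bsub>s+1\<^esub>\<close>. The matrices \<open>Pm\<close> are those of the recursion, which enter only through the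
  properties assumed here; \<open>S\<close> is the inverse of the limit \<open>R\<close>, and \<open>g\<close> is the contribution of the initial
  estimate.
\<close>

locale rls_regression = innovations M F X for M F and X :: "nat \<Rightarrow> 'w \<Rightarrow> real" +
  fixes x :: "nat \<Rightarrow> 'w \<Rightarrow> real^'p" and R S Q0 :: "real^'p^'p" and g :: "real^'p"
    and v B pc :: real and Pm :: "nat \<Rightarrow> 'w \<Rightarrow> real^'p^'p"
  assumes v: "v \<ge> 0"
    and X_law: "\<And>s. distr M borel (X s) = gaussian_law 0 v"
    and x_adapted: "\<And>s. x s \<in> borel_measurable (F s)"
    and x_int: "\<And>s i. integrable M (\<lambda>\<omega>. (x s \<omega> $ i) ^ 4)"
    and x_B: "\<And>s i. expectation (\<lambda>\<omega>. (x s \<omega> $ i) ^ 4) \<le> B"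
    and mean: "(\<lambda>k. (1 / real k) *\<^sub>R (\<Sum>s<k. \<chi> i j. expectation (\<lambda>\<omega>. x s \<omega> $ i * x s \<omega> $ j))) \<longlonglongrightarrow> R"
    and RS: "R ** S = mat 1" and S_sym: "transpose S = S" and S_psd: "\<And>u. 0 \<le> u \<bullet> (S *v u)"
    and P_inv: "\<And>k \<omega>. \<omega> \<in> space M \<Longrightarrow> Pm k \<omega> ** (Q0 + (\<Sum>s<k. outer (x s \<omega>) (x s \<omega>))) = mat 1"
    and P_meas: "\<And>k. Pm k \<in> borel_measurable M"
    and P_bound: "\<And>k \<omega>. \<omega> \<in> space M \<Longrightarrow> norm (Pm k \<omega>) \<le> pc"
begin

definition score :: "nat \<Rightarrow> 'w \<Rightarrow> real^'p" where
  "score k \<omega> = (\<Sum>s<k. X s \<omega> *\<^sub>R x s \<omega>)"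

definition mean_info :: "nat \<Rightarrow> real^'p^'p" where
  "mean_info k = (\<Sum>s<k. \<chi> i j. expectation (\<lambda>\<omega>. x s \<omega> $ i * x s \<omega> $ j))"

definition fluctuation :: "nat \<Rightarrow> 'w \<Rightarrow> real^'p^'p" where
  "fluctuation k \<omega> = (\<Sum>s<k. outer (x s \<omega>) (x s \<omega>)) - mean_info k"

text \<open>
  The law of large numbers for the information matrix in \<open>L\<^bsup>2q\<^esup>\<close>, at the rate of independent summands.
\<close>

definition moment_rate :: "nat \<Rightarrow> bool" where
  "moment_rate q \<longleftrightarrow> (\<exists>C\<ge>0. \<forall>k i j. integrable M (\<lambda>\<omega>. (fluctuation k \<omega> $ i $ j) ^ (2 * q)) \<and>
     expectation (\<lambda>\<omega>. (fluctuation k \<omega> $ i $ j) ^ (2 * q)) \<le> C * real (Suc k) ^ q)"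

definition deviation :: "nat \<Rightarrow> 'w \<Rightarrow> real" where
  "deviation k \<omega> = norm (fluctuation k \<omega>) / real k"

text \<open>
  The deterministic part of the distance of the averaged information matrix from \<open>R\<close>. It tends to zero
  without any rate, so it is kept apart from the random part, of which high powers are taken.
\<close>

definition bias :: "nat \<Rightarrow> real" where
  "bias k = norm ((1 / real k) *\<^sub>R (Q0 + mean_info k) - R)"

definition scaled_error :: "nat \<Rightarrow> 'w \<Rightarrow> real^'p" where
  "scaled_error k \<omega> = sqrt (real k) *\<^sub>R (Pm k \<omega> *v (g + score k \<omega>))"

text \<open>
  The scaled error with \<open>Pm k\<close> replaced by its asymptotic value \<open>S / k\<close> and without the initial estimate.
\<close>

definition linear_part :: "nat \<Rightarrow> 'w \<Rightarrow> real^'p" where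
  "linear_part k \<omega> = (1 / sqrt (real k)) *\<^sub>R (S *v score k \<omega>)"

definition remainder :: "nat \<Rightarrow> 'w \<Rightarrow> real" where
  "remainder k \<omega> = norm (scaled_error k \<omega> - linear_part k \<omega>)"

lemma x_measurable [measurable]: "x s \<in> borel_measurable M"
  by (rule adapted_measurable[OF x_adapted])

lemma P_measurable [measurable]: "Pm k \<in> borel_measurable M" by (rule P_meas)

lemma x_nth_adapted: "(\<lambda>\<omega>. x s \<omega> $ i) \<in> borel_measurable (F s)"
  using measurable_compose[OF x_adapted vec_nth_borel_measurable] .

lemma score_measurable [measurable]: "score k \<in> borel_measurable M"
  unfolding score_def[abs_def] by measurable

lemma fluctuation_measurable [measurable]: "fluctuation k \<in> borel_measurable M"
  unfolding fluctuation_def[abs_def]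
  by (intro borel_measurable_diff borel_measurable_sum outer_borel_measurable) auto

lemma deviation_measurable [measurable]: "deviation k \<in> borel_measurable M"
  unfolding deviation_def[abs_def] by measurable

lemma scaled_error_measurable [measurable]: "scaled_error k \<in> borel_measurable M"
  unfolding scaled_error_def[abs_def]
  by (intro borel_measurable_scaleR matrix_vector_borel_measurable) auto

lemma linear_part_measurable [measurable]: "linear_part k \<in> borel_measurable M"
  unfolding linear_part_def[abs_def]
  by (intro borel_measurable_scaleR matrix_vector_borel_measurable) auto

lemma remainder_measurable [measurable]: "remainder k \<in> borel_measurable M"
  unfolding remainder_def[abs_def] by measurable

lemma score_nth: "score k \<omega> $ i = (\<Sum>s<k. x s \<omega> $ i * X s \<omega>)"
  by (simp add: score_def mult.commute)

lemma X_moments: "integrable M (\<lambda>\<omega>. X s \<omega> ^ j)" "expectation (\<lambda>\<omega>. X s \<omega> ^ j) = (\<integral>y. y ^ j \<partial>gaussian_law 0 v)"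
proof -
  have "integrable (distr M borel (X s)) (\<lambda>y. y ^ j)"
    unfolding X_law by (rule gaussian_law_moments[OF v])
  then show "integrable M (\<lambda>\<omega>. X s \<omega> ^ j)" by (subst (asm) integrable_distr_eq) auto
  show "expectation (\<lambda>\<omega>. X s \<omega> ^ j) = (\<integral>y. y ^ j \<partial>gaussian_law 0 v)"
    unfolding X_law[of s, symmetric] by (subst integral_distr) auto
qed

lemma X_mean: "expectation (X s) = 0" and X_var: "expectation (\<lambda>\<omega>. (X s \<omega>)\<^sup>2) = v"
  using X_moments(2)[of s 1] X_moments(2)[of s 2] gaussian_law_moments[OF v] by auto

lemma X_char: "(CLINT \<omega>|M. iexp (t * X s \<omega>)) = complex_of_real (exp (- (v * t\<^sup>2) / 2))"
proof -
  have "(CLINT \<omega>|M. iexp (t * X s \<omega>)) = char (distr M borel (X s)) t"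
    unfolding char_def by (rule integral_distr[symmetric]) auto
  then show ?thesis unfolding X_law by (simp only: char_gaussian_law[OF v])
qed

lemma x_lower_moments:
  assumes "q \<in> {1, 2}"
  shows "integrable M (\<lambda>\<omega>. (x s \<omega> $ i) ^ (2 * q))" "expectation (\<lambda>\<omega>. (x s \<omega> $ i) ^ (2 * q)) \<le> 1 + B"
proof -
  have m: "(\<lambda>\<omega>. x s \<omega> $ i) \<in> borel_measurable M" by measurable
  have i4: "integrable M (\<lambda>\<omega>. (x s \<omega> $ i) ^ (2 * 2))" using x_int by simp
  have q: "2 * q \<le> 2 * (2::nat)" using assms by auto
  show "integrable M (\<lambda>\<omega>. (x s \<omega> $ i) ^ (2 * q))" by (rule integrable_lower_power[OF m i4 q])
  show "expectation (\<lambda>\<omega>. (x s \<omega> $ i) ^ (2 * q)) \<le> 1 + B"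
    using moment_le_one_plus[OF m i4 q] x_B[of s i] by simp
qed

lemma score_moment:
  assumes q: "q \<in> {1, 2}"
  shows "\<exists>C\<ge>0. \<forall>k. integrable M (\<lambda>\<omega>. norm (score k \<omega>) ^ (2 * q)) \<and>
     expectation (\<lambda>\<omega>. norm (score k \<omega>) ^ (2 * q)) \<le> C * real k ^ q"
proof -
  let ?mX = "\<integral>y. y ^ (2 * q) \<partial>gaussian_law 0 v" and ?n = "real CARD('p)"
  define C where "C = ?n ^ (2 * q) * (?n * (2 * 4 ^ q * exp (4 ^ q) * ((1 + B) * ?mX)))"
  have q1: "q \<ge> 1" using q by auto
  have "0 \<le> expectation (\<lambda>\<omega>. (x 0 \<omega> $ i) ^ 4)" for i by simp
  then have B: "0 \<le> B" using x_B order_trans by blast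
  have mX: "0 \<le> ?mX" by (intro integral_nonneg_AE AE_I2) (simp add: power_mult)
  have C: "C \<ge> 0" unfolding C_def using B mX by (intro mult_nonneg_nonneg) auto
  have comp: "integrable M (\<lambda>\<omega>. (score k \<omega> $ i) ^ (2 * q))"
    "expectation (\<lambda>\<omega>. (score k \<omega> $ i) ^ (2 * q)) \<le> 2 * 4 ^ q * exp (4 ^ q) * ((1 + B) * ?mX) * real k ^ q" for k i
  proof -
    note mt = martingale_transform_moment[where z = "\<lambda>s \<omega>. x s \<omega> $ i" and n = k, OF q1 x_nth_adapted
        x_lower_moments(1)[OF q] x_lower_moments(2)[OF q] X_moments(1) eq_refl[OF X_moments(2)] X_mean]
    show "integrable M (\<lambda>\<omega>. (score k \<omega> $ i) ^ (2 * q))" unfolding score_nth by (rule mt(1))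
    show "expectation (\<lambda>\<omega>. (score k \<omega> $ i) ^ (2 * q)) \<le> 2 * 4 ^ q * exp (4 ^ q) * ((1 + B) * ?mX) * real k ^ q"
      unfolding score_nth by (rule mt(2))
  qed
  have pw: "norm (score k \<omega>) ^ (2 * q) \<le> ?n ^ (2 * q) * (\<Sum>i\<in>UNIV. (score k \<omega> $ i) ^ (2 * q))" for k \<omega>
  proof -
    have "norm (score k \<omega>) ^ (2 * q) \<le> (\<Sum>i\<in>UNIV. \<bar>score k \<omega> $ i\<bar>) ^ (2 * q)"
      by (intro power_mono norm_le_l1_cart) auto
    also have "\<dots> \<le> ?n ^ (2 * q) * (\<Sum>i\<in>UNIV. \<bar>score k \<omega> $ i\<bar> ^ (2 * q))"
      using q1 by (intro sum_power_le_card) auto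
    finally show ?thesis by (simp add: power_mult)
  qed
  have i: "integrable M (\<lambda>\<omega>. ?n ^ (2 * q) * (\<Sum>i\<in>UNIV. (score k \<omega> $ i) ^ (2 * q)))" for k
    using comp(1) by (intro integrable_mult_right Bochner_Integration.integrable_sum) auto
  have int: "integrable M (\<lambda>\<omega>. norm (score k \<omega>) ^ (2 * q))" for k
  proof (rule Bochner_Integration.integrable_bound[OF i[of k]])
    show "AE \<omega> in M. norm (norm (score k \<omega>) ^ (2 * q)) \<le> norm (?n ^ (2 * q) * (\<Sum>i\<in>UNIV. (score k \<omega> $ i) ^ (2 * q)))"
    proof (rule AE_I2)
      fix \<omega>
      show "norm (norm (score k \<omega>) ^ (2 * q)) \<le> norm (?n ^ (2 * q) * (\<Sum>i\<in>UNIV. (score k \<omega> $ i) ^ (2 * q)))"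
      proof -
        have "0 \<le> norm (score k \<omega>) ^ (2 * q)" by simp
        then show ?thesis using pw[of k \<omega>] unfolding real_norm_def by linarith
      qed
    qed
  qed measurable
  have "expectation (\<lambda>\<omega>. norm (score k \<omega>) ^ (2 * q)) \<le> C * real k ^ q" for k
  proof -
    have "expectation (\<lambda>\<omega>. norm (score k \<omega>) ^ (2 * q)) \<le> expectation (\<lambda>\<omega>. ?n ^ (2 * q) * (\<Sum>i\<in>UNIV. (score k \<omega> $ i) ^ (2 * q)))"
      by (rule integral_mono[OF int i pw])
    also have "\<dots> = ?n ^ (2 * q) * (\<Sum>i\<in>UNIV. expectation (\<lambda>\<omega>. (score k \<omega> $ i) ^ (2 * q)))"
      using comp(1) by (subst integral_mult_right_zero, subst Bochner_Integration.integral_sum) auto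
    also have "\<dots> \<le> ?n ^ (2 * q) * (\<Sum>i\<in>(UNIV::'p set). 2 * 4 ^ q * exp (4 ^ q) * ((1 + B) * ?mX) * real k ^ q)"
      by (intro mult_left_mono sum_mono comp(2)) auto
    also have "\<dots> = C * real k ^ q" by (simp add: C_def)
    finally show ?thesis .
  qed
  with int C show ?thesis by blast
qed

lemma deviation_moment:
  assumes q: "q \<ge> 1" and mr: "moment_rate q"
  shows "\<exists>C\<ge>0. \<forall>k\<ge>1. integrable M (\<lambda>\<omega>. deviation k \<omega> ^ (2 * q)) \<and>
     expectation (\<lambda>\<omega>. deviation k \<omega> ^ (2 * q)) \<le> C / real k ^ q"
proof -
  obtain C where C: "C \<ge> 0" "\<And>k i j. integrable M (\<lambda>\<omega>. (fluctuation k \<omega> $ i $ j) ^ (2 * q))"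
    "\<And>k i j. expectation (\<lambda>\<omega>. (fluctuation k \<omega> $ i $ j) ^ (2 * q)) \<le> C * real (Suc k) ^ q"
    using mr unfolding moment_rate_def by blast
  let ?n = "real CARD('p \<times> 'p)"
  define D where "D = ?n ^ (2 * q) * (?n * (C * 2 ^ q))"
  have D: "D \<ge> 0" using C(1) by (simp add: D_def)
  have pw: "deviation k \<omega> ^ (2 * q) \<le> (1 / real k ^ (2 * q)) * (?n ^ (2 * q) * (\<Sum>(i, j)\<in>UNIV. (fluctuation k \<omega> $ i $ j) ^ (2 * q)))" for k \<omega>
  proof -
    have "norm (fluctuation k \<omega>) ^ (2 * q) \<le> (\<Sum>p\<in>UNIV. \<bar>fluctuation k \<omega> $ fst p $ snd p\<bar>) ^ (2 * q)"
      using norm_matrix_le_sum[of "fluctuation k \<omega>"] by (intro power_mono) (auto simp: case_prod_beta)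
    also have "\<dots> \<le> ?n ^ (2 * q) * (\<Sum>p\<in>UNIV. \<bar>fluctuation k \<omega> $ fst p $ snd p\<bar> ^ (2 * q))"
      using q by (intro sum_power_le_card) auto
    also have "(\<Sum>p\<in>UNIV. \<bar>fluctuation k \<omega> $ fst p $ snd p\<bar> ^ (2 * q)) = (\<Sum>(i, j)\<in>UNIV. (fluctuation k \<omega> $ i $ j) ^ (2 * q))"
      by (intro sum.cong) (auto simp: power_mult)
    finally have "(1 / real k ^ (2 * q)) * norm (fluctuation k \<omega>) ^ (2 * q) \<le>
       (1 / real k ^ (2 * q)) * (?n ^ (2 * q) * (\<Sum>(i, j)\<in>UNIV. (fluctuation k \<omega> $ i $ j) ^ (2 * q)))"
      by (intro mult_left_mono) auto
    then show ?thesis by (simp add: deviation_def power_divide)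
  qed
  have i: "integrable M (\<lambda>\<omega>. (1 / real k ^ (2 * q)) * (?n ^ (2 * q) * (\<Sum>(i, j)\<in>UNIV. (fluctuation k \<omega> $ i $ j) ^ (2 * q))))" for k
    using C(2) by (intro integrable_mult_right Bochner_Integration.integrable_sum) auto
  have int: "integrable M (\<lambda>\<omega>. deviation k \<omega> ^ (2 * q))" for k
  proof (rule Bochner_Integration.integrable_bound[OF i[of k]])
    show "AE \<omega> in M. norm (deviation k \<omega> ^ (2 * q)) \<le>
       norm ((1 / real k ^ (2 * q)) * (?n ^ (2 * q) * (\<Sum>(i, j)\<in>UNIV. (fluctuation k \<omega> $ i $ j) ^ (2 * q))))"
    proof (rule AE_I2)
      fix \<omega>
      have "norm (deviation k \<omega> ^ (2 * q)) = deviation k \<omega> ^ (2 * q)" by (simp add: power_mult)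
      then show "norm (deviation k \<omega> ^ (2 * q)) \<le>
         norm ((1 / real k ^ (2 * q)) * (?n ^ (2 * q) * (\<Sum>(i, j)\<in>UNIV. (fluctuation k \<omega> $ i $ j) ^ (2 * q))))"
        using pw[of k \<omega>] unfolding real_norm_def by linarith
    qed
  qed measurable
  have "expectation (\<lambda>\<omega>. deviation k \<omega> ^ (2 * q)) \<le> D / real k ^ q" if k: "k \<ge> 1" for k
  proof -
    have "expectation (\<lambda>\<omega>. deviation k \<omega> ^ (2 * q)) \<le>
       expectation (\<lambda>\<omega>. (1 / real k ^ (2 * q)) * (?n ^ (2 * q) * (\<Sum>(i, j)\<in>UNIV. (fluctuation k \<omega> $ i $ j) ^ (2 * q))))"
      by (rule integral_mono[OF int i pw])
    also have "\<dots> = (1 / real k ^ (2 * q)) * (?n ^ (2 * q) * (\<Sum>p\<in>UNIV. expectation (\<lambda>\<omega>. (fluctuation k \<omega> $ fst p $ snd p) ^ (2 * q))))"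
      using C(2) by (simp only: integral_mult_right_zero case_prod_beta) (subst Bochner_Integration.integral_sum, auto simp: case_prod_beta)
    also have "\<dots> \<le> (1 / real k ^ (2 * q)) * (?n ^ (2 * q) * (\<Sum>p\<in>(UNIV::('p\<times>'p) set). C * (2 * real k) ^ q))"
    proof (intro mult_left_mono sum_mono)
      fix p :: "'p \<times> 'p"
      have "C * real (Suc k) ^ q \<le> C * (2 * real k) ^ q" using k C(1) by (intro mult_left_mono power_mono) auto
      then show "expectation (\<lambda>\<omega>. (fluctuation k \<omega> $ fst p $ snd p) ^ (2 * q)) \<le> C * (2 * real k) ^ q"
        using C(3) order_trans by blast
    qed auto
    also have "\<dots> = D * (real k ^ q / real k ^ (2 * q))" by (simp add: D_def power_mult_distrib)
    also have "real k ^ q / real k ^ (2 * q) = 1 / real k ^ q"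
      using k by (simp add: mult_2 power_add)
    finally show ?thesis by simp
  qed
  with int D show ?thesis by blast
qed

lemma bias_tendsto: "bias \<longlonglongrightarrow> 0"
proof -
  have "(\<lambda>k. (1 / real k) *\<^sub>R Q0) \<longlonglongrightarrow> 0 *\<^sub>R Q0"
    by (intro tendsto_scaleR tendsto_const lim_1_over_n)
  then have "(\<lambda>k. (1 / real k) *\<^sub>R Q0 + (1 / real k) *\<^sub>R mean_info k) \<longlonglongrightarrow> 0 + R"
    using mean by (intro tendsto_add) (simp_all add: mean_info_def)
  then have "(\<lambda>k. (1 / real k) *\<^sub>R (Q0 + mean_info k) - R) \<longlonglongrightarrow> 0"
    by (simp add: scaleR_add_right LIM_zero)
  then show ?thesis unfolding bias_def[abs_def] by (rule tendsto_norm_zero)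
qed

text \<open>
  This bound holds on the whole space, because the matrices \<open>Pm k\<close> are bounded.
\<close>

lemma remainder_crude:
  assumes k: "k \<ge> 1" and \<omega>: "\<omega> \<in> space M"
  shows "remainder k \<omega> \<le> sqrt (real k) * ((pc + norm S) * (norm g + norm (score k \<omega>)))"
proof -
  let ?w = "norm (score k \<omega>)"
  have sk: "sqrt (real k) \<ge> 1" using k by simp
  have "norm (scaled_error k \<omega>) \<le> sqrt (real k) * (pc * (norm g + ?w))"
  proof -
    have "norm (Pm k \<omega> *v (g + score k \<omega>)) \<le> norm (Pm k \<omega>) * norm (g + score k \<omega>)" by (rule norm_matrix_vector_le)
    also have "\<dots> \<le> pc * (norm g + ?w)"
      using P_bound[OF \<omega>] by (intro mult_mono norm_triangle_ineq) (auto intro: order_trans[OF norm_ge_zero])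
    finally show ?thesis unfolding scaled_error_def by (simp add: mult_left_mono)
  qed
  moreover have "norm (linear_part k \<omega>) \<le> sqrt (real k) * (norm S * (norm g + ?w))"
  proof -
    have "norm (linear_part k \<omega>) = (1 / sqrt (real k)) * norm (S *v score k \<omega>)" by (simp add: linear_part_def)
    also have "\<dots> \<le> sqrt (real k) * (norm S * (norm g + ?w))"
    proof (rule mult_mono)
      have "1 / sqrt (real k) \<le> 1" using sk by simp
      then show "1 / sqrt (real k) \<le> sqrt (real k)" using sk by linarith
      show "norm (S *v score k \<omega>) \<le> norm S * (norm g + ?w)"
        by (rule order_trans[OF norm_matrix_vector_le]) (intro mult_left_mono, auto)
    qed auto
    finally show ?thesis .
  qed
  moreover have "remainder k \<omega> \<le> norm (scaled_error k \<omega>) + norm (linear_part k \<omega>)"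
    unfolding remainder_def by (rule norm_triangle_ineq4)
  ultimately show ?thesis by (simp add: distrib_left distrib_right)
qed

text \<open>
  Here the averaged information matrix is close enough to \<open>R\<close> for its inverse \<open>k Pm k\<close> to be close to \<open>S\<close>.
\<close>

lemma remainder_good:
  assumes k: "k \<ge> 1" and \<omega>: "\<omega> \<in> space M" and good: "(deviation k \<omega> + bias k) * norm S \<le> 1 / 2"
  shows "remainder k \<omega> \<le> 2 * (norm S)\<^sup>2 * (deviation k \<omega> + bias k) * (norm (score k \<omega>) / sqrt (real k))
      + 2 * norm S * norm g / sqrt (real k)"
proof -
  define V where "V = (1 / real k) *\<^sub>R (Q0 + (\<Sum>s<k. outer (x s \<omega>) (x s \<omega>)))"
  define W where "W = real k *\<^sub>R Pm k \<omega>"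
  let ?w = "score k \<omega>" and ?r = "sqrt (real k)"
  have k0: "real k \<noteq> 0" "?r > 0" using k by auto
  have "V - R = (1 / real k) *\<^sub>R fluctuation k \<omega> + ((1 / real k) *\<^sub>R (Q0 + mean_info k) - R)"
    by (simp add: V_def fluctuation_def algebra_simps)
  then have "norm (V - R) \<le> norm ((1 / real k) *\<^sub>R fluctuation k \<omega>) + bias k"
    unfolding bias_def by (metis norm_triangle_ineq)
  then have VR: "norm (V - R) \<le> deviation k \<omega> + bias k" by (simp add: deviation_def)
  have "W ** V = Pm k \<omega> ** (Q0 + (\<Sum>s<k. outer (x s \<omega>) (x s \<omega>)))"
    using k0 unfolding V_def W_def by (simp add: vec_eq_iff matrix_matrix_mult_def)
  then have WV: "W ** V = mat 1" using P_inv[OF \<omega>] by simp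
  have "norm (V - R) * norm S \<le> (deviation k \<omega> + bias k) * norm S" using VR by (intro mult_right_mono) auto
  then have small: "norm (V - R) * norm S \<le> 1 / 2" using good by linarith
  note ip = inverse_perturbation[OF WV RS small]
  have "norm (W - S) \<le> 2 * (norm S)\<^sup>2 * (deviation k \<omega> + bias k)"
    using ip(2) VR by (meson mult_left_mono order_trans zero_le_mult_iff zero_le_numeral zero_le_power2)
  then have a: "norm ((W - S) *v ?w) \<le> 2 * (norm S)\<^sup>2 * (deviation k \<omega> + bias k) * norm ?w"
    by (rule order_trans[OF norm_matrix_vector_le mult_right_mono]) simp
  have b: "norm (W *v g) \<le> 2 * norm S * norm g"
    by (rule order_trans[OF norm_matrix_vector_le mult_right_mono[OF ip(1)]]) simp
  have "scaled_error k \<omega> - linear_part k \<omega> = (1 / ?r) *\<^sub>R ((W - S) *v ?w + W *v g)"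
  proof -
    have r: "?r = real k / ?r" using k0 by (simp add: real_div_sqrt)
    have "scaled_error k \<omega> = (real k / ?r) *\<^sub>R (Pm k \<omega> *v (g + ?w))"
      unfolding scaled_error_def using r by simp
    also have "\<dots> = (1 / ?r) *\<^sub>R (W *v (g + ?w))" by (simp add: W_def scaleR_matrix_vector)
    finally show ?thesis
      by (simp add: linear_part_def matrix_vector_right_distrib matrix_vector_mult_diff_rdistrib algebra_simps)
  qed
  then have "remainder k \<omega> = (1 / ?r) * norm ((W - S) *v ?w + W *v g)"
    using k0 by (simp add: remainder_def)
  also have "\<dots> \<le> (1 / ?r) * (2 * (norm S)\<^sup>2 * (deviation k \<omega> + bias k) * norm ?w + 2 * norm S * norm g)"
    using k0 by (intro mult_left_mono order_trans[OF norm_triangle_ineq add_mono[OF a b]]) auto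
  finally show ?thesis by (simp add: add_divide_distrib)
qed

lemma eventually_bias_small: "\<forall>\<^sub>F k in sequentially. k \<ge> 1 \<and> bias k * norm S \<le> 1 / 4"
proof -
  have "(\<lambda>k. bias k * norm S) \<longlonglongrightarrow> 0" using tendsto_mult_left_zero[OF bias_tendsto] .
  then have "\<forall>\<^sub>F k in sequentially. bias k * norm S < 1 / 4" by (rule order_tendstoD) simp
  with eventually_ge_at_top[of 1] show ?thesis by eventually_elim auto
qed

lemma deviation_nonneg: "0 \<le> deviation k \<omega>" by (simp add: deviation_def)
lemma bias_nonneg: "0 \<le> bias k" by (simp add: bias_def)
lemma remainder_nonneg: "0 \<le> remainder k \<omega>" by (simp add: remainder_def)

lemma large_deviation:
  assumes "bias k * norm S \<le> 1 / 4" "\<not> (deviation k \<omega> + bias k) * norm S \<le> 1 / 2"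
  shows "1 \<le> 4 * norm S * deviation k \<omega>"
proof -
  have "4 * norm S * deviation k \<omega> = 4 * (deviation k \<omega> * norm S)" by simp
  then show ?thesis using assms unfolding distrib_right by linarith
qed

lemma deviation_mean:
  assumes "moment_rate 1"
  shows "\<exists>C\<ge>0. \<forall>k\<ge>1. integrable M (\<lambda>\<omega>. (deviation k \<omega>)\<^sup>2) \<and>
    expectation (\<lambda>\<omega>. (deviation k \<omega>)\<^sup>2) \<le> C / real k \<and>
    integrable M (deviation k) \<and> expectation (deviation k) \<le> sqrt (C / real k)"
proof -
  obtain C where C: "C \<ge> 0" "\<And>k. k \<ge> 1 \<Longrightarrow> integrable M (\<lambda>\<omega>. (deviation k \<omega>)\<^sup>2)"
    "\<And>k. k \<ge> 1 \<Longrightarrow> expectation (\<lambda>\<omega>. (deviation k \<omega>)\<^sup>2) \<le> C / real k"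
    using deviation_moment[OF _ assms] by auto
  have one: "(\<lambda>_. 1) \<in> borel_measurable M" "integrable M (\<lambda>_. (1::real)\<^sup>2)" "expectation (\<lambda>_. (1::real)\<^sup>2) \<le> 1"
    by (auto simp: prob_space)
  have d1: "integrable M (deviation k)" if "k \<ge> 1" for k
    using integrable_mult_of_squares[OF deviation_measurable one(1) C(2)[OF that] one(2)] by simp
  have d2: "expectation (deviation k) \<le> sqrt (C / real k)" if "k \<ge> 1" for k
    using expectation_cauchy_schwarz[OF deviation_measurable one(1) C(2)[OF that] one(2) C(3)[OF that] one(3)] by simp
  show ?thesis using C d1 d2 by blast
qed

lemma score_mean:
  "\<exists>C\<ge>0. \<forall>k. integrable M (\<lambda>\<omega>. (norm (score k \<omega>))\<^sup>2) \<and>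
    expectation (\<lambda>\<omega>. (norm (score k \<omega>))\<^sup>2) \<le> C * real k \<and>
    integrable M (\<lambda>\<omega>. norm (score k \<omega>)) \<and> expectation (\<lambda>\<omega>. norm (score k \<omega>)) \<le> sqrt (C * real k)"
proof -
  obtain C where C: "C \<ge> 0" "\<And>k. integrable M (\<lambda>\<omega>. (norm (score k \<omega>))\<^sup>2)"
    "\<And>k. expectation (\<lambda>\<omega>. (norm (score k \<omega>))\<^sup>2) \<le> C * real k"
    using score_moment[of 1] by auto
  have one: "(\<lambda>_. 1) \<in> borel_measurable M" "integrable M (\<lambda>_. (1::real)\<^sup>2)" "expectation (\<lambda>_. (1::real)\<^sup>2) \<le> 1"
    by (auto simp: prob_space)
  have m: "(\<lambda>\<omega>. norm (score k \<omega>)) \<in> borel_measurable M" for k by measurable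
  have d1: "integrable M (\<lambda>\<omega>. norm (score k \<omega>))" for k
    using integrable_mult_of_squares[OF m one(1) C(2) one(2)] by simp
  have d2: "expectation (\<lambda>\<omega>. norm (score k \<omega>)) \<le> sqrt (C * real k)" for k
    using expectation_cauchy_schwarz[OF m one(1) C(2) one(2) C(3) one(3), of k] by simp
  show ?thesis using C d1 d2 by blast
qed

text \<open>
  Where the bound for a good information matrix fails, \<open>4 |S|\<close> times the deviation is at least one and dominates the
  truncated remainder. Elsewhere the product of the deviation and the score has a bounded expectation by the Cauchy-Schwarz
  inequality, and it is divided by \<open>\<surd>k\<close>; the product of the bias and the score is small because the bias is.
\<close>

lemma remainder_in_probability:
  assumes mr: "moment_rate 1"
  shows "(\<lambda>k. expectation (\<lambda>\<omega>. min 1 (remainder k \<omega>))) \<longlonglongrightarrow> 0"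
proof -
  obtain C where C: "C \<ge> 0" "\<And>k. k \<ge> 1 \<Longrightarrow> integrable M (\<lambda>\<omega>. (deviation k \<omega>)\<^sup>2)"
    "\<And>k. k \<ge> 1 \<Longrightarrow> expectation (\<lambda>\<omega>. (deviation k \<omega>)\<^sup>2) \<le> C / real k"
    "\<And>k. k \<ge> 1 \<Longrightarrow> integrable M (deviation k)"
    "\<And>k. k \<ge> 1 \<Longrightarrow> expectation (deviation k) \<le> sqrt (C / real k)"
    using deviation_mean[OF mr] by blast
  obtain D where D: "D \<ge> 0" "\<And>k. integrable M (\<lambda>\<omega>. (norm (score k \<omega>))\<^sup>2)"
    "\<And>k. expectation (\<lambda>\<omega>. (norm (score k \<omega>))\<^sup>2) \<le> D * real k"
    "\<And>k. integrable M (\<lambda>\<omega>. norm (score k \<omega>))"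
    "\<And>k. expectation (\<lambda>\<omega>. norm (score k \<omega>)) \<le> sqrt (D * real k)"
    using score_mean by blast
  let ?s = "norm S"
  let ?ub = "\<lambda>k. 2 * ?s\<^sup>2 * (sqrt C * sqrt D / sqrt (real k) + bias k * sqrt D)
     + 2 * ?s * norm g / sqrt (real k) + 4 * ?s * (sqrt C / sqrt (real k))"
  have "\<forall>\<^sub>F k in sequentially. norm (expectation (\<lambda>\<omega>. min 1 (remainder k \<omega>))) \<le> ?ub k"
    using eventually_bias_small
  proof eventually_elim
    case (elim k)
    then have k: "k \<ge> 1" and bs: "bias k * ?s \<le> 1 / 4" by auto
    let ?r = "sqrt (real k)" and ?w = "\<lambda>\<omega>. norm (score k \<omega>)"
    have r: "?r > 0" using k by simp
    have dw: "integrable M (\<lambda>\<omega>. deviation k \<omega> * ?w \<omega>)"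
      by (rule integrable_mult_of_squares) (use C(2)[OF k] D(2) in auto)
    have dwb: "expectation (\<lambda>\<omega>. deviation k \<omega> * ?w \<omega>) \<le> sqrt C * sqrt D"
    proof -
      have "\<bar>expectation (\<lambda>\<omega>. deviation k \<omega> * ?w \<omega>)\<bar> \<le> sqrt (C / real k) * sqrt (D * real k)"
        by (rule expectation_cauchy_schwarz) (use C(2,3)[OF k] D(2,3) in auto)
      also have "\<dots> = sqrt C * sqrt D" using r by (simp add: real_sqrt_mult real_sqrt_divide)
      finally show ?thesis by linarith
    qed
    let ?rhs = "\<lambda>\<omega>. 2 * ?s\<^sup>2 / ?r * (deviation k \<omega> * ?w \<omega>) + 2 * ?s\<^sup>2 / ?r * bias k * ?w \<omega>
       + 2 * ?s * norm g / ?r + 4 * ?s * deviation k \<omega>"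
    have pw: "min 1 (remainder k \<omega>) \<le> ?rhs \<omega>" if \<omega>: "\<omega> \<in> space M" for \<omega>
    proof -
      have nn: "0 \<le> 2 * ?s\<^sup>2 / ?r * (deviation k \<omega> * ?w \<omega>)" "0 \<le> 2 * ?s\<^sup>2 / ?r * bias k * ?w \<omega>"
        "0 \<le> 2 * ?s * norm g / ?r" "0 \<le> 4 * ?s * deviation k \<omega>"
        using r deviation_nonneg bias_nonneg by auto
      show ?thesis
      proof (cases "(deviation k \<omega> + bias k) * ?s \<le> 1 / 2")
        case True
        have "remainder k \<omega> \<le> 2 * ?s\<^sup>2 / ?r * (deviation k \<omega> * ?w \<omega>) + 2 * ?s\<^sup>2 / ?r * bias k * ?w \<omega>
          + 2 * ?s * norm g / ?r"
          using remainder_good[OF k \<omega> True] r by (simp add: field_simps)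
        then show ?thesis using nn by linarith
      next
        case False
        then have "1 \<le> 4 * ?s * deviation k \<omega>" using large_deviation bs by blast
        then show ?thesis using nn by linarith
      qed
    qed
    have ir: "integrable M ?rhs" using dw C(4)[OF k] D(4)[of k] by auto
    have im: "integrable M (\<lambda>\<omega>. min 1 (remainder k \<omega>))"
      by (rule integrable_const_bound[of _ 1]) (auto simp: remainder_nonneg)
    have "expectation (\<lambda>\<omega>. min 1 (remainder k \<omega>)) \<le> expectation ?rhs"
      by (rule integral_mono_AE[OF im ir]) (use pw in auto)
    also have "\<dots> = 2 * ?s\<^sup>2 / ?r * expectation (\<lambda>\<omega>. deviation k \<omega> * ?w \<omega>) + 2 * ?s\<^sup>2 / ?r * bias k * expectation ?w
       + 2 * ?s * norm g / ?r + 4 * ?s * expectation (deviation k)"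
      using dw C(4)[OF k] D(4)[of k] by (simp add: prob_space)
    also have "\<dots> \<le> 2 * ?s\<^sup>2 / ?r * (sqrt C * sqrt D) + 2 * ?s\<^sup>2 / ?r * bias k * sqrt (D * real k)
       + 2 * ?s * norm g / ?r + 4 * ?s * sqrt (C / real k)"
      using dwb C(5)[OF k] D(5)[of k] r bias_nonneg by (intro add_mono mult_left_mono) auto
    also have "\<dots> = ?ub k" using r by (simp add: real_sqrt_mult real_sqrt_divide field_simps)
    finally have "expectation (\<lambda>\<omega>. min 1 (remainder k \<omega>)) \<le> ?ub k" .
    moreover have "0 \<le> expectation (\<lambda>\<omega>. min 1 (remainder k \<omega>))"
      by (intro integral_nonneg_AE AE_I2) (simp add: remainder_nonneg)
    ultimately show ?case by simp
  qed
  moreover have "?ub \<longlonglongrightarrow> 0"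
  proof -
    have inv_sqrt: "(\<lambda>k. c / sqrt (real k)) \<longlonglongrightarrow> 0" for c
      by (intro real_tendsto_divide_at_top[OF tendsto_const] filterlim_compose[OF sqrt_at_top] filterlim_real_sequentially)
    have "?ub \<longlonglongrightarrow> 2 * ?s\<^sup>2 * (0 + 0 * sqrt D) + 0 + 4 * ?s * 0"
      by (intro tendsto_intros inv_sqrt bias_tendsto)
    then show ?thesis by simp
  qed
  ultimately show ?thesis by (rule Lim_null_comparison)
qed

lemma linear_part_inner: "u \<bullet> linear_part k \<omega> = (\<Sum>s<k. ((S *v u) \<bullet> x s \<omega>) * X s \<omega>) / sqrt (real k)"
proof -
  have "u \<bullet> (S *v score k \<omega>) = (S *v u) \<bullet> score k \<omega>"
    by (metis dot_lmul_matrix S_sym transpose_matrix_vector)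
  then show ?thesis
    by (simp add: linear_part_def score_def inner_sum_right mult.commute)
qed

text \<open>
  The quadratic variation in the direction \<open>u\<close> is the form of the averaged information matrix at \<open>S u\<close>, which tends to
  \<open>(S u) \<bullet> (R (S u)) = u \<bullet> (S u)\<close>.
\<close>

lemma linear_part_char:
  assumes mr: "moment_rate 1"
  shows "(\<lambda>k. CLINT \<omega>|M. iexp (u \<bullet> linear_part k \<omega>)) \<longlonglongrightarrow> complex_of_real (exp (- (v * (u \<bullet> (S *v u))) / 2))"
proof -
  let ?c = "S *v u"
  have \<sigma>: "?c \<bullet> (R *v ?c) = u \<bullet> (S *v u)"
    by (simp add: matrix_vector_mul_assoc RS matrix_vector_mul_lid inner_commute)
  obtain C where C: "C \<ge> 0" "\<And>k. k \<ge> 1 \<Longrightarrow> integrable M (deviation k)"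
    "\<And>k. k \<ge> 1 \<Longrightarrow> expectation (deviation k) \<le> sqrt (C / real k)"
    using deviation_mean[OF mr] by blast
  have aF: "(\<lambda>\<omega>. ?c \<bullet> x s \<omega>) \<in> borel_measurable (F s)" for s
    using x_adapted[of s] by simp
  have ai: "integrable M (\<lambda>\<omega>. (?c \<bullet> x s \<omega>)\<^sup>2)" for s
  proof -
    have "integrable M (\<lambda>\<omega>. (\<Sum>i\<in>UNIV. \<Sum>j\<in>UNIV. (?c $ i * ?c $ j) * (x s \<omega> $ i * x s \<omega> $ j)))"
      using x_lower_moments(1)[of 1]
      by (intro Bochner_Integration.integrable_sum integrable_mult_right integrable_mult_of_squares) auto
    moreover have "(?c \<bullet> x s \<omega>)\<^sup>2 = (\<Sum>i\<in>UNIV. \<Sum>j\<in>UNIV. (?c $ i * ?c $ j) * (x s \<omega> $ i * x s \<omega> $ j))" for \<omega>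
      by (simp add: inner_vec_def power2_eq_square sum_product mult_ac)
    ultimately show ?thesis by simp
  qed
  define \<beta> where "\<beta> = (\<lambda>k. norm ((1 / real k) *\<^sub>R mean_info k - R))"
  have \<beta>: "\<beta> \<longlonglongrightarrow> 0"
    using mean unfolding \<beta>_def mean_info_def by (intro tendsto_norm_zero LIM_zero)
  have pw: "\<bar>(\<Sum>s<k. (?c \<bullet> x s \<omega>)\<^sup>2) / real k - ?c \<bullet> (R *v ?c)\<bar> \<le> (norm ?c)\<^sup>2 * (deviation k \<omega> + \<beta> k)" for k \<omega>
  proof -
    let ?D = "(1 / real k) *\<^sub>R fluctuation k \<omega> + ((1 / real k) *\<^sub>R mean_info k - R)"
    have D: "?D = (1 / real k) *\<^sub>R (\<Sum>s<k. outer (x s \<omega>) (x s \<omega>)) - R"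
      by (simp add: fluctuation_def algebra_simps)
    have "?c \<bullet> (?D *v ?c) = (\<Sum>s<k. (?c \<bullet> x s \<omega>)\<^sup>2) / real k - ?c \<bullet> (R *v ?c)"
      unfolding D by (simp add: matrix_vector_mult_diff_rdistrib scaleR_matrix_vector sum_matrix_vector
          outer_mult_vec inner_diff_right inner_sum_right power2_eq_square inner_commute)
    moreover have "\<bar>?c \<bullet> (?D *v ?c)\<bar> \<le> norm ?c * (norm ?D * norm ?c)"
      by (rule order_trans[OF Cauchy_Schwarz_ineq2]) (intro mult_left_mono norm_matrix_vector_le, simp)
    moreover have "norm ?D \<le> deviation k \<omega> + \<beta> k"
      unfolding \<beta>_def deviation_def by (rule order_trans[OF norm_triangle_ineq]) simp
    then have "norm ?c * (norm ?D * norm ?c) \<le> norm ?c * ((deviation k \<omega> + \<beta> k) * norm ?c)"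
      by (intro mult_left_mono mult_right_mono) auto
    ultimately show ?thesis by (simp add: power2_eq_square mult_ac)
  qed
  have lim: "(\<lambda>k. expectation (\<lambda>\<omega>. \<bar>(\<Sum>s<k. (?c \<bullet> x s \<omega>)\<^sup>2) / real k - ?c \<bullet> (R *v ?c)\<bar>)) \<longlonglongrightarrow> 0"
  proof (rule Lim_null_comparison)
    show "\<forall>\<^sub>F k in sequentially. norm (expectation (\<lambda>\<omega>. \<bar>(\<Sum>s<k. (?c \<bullet> x s \<omega>)\<^sup>2) / real k - ?c \<bullet> (R *v ?c)\<bar>))
        \<le> (norm ?c)\<^sup>2 * (sqrt C / sqrt (real k) + \<beta> k)"
      using eventually_ge_at_top[of 1]
    proof eventually_elim
      case (elim k)
      have "expectation (\<lambda>\<omega>. \<bar>(\<Sum>s<k. (?c \<bullet> x s \<omega>)\<^sup>2) / real k - ?c \<bullet> (R *v ?c)\<bar>) \<le>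
        expectation (\<lambda>\<omega>. (norm ?c)\<^sup>2 * (deviation k \<omega> + \<beta> k))"
        using ai C(2)[OF elim] by (intro integral_mono pw) auto
      also have "\<dots> = (norm ?c)\<^sup>2 * (expectation (deviation k) + \<beta> k)" using C(2)[OF elim] by (simp add: prob_space)
      also have "\<dots> \<le> (norm ?c)\<^sup>2 * (sqrt C / sqrt (real k) + \<beta> k)"
        using C(3)[OF elim] by (intro mult_left_mono) (auto simp: real_sqrt_divide)
      finally show ?case by simp
    qed
    have "(\<lambda>k. sqrt C / sqrt (real k)) \<longlonglongrightarrow> 0"
      by (intro real_tendsto_divide_at_top[OF tendsto_const] filterlim_compose[OF sqrt_at_top] filterlim_real_sequentially)
    then have "(\<lambda>k. (norm ?c)\<^sup>2 * (sqrt C / sqrt (real k) + \<beta> k)) \<longlonglongrightarrow> (norm ?c)\<^sup>2 * (0 + 0)"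
      by (intro tendsto_intros \<beta>)
    then show "(\<lambda>k. (norm ?c)\<^sup>2 * (sqrt C / sqrt (real k) + \<beta> k)) \<longlonglongrightarrow> 0" by simp
  qed
  have "0 \<le> ?c \<bullet> (R *v ?c)" unfolding \<sigma> by (rule S_psd)
  from gaussian_martingale_clt[OF v X_char aF ai this lim]
  show ?thesis unfolding linear_part_inner \<sigma> .
qed

text \<open>
  Both the characteristic functions and the tightness of the scaled error are inherited from its linear part,
  since the remainder tends to zero in probability.
\<close>

theorem scaled_error_in_distribution:
  assumes mr: "moment_rate 1" and N: "prob_space N" "is_gaussian_law N 0 (v *\<^sub>R S)"
  shows "converges_in_distribution M scaled_error N"
proof (rule levy_continuity_vector[OF prob_space_axioms N(1)])
  show sN: "sets N = sets borel" using N(2) by (simp add: is_gaussian_law_def)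
  show "scaled_error k \<in> borel_measurable M" for k by measurable
  note rem = remainder_in_probability[OF mr]
  have im: "integrable M (\<lambda>\<omega>. min 1 (remainder k \<omega>))" for k
    by (rule integrable_const_bound[of _ 1]) (auto simp: remainder_nonneg)
  obtain D where D: "D \<ge> 0" "\<And>k. integrable M (\<lambda>\<omega>. (norm (score k \<omega>))\<^sup>2)"
    "\<And>k. expectation (\<lambda>\<omega>. (norm (score k \<omega>))\<^sup>2) \<le> D * real k"
    using score_mean by blast
  show "\<exists>K. \<forall>\<^sub>F k in sequentially. prob {\<omega> \<in> space M. K < norm (scaled_error k \<omega>)} \<le> \<epsilon>" if \<epsilon>: "\<epsilon> > 0" for \<epsilon>
  proof -
    define b where "b = (norm S)\<^sup>2 * D"
    have b: "b \<ge> 0" using D by (simp add: b_def)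
    \<comment> \<open>leaves room for a remainder of size \<open>1\<close> and for Markov's inequality to give \<open>\<epsilon> / 2\<close>\<close>
    define K where "K = 2 + 2 * b / \<epsilon>"
    have K: "K \<ge> 2" using b \<epsilon> by (simp add: K_def)
    have "\<forall>\<^sub>F k in sequentially. expectation (\<lambda>\<omega>. min 1 (remainder k \<omega>)) < \<epsilon> / 2"
      using order_tendstoD(2)[OF rem, of "\<epsilon> / 2"] \<epsilon> by simp
    then have "\<forall>\<^sub>F k in sequentially. prob {\<omega> \<in> space M. K < norm (scaled_error k \<omega>)} \<le> \<epsilon>"
      using eventually_ge_at_top[of 1]
    proof eventually_elim
      case (elim k)
      let ?A = "{\<omega> \<in> space M. K < norm (scaled_error k \<omega>)}"
      let ?f = "\<lambda>\<omega>. ((norm S)\<^sup>2 / (real k * (K - 1))) * (norm (score k \<omega>))\<^sup>2 + min 1 (remainder k \<omega>)"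
      have A: "?A \<in> sets M" by measurable
      have pw: "indicator ?A \<omega> \<le> ?f \<omega>" for \<omega>
      proof (cases "\<omega> \<in> ?A \<and> remainder k \<omega> < 1")
        case True
        have "norm (scaled_error k \<omega>) \<le> norm (linear_part k \<omega>) + remainder k \<omega>"
          unfolding remainder_def by (metis norm_triangle_sub add.commute)
        then have lp: "K - 1 \<le> norm (linear_part k \<omega>)" using True by simp
        have "1 * (K - 1) \<le> (K - 1) * (K - 1)" using K by (intro mult_right_mono) auto
        also have "\<dots> \<le> norm (linear_part k \<omega>) * norm (linear_part k \<omega>)" using lp K by (intro mult_mono) auto
        also have "\<dots> = (norm (S *v score k \<omega>))\<^sup>2 / real k"
          by (simp add: linear_part_def power2_eq_square)
        also have "\<dots> \<le> (norm S * norm (score k \<omega>))\<^sup>2 / real k"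
          by (intro divide_right_mono power_mono norm_matrix_vector_le) auto
        finally have "K - 1 \<le> (norm S)\<^sup>2 * (norm (score k \<omega>))\<^sup>2 / real k" by (simp add: power_mult_distrib)
        then have "1 \<le> ((norm S)\<^sup>2 * (norm (score k \<omega>))\<^sup>2 / real k) / (K - 1)"
          using K by (subst le_divide_eq_1_pos) auto
        moreover have "((norm S)\<^sup>2 * (norm (score k \<omega>))\<^sup>2 / real k) / (K - 1) = ((norm S)\<^sup>2 / (real k * (K - 1))) * (norm (score k \<omega>))\<^sup>2"
          by simp
        moreover have "0 \<le> min 1 (remainder k \<omega>)" by (simp add: remainder_nonneg)
        ultimately show ?thesis using True by simp
      next
        case False
        have "0 \<le> ((norm S)\<^sup>2 / (real k * (K - 1))) * (norm (score k \<omega>))\<^sup>2" using K by simp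
        then show ?thesis using False remainder_nonneg[of k \<omega>] by (auto simp: indicator_def)
      qed
      have "prob ?A = expectation (indicator ?A)" using A by simp
      also have "\<dots> \<le> expectation ?f"
        using A D(2)[of k] im[of k] by (intro integral_mono pw) (auto simp: emeasure_eq_measure)
      also have "\<dots> = ((norm S)\<^sup>2 / (real k * (K - 1))) * expectation (\<lambda>\<omega>. (norm (score k \<omega>))\<^sup>2) + expectation (\<lambda>\<omega>. min 1 (remainder k \<omega>))"
        using D(2)[of k] im[of k] by simp
      also have "\<dots> \<le> ((norm S)\<^sup>2 / (real k * (K - 1))) * (D * real k) + \<epsilon> / 2"
        using D(3)[of k] K elim by (intro add_mono mult_left_mono) auto
      also have "((norm S)\<^sup>2 / (real k * (K - 1))) * (D * real k) = b / (K - 1)"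
        using elim K by (simp add: b_def)
      also have "b / (K - 1) + \<epsilon> / 2 \<le> \<epsilon>"
      proof -
        have "2 * b = (K - 2) * \<epsilon>" using \<epsilon> by (simp add: K_def)
        also have "\<dots> \<le> (K - 1) * \<epsilon>" using \<epsilon> by (intro mult_right_mono) auto
        finally have "b / (K - 1) \<le> \<epsilon> / 2" using K by (simp add: field_simps)
        then show ?thesis by linarith
      qed
      finally show ?case .
    qed
    then show ?thesis by blast
  qed
  show "(\<lambda>k. CLINT \<omega>|M. iexp (u \<bullet> scaled_error k \<omega>)) \<longlonglongrightarrow> (CLINT y|N. iexp (u \<bullet> y))" for u
  proof -
    have idN: "(\<lambda>y. u \<bullet> y) \<in> borel_measurable N" using sN by (simp cong: measurable_cong_sets)
    have "(CLINT y|N. iexp (u \<bullet> y)) = char (distr N borel (\<lambda>y. u \<bullet> y)) 1"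
      unfolding char_def by (subst integral_distr[OF idN]) auto
    also have "\<dots> = char (gaussian_law 0 (u \<bullet> ((v *\<^sub>R S) *v u))) 1"
      using N(2) by (simp add: is_gaussian_law_def)
    also have "\<dots> = complex_of_real (exp (- (v * (u \<bullet> (S *v u))) / 2))"
      using v S_psd[of u] by (subst char_gaussian_law) (auto simp: scaleR_matrix_vector)
    finally have lim: "(\<lambda>k. CLINT \<omega>|M. iexp (u \<bullet> linear_part k \<omega>)) \<longlonglongrightarrow> (CLINT y|N. iexp (u \<bullet> y))"
      using linear_part_char[OF mr, of u] by simp
    have i: "complex_integrable M (\<lambda>\<omega>. iexp (u \<bullet> scaled_error k \<omega>))" "complex_integrable M (\<lambda>\<omega>. iexp (u \<bullet> linear_part k \<omega>))" for k
      by (rule integrable_const_bound[of _ 1]; simp)+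
    have pw: "cmod (iexp (u \<bullet> scaled_error k \<omega>) - iexp (u \<bullet> linear_part k \<omega>)) \<le> (2 + norm u) * min 1 (remainder k \<omega>)" for k \<omega>
    proof (cases "remainder k \<omega> \<le> 1")
      case True
      have "cmod (iexp (u \<bullet> scaled_error k \<omega>) - iexp (u \<bullet> linear_part k \<omega>)) \<le> \<bar>u \<bullet> scaled_error k \<omega> - u \<bullet> linear_part k \<omega>\<bar>"
        by (rule iexp_diff_le)
      also have "\<dots> \<le> norm u * remainder k \<omega>"
        unfolding remainder_def inner_diff_right[symmetric] by (rule Cauchy_Schwarz_ineq2)
      also have "\<dots> \<le> (2 + norm u) * remainder k \<omega>" by (intro mult_right_mono remainder_nonneg) simp
      finally show ?thesis using True by (simp add: min_absorb2)
    next
      case False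
      have "cmod (iexp (u \<bullet> scaled_error k \<omega>) - iexp (u \<bullet> linear_part k \<omega>)) \<le> 1 + 1"
        by (rule order_trans[OF norm_triangle_ineq4]) simp
      then have "cmod (iexp (u \<bullet> scaled_error k \<omega>) - iexp (u \<bullet> linear_part k \<omega>)) \<le> 2 + norm u"
        using norm_ge_zero[of u] by linarith
      then show ?thesis using False by (simp add: min_absorb1)
    qed
    have "(\<lambda>k. (CLINT \<omega>|M. iexp (u \<bullet> scaled_error k \<omega>)) - (CLINT \<omega>|M. iexp (u \<bullet> linear_part k \<omega>))) \<longlonglongrightarrow> 0"
    proof (rule Lim_null_comparison)
      show "\<forall>\<^sub>F k in sequentially. cmod ((CLINT \<omega>|M. iexp (u \<bullet> scaled_error k \<omega>)) - (CLINT \<omega>|M. iexp (u \<bullet> linear_part k \<omega>)))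
         \<le> (2 + norm u) * expectation (\<lambda>\<omega>. min 1 (remainder k \<omega>))"
      proof (rule always_eventually, rule allI)
        fix k
        have "cmod ((CLINT \<omega>|M. iexp (u \<bullet> scaled_error k \<omega>)) - (CLINT \<omega>|M. iexp (u \<bullet> linear_part k \<omega>))) =
           cmod (CLINT \<omega>|M. iexp (u \<bullet> scaled_error k \<omega>) - iexp (u \<bullet> linear_part k \<omega>))"
          using i[of k] by simp
        also have "\<dots> \<le> expectation (\<lambda>\<omega>. cmod (iexp (u \<bullet> scaled_error k \<omega>) - iexp (u \<bullet> linear_part k \<omega>)))"
          by (rule integral_norm_bound)
        also have "\<dots> \<le> expectation (\<lambda>\<omega>. (2 + norm u) * min 1 (remainder k \<omega>))"
          using i[of k] im[of k] by (intro integral_mono pw integrable_norm) auto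
        finally show "cmod ((CLINT \<omega>|M. iexp (u \<bullet> scaled_error k \<omega>)) - (CLINT \<omega>|M. iexp (u \<bullet> linear_part k \<omega>)))
         \<le> (2 + norm u) * expectation (\<lambda>\<omega>. min 1 (remainder k \<omega>))" by simp
      qed
      show "(\<lambda>k. (2 + norm u) * expectation (\<lambda>\<omega>. min 1 (remainder k \<omega>))) \<longlonglongrightarrow> 0"
        by (rule tendsto_mult_right_zero[OF rem])
    qed
    from tendsto_add[OF this lim] show ?thesis by simp
  qed
qed


section \<open>Convergence of the error covariance\<close>

text \<open>
  The last summand takes care of the points where the information matrix is far from its limit: there the
  square of the crude bound is multiplied by \<open>(4 |S| \<cdot> deviation)\<^sup>5 \<ge> 1\<close>.
\<close>

lemma remainder_sq_le:
  assumes k: "k \<ge> 1" and bs: "bias k * norm S \<le> 1 / 4" and \<omega>: "\<omega> \<in> space M"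
  shows "(remainder k \<omega>)\<^sup>2 \<le>
     16 * norm S ^ 4 / real k * ((deviation k \<omega>)\<^sup>2 * (norm (score k \<omega>))\<^sup>2)
   + 16 * norm S ^ 4 / real k * (bias k)\<^sup>2 * (norm (score k \<omega>))\<^sup>2
   + 8 * (norm S)\<^sup>2 * (norm g)\<^sup>2 / real k
   + 2 * (4 * norm S) ^ 5 * (pc + norm S)\<^sup>2 * real k * ((norm g)\<^sup>2 * deviation k \<omega> ^ 5 + deviation k \<omega> ^ 5 * (norm (score k \<omega>))\<^sup>2)"
    (is "_ \<le> ?t1 + ?t2 + ?t3 + ?t4")
proof -
  let ?s = "norm S" and ?d = "deviation k \<omega>" and ?w = "norm (score k \<omega>)" and ?r = "sqrt (real k)"
  have r: "?r > 0" "?r\<^sup>2 = real k" using k by auto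
  have d: "0 \<le> ?d" by (rule deviation_nonneg)
  have sq: "(p + q)\<^sup>2 \<le> 2 * p\<^sup>2 + 2 * q\<^sup>2" for p q :: real
    using sum_squares_bound[of p q] by (simp add: power2_sum)
  have nn: "0 \<le> ?t1" "0 \<le> ?t2" "0 \<le> ?t3" "0 \<le> ?t4" using d by auto
  show ?thesis
  proof (cases "(?d + bias k) * ?s \<le> 1 / 2")
    case True
    have "(remainder k \<omega>)\<^sup>2 \<le> (2 * ?s\<^sup>2 * (?d + bias k) * (?w / ?r) + 2 * ?s * norm g / ?r)\<^sup>2"
      using remainder_good[OF k \<omega> True] by (intro power_mono remainder_nonneg)
    also have "\<dots> \<le> 2 * (2 * ?s\<^sup>2 * (?d + bias k) * (?w / ?r))\<^sup>2 + 2 * (2 * ?s * norm g / ?r)\<^sup>2" by (rule sq)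
    also have "(2 * ?s\<^sup>2 * (?d + bias k) * (?w / ?r))\<^sup>2 = (4 * ?s ^ 4 * ?w\<^sup>2 / real k) * (?d + bias k)\<^sup>2"
      using r by (simp add: power_mult_distrib power_divide power_mult[symmetric])
    also have "2 * (2 * ?s * norm g / ?r)\<^sup>2 = ?t3" using r by (simp add: power_mult_distrib power_divide)
    finally have a: "(remainder k \<omega>)\<^sup>2 \<le> 2 * ((4 * ?s ^ 4 * ?w\<^sup>2 / real k) * (?d + bias k)\<^sup>2) + ?t3" .
    have "(4 * ?s ^ 4 * ?w\<^sup>2 / real k) * (?d + bias k)\<^sup>2 \<le> (4 * ?s ^ 4 * ?w\<^sup>2 / real k) * (2 * ?d\<^sup>2 + 2 * (bias k)\<^sup>2)"
      by (intro mult_left_mono sq) auto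
    also have "2 * \<dots> = ?t1 + ?t2" by (simp add: field_simps add_divide_distrib)
    finally have "2 * ((4 * ?s ^ 4 * ?w\<^sup>2 / real k) * (?d + bias k)\<^sup>2) \<le> ?t1 + ?t2" by simp
    then show ?thesis using a nn by linarith
  next
    case False
    then have "1 \<le> 4 * ?s * ?d" using large_deviation bs by blast
    then have one: "1 \<le> (4 * ?s * ?d) ^ 5" by (rule one_le_power)
    have "(remainder k \<omega>)\<^sup>2 \<le> (?r * ((pc + ?s) * (norm g + ?w)))\<^sup>2"
      using remainder_crude[OF k \<omega>] by (intro power_mono remainder_nonneg)
    also have "\<dots> = real k * (pc + ?s)\<^sup>2 * (norm g + ?w)\<^sup>2" using r by (simp add: power_mult_distrib)
    also have "\<dots> \<le> real k * (pc + ?s)\<^sup>2 * (2 * (norm g)\<^sup>2 + 2 * ?w\<^sup>2)" by (intro mult_left_mono sq) auto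
    also have "\<dots> \<le> (real k * (pc + ?s)\<^sup>2 * (2 * (norm g)\<^sup>2 + 2 * ?w\<^sup>2)) * (4 * ?s * ?d) ^ 5"
    proof -
      have "0 \<le> real k * (pc + ?s)\<^sup>2 * (2 * (norm g)\<^sup>2 + 2 * ?w\<^sup>2)" by simp
      from mult_left_mono[OF one this] show ?thesis by simp
    qed
    also have "\<dots> = ?t4" by (simp add: power_mult_distrib algebra_simps)
    finally show ?thesis using nn by linarith
  qed
qed

text \<open>
  The deviation has a tenth moment of order \<open>k\<^bsup>-5\<^esup>\<close> and the score a fourth moment of order \<open>k\<^sup>2\<close>. By the
  Cauchy-Schwarz inequality the last summand of the pointwise bound is then of order \<open>k \<cdot> k\<^bsup>-5/2\<^esup> \<cdot> k\<close>.
\<close>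

lemma remainder_mean_square:
  assumes mr: "moment_rate 2" "moment_rate 5"
  shows "\<forall>\<^sub>F k in sequentially. integrable M (\<lambda>\<omega>. (remainder k \<omega>)\<^sup>2)"
    "(\<lambda>k. expectation (\<lambda>\<omega>. (remainder k \<omega>)\<^sup>2)) \<longlonglongrightarrow> 0"
proof -
  obtain C2 where C2: "C2 \<ge> 0" "\<And>k. k \<ge> 1 \<Longrightarrow> integrable M (\<lambda>\<omega>. deviation k \<omega> ^ (2 * 2))"
    "\<And>k. k \<ge> 1 \<Longrightarrow> expectation (\<lambda>\<omega>. deviation k \<omega> ^ (2 * 2)) \<le> C2 / real k ^ 2"
    using deviation_moment[OF _ mr(1)] by (metis one_le_numeral)
  obtain C5 where C5: "C5 \<ge> 0" "\<And>k. k \<ge> 1 \<Longrightarrow> integrable M (\<lambda>\<omega>. deviation k \<omega> ^ (2 * 5))"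
    "\<And>k. k \<ge> 1 \<Longrightarrow> expectation (\<lambda>\<omega>. deviation k \<omega> ^ (2 * 5)) \<le> C5 / real k ^ 5"
    using deviation_moment[OF _ mr(2)] by (metis one_le_numeral)
  obtain D where D: "D \<ge> 0" "\<And>k. integrable M (\<lambda>\<omega>. (norm (score k \<omega>))\<^sup>2)"
    "\<And>k. expectation (\<lambda>\<omega>. (norm (score k \<omega>))\<^sup>2) \<le> D * real k"
    using score_mean by blast
  obtain D4 where D4: "D4 \<ge> 0" "\<And>k. integrable M (\<lambda>\<omega>. norm (score k \<omega>) ^ (2 * 2))"
    "\<And>k. expectation (\<lambda>\<omega>. norm (score k \<omega>) ^ (2 * 2)) \<le> D4 * real k ^ 2"
    using score_moment[of 2] by blast
  define a1 where "a1 = 16 * norm S ^ 4"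
  define a3 where "a3 = 8 * (norm S)\<^sup>2 * (norm g)\<^sup>2"
  define a4 where "a4 = 2 * (4 * norm S) ^ 5 * (pc + norm S)\<^sup>2"
  have a: "a1 \<ge> 0" "a3 \<ge> 0" "a4 \<ge> 0" by (simp_all add: a1_def a3_def a4_def)
  let ?w = "\<lambda>k \<omega>. (norm (score k \<omega>))\<^sup>2"
  let ?ub = "\<lambda>k. a1 * (sqrt C2 * sqrt D4) * (1 / real k) + a1 * D * (bias k)\<^sup>2 + a3 * (1 / real k)
     + a4 * (norm g)\<^sup>2 * sqrt C5 * (real k * sqrt (1 / real k ^ 5)) + a4 * (sqrt C5 * sqrt D4) * (real k * (sqrt (1 / real k ^ 5) * real k))"
  have main: "integrable M (\<lambda>\<omega>. (remainder k \<omega>)\<^sup>2) \<and> expectation (\<lambda>\<omega>. (remainder k \<omega>)\<^sup>2) \<le> ?ub k"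
    if k: "k \<ge> 1" and bs: "bias k * norm S \<le> 1 / 4" for k
  proof -
    have k0: "real k > 0" using k by simp
    have sqs: "integrable M (\<lambda>\<omega>. ((deviation k \<omega>)\<^sup>2)\<^sup>2)" "integrable M (\<lambda>\<omega>. (?w k \<omega>)\<^sup>2)" "integrable M (\<lambda>\<omega>. (deviation k \<omega> ^ 5)\<^sup>2)"
      "expectation (\<lambda>\<omega>. ((deviation k \<omega>)\<^sup>2)\<^sup>2) \<le> C2 / real k ^ 2" "expectation (\<lambda>\<omega>. (?w k \<omega>)\<^sup>2) \<le> D4 * real k ^ 2"
      "expectation (\<lambda>\<omega>. (deviation k \<omega> ^ 5)\<^sup>2) \<le> C5 / real k ^ 5"
      using C2(2,3)[OF k] C5(2,3)[OF k] D4(2,3)[of k] by (simp_all add: power_mult[symmetric])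
    have meas: "(\<lambda>\<omega>. (deviation k \<omega>)\<^sup>2) \<in> borel_measurable M" "?w k \<in> borel_measurable M" "(\<lambda>\<omega>. deviation k \<omega> ^ 5) \<in> borel_measurable M"
      by measurable
    have one: "(\<lambda>_. 1) \<in> borel_measurable M" "integrable M (\<lambda>_. (1::real)\<^sup>2)" "expectation (\<lambda>_. (1::real)\<^sup>2) \<le> 1"
      by (auto simp: prob_space)
    have i: "integrable M (\<lambda>\<omega>. (deviation k \<omega>)\<^sup>2 * ?w k \<omega>)" "integrable M (\<lambda>\<omega>. deviation k \<omega> ^ 5 * ?w k \<omega>)" "integrable M (\<lambda>\<omega>. deviation k \<omega> ^ 5)"
      using integrable_mult_of_squares[OF meas(1,2) sqs(1,2)] integrable_mult_of_squares[OF meas(3,2) sqs(3,2)]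
        integrable_mult_of_squares[OF meas(3) one(1) sqs(3) one(2)] by simp_all
    have e1: "expectation (\<lambda>\<omega>. (deviation k \<omega>)\<^sup>2 * ?w k \<omega>) \<le> sqrt C2 * sqrt D4"
    proof -
      have "\<bar>expectation (\<lambda>\<omega>. (deviation k \<omega>)\<^sup>2 * ?w k \<omega>)\<bar> \<le> sqrt (C2 / real k ^ 2) * sqrt (D4 * real k ^ 2)"
        by (rule expectation_cauchy_schwarz[OF meas(1,2) sqs(1,2,4,5)])
      also have "\<dots> = sqrt C2 * sqrt D4" using k0 by (simp add: real_sqrt_mult real_sqrt_divide)
      finally show ?thesis by linarith
    qed
    have e2: "expectation (\<lambda>\<omega>. deviation k \<omega> ^ 5 * ?w k \<omega>) \<le> (sqrt C5 * sqrt D4) * (sqrt (1 / real k ^ 5) * real k)"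
    proof -
      have "\<bar>expectation (\<lambda>\<omega>. deviation k \<omega> ^ 5 * ?w k \<omega>)\<bar> \<le> sqrt (C5 / real k ^ 5) * sqrt (D4 * real k ^ 2)"
        by (rule expectation_cauchy_schwarz[OF meas(3,2) sqs(3,2,6,5)])
      also have "\<dots> = (sqrt C5 * sqrt D4) * (sqrt (1 / real k ^ 5) * real k)"
        using k0 by (simp add: real_sqrt_mult real_sqrt_divide)
      finally show ?thesis by linarith
    qed
    have e3: "expectation (\<lambda>\<omega>. deviation k \<omega> ^ 5) \<le> sqrt C5 * sqrt (1 / real k ^ 5)"
    proof -
      have "\<bar>expectation (\<lambda>\<omega>. deviation k \<omega> ^ 5 * 1)\<bar> \<le> sqrt (C5 / real k ^ 5) * sqrt 1"
        by (rule expectation_cauchy_schwarz[OF meas(3) one(1) sqs(3) one(2) sqs(6) one(3)])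
      also have "\<dots> = sqrt C5 * sqrt (1 / real k ^ 5)" by (simp add: real_sqrt_divide)
      finally show ?thesis by simp
    qed
    let ?rhs = "\<lambda>\<omega>. a1 / real k * ((deviation k \<omega>)\<^sup>2 * ?w k \<omega>) + a1 / real k * (bias k)\<^sup>2 * ?w k \<omega> + a3 / real k
       + a4 * real k * ((norm g)\<^sup>2 * deviation k \<omega> ^ 5 + deviation k \<omega> ^ 5 * ?w k \<omega>)"
    have pw: "(remainder k \<omega>)\<^sup>2 \<le> ?rhs \<omega>" if "\<omega> \<in> space M" for \<omega>
      using remainder_sq_le[OF k bs that] by (simp add: a1_def a3_def a4_def)
    have ir: "integrable M ?rhs" using i D(2)[of k] by auto
    have int: "integrable M (\<lambda>\<omega>. (remainder k \<omega>)\<^sup>2)"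
    proof (rule Bochner_Integration.integrable_bound[OF ir])
      show "AE \<omega> in M. norm ((remainder k \<omega>)\<^sup>2) \<le> norm (?rhs \<omega>)"
      proof (rule AE_I2)
        fix \<omega> assume "\<omega> \<in> space M"
        moreover have "0 \<le> (remainder k \<omega>)\<^sup>2" by simp
        ultimately show "norm ((remainder k \<omega>)\<^sup>2) \<le> norm (?rhs \<omega>)" using pw[of \<omega>] unfolding real_norm_def by linarith
      qed
    qed measurable
    have "expectation (\<lambda>\<omega>. (remainder k \<omega>)\<^sup>2) \<le> expectation ?rhs"
      by (rule integral_mono_AE[OF int ir]) (use pw in auto)
    also have "\<dots> = a1 / real k * expectation (\<lambda>\<omega>. (deviation k \<omega>)\<^sup>2 * ?w k \<omega>) + a1 / real k * (bias k)\<^sup>2 * expectation (?w k) + a3 / real k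
       + a4 * real k * ((norm g)\<^sup>2 * expectation (\<lambda>\<omega>. deviation k \<omega> ^ 5) + expectation (\<lambda>\<omega>. deviation k \<omega> ^ 5 * ?w k \<omega>))"
      using i D(2)[of k] by (simp add: prob_space)
    also have "\<dots> \<le> a1 / real k * (sqrt C2 * sqrt D4) + a1 / real k * (bias k)\<^sup>2 * (D * real k) + a3 / real k
       + a4 * real k * ((norm g)\<^sup>2 * (sqrt C5 * sqrt (1 / real k ^ 5)) + (sqrt C5 * sqrt D4) * (sqrt (1 / real k ^ 5) * real k))"
      using a k0 e1 e2 e3 D(3)[of k] by (intro add_mono mult_left_mono order_refl) auto
    also have "\<dots> = ?ub k" using k0 by (simp add: field_simps)
    finally show ?thesis using int by blast
  qed
  have ev: "\<forall>\<^sub>F k in sequentially. integrable M (\<lambda>\<omega>. (remainder k \<omega>)\<^sup>2) \<and> expectation (\<lambda>\<omega>. (remainder k \<omega>)\<^sup>2) \<le> ?ub k"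
    using eventually_bias_small by eventually_elim (use main in blast)
  then show "\<forall>\<^sub>F k in sequentially. integrable M (\<lambda>\<omega>. (remainder k \<omega>)\<^sup>2)" by eventually_elim auto
  show "(\<lambda>k. expectation (\<lambda>\<omega>. (remainder k \<omega>)\<^sup>2)) \<longlonglongrightarrow> 0"
  proof (rule Lim_null_comparison)
    show "\<forall>\<^sub>F k in sequentially. norm (expectation (\<lambda>\<omega>. (remainder k \<omega>)\<^sup>2)) \<le> ?ub k"
      using ev by eventually_elim simp
    have l1: "(\<lambda>k. 1 / real k) \<longlonglongrightarrow> 0" by (rule lim_1_over_n)
    have l2: "(\<lambda>k. real k * sqrt (1 / real k ^ 5)) \<longlonglongrightarrow> 0" by real_asymp
    have l3: "(\<lambda>k. real k * (sqrt (1 / real k ^ 5) * real k)) \<longlonglongrightarrow> 0" by real_asymp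
    have "?ub \<longlonglongrightarrow> a1 * (sqrt C2 * sqrt D4) * 0 + a1 * D * 0\<^sup>2 + a3 * 0 + a4 * (norm g)\<^sup>2 * sqrt C5 * 0 + a4 * (sqrt C5 * sqrt D4) * 0"
      by (intro tendsto_intros l1 l2 l3 bias_tendsto)
    then show "?ub \<longlonglongrightarrow> 0" by simp
  qed
qed

lemma score_covariance:
  "integrable M (\<lambda>\<omega>. score k \<omega> $ i * score k \<omega> $ j)"
  "expectation (\<lambda>\<omega>. score k \<omega> $ i * score k \<omega> $ j) = v * mean_info k $ i $ j"
proof -
  have x2: "integrable M (\<lambda>\<omega>. (x s \<omega> $ i)\<^sup>2)" for s i using x_lower_moments(1)[of 1 s i] by simp
  note tc = transform_covariance[where a = "\<lambda>s \<omega>. x s \<omega> $ i" and b = "\<lambda>s \<omega>. x s \<omega> $ j" and k = k for i j,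
      OF x_nth_adapted x2 x_nth_adapted x2 X_moments(1) X_mean X_var]
  have sq: "integrable M (\<lambda>\<omega>. (score k \<omega> $ i)\<^sup>2)" for i unfolding score_nth by (rule tc(1))
  show "integrable M (\<lambda>\<omega>. score k \<omega> $ i * score k \<omega> $ j)"
    by (rule integrable_mult_of_squares[OF _ _ sq sq]) measurable
  show "expectation (\<lambda>\<omega>. score k \<omega> $ i * score k \<omega> $ j) = v * mean_info k $ i $ j"
    unfolding score_nth tc(2) by (simp add: mean_info_def)
qed

text \<open>
  The score has covariance \<open>v\<close> times the mean information matrix, and \<open>S R S = S\<close>.
\<close>

lemma linear_part_covariance:
  "integrable M (\<lambda>\<omega>. linear_part k \<omega> $ i * linear_part k \<omega> $ j)"
  "(\<lambda>k. expectation (\<lambda>\<omega>. linear_part k \<omega> $ i * linear_part k \<omega> $ j)) \<longlonglongrightarrow> v * S $ i $ j"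
proof -
  have eq: "linear_part k \<omega> $ i * linear_part k \<omega> $ j =
     (\<Sum>a\<in>UNIV. \<Sum>b\<in>UNIV. (S $ i $ a * S $ j $ b / real k) * (score k \<omega> $ a * score k \<omega> $ b))" for k \<omega>
  proof -
    have "linear_part k \<omega> $ i * linear_part k \<omega> $ j = (S *v score k \<omega>) $ i * (S *v score k \<omega>) $ j / real k"
      by (simp add: linear_part_def)
    also have "\<dots> = (\<Sum>a\<in>UNIV. \<Sum>b\<in>UNIV. (S $ i $ a * score k \<omega> $ a) * (S $ j $ b * score k \<omega> $ b)) / real k"
      by (simp add: matrix_vector_mult_def sum_product)
    also have "\<dots> = (\<Sum>a\<in>UNIV. \<Sum>b\<in>UNIV. (S $ i $ a * S $ j $ b / real k) * (score k \<omega> $ a * score k \<omega> $ b))"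
      by (simp add: sum_divide_distrib mult_ac)
    finally show ?thesis .
  qed
  show "integrable M (\<lambda>\<omega>. linear_part k \<omega> $ i * linear_part k \<omega> $ j)"
    unfolding eq by (intro Bochner_Integration.integrable_sum integrable_mult_right score_covariance)
  have e: "expectation (\<lambda>\<omega>. linear_part k \<omega> $ i * linear_part k \<omega> $ j) =
     (\<Sum>a\<in>UNIV. \<Sum>b\<in>UNIV. S $ i $ a * S $ j $ b * (v * ((1 / real k) *\<^sub>R mean_info k) $ a $ b))" for k
    unfolding eq
    by (subst Bochner_Integration.integral_sum, (intro Bochner_Integration.integrable_sum integrable_mult_right score_covariance),
        intro sum.cong refl, subst Bochner_Integration.integral_sum, (intro integrable_mult_right score_covariance),
        intro sum.cong refl, simp add: score_covariance(2))
  have "(\<lambda>k. \<Sum>a\<in>UNIV. \<Sum>b\<in>UNIV. S $ i $ a * S $ j $ b * (v * ((1 / real k) *\<^sub>R mean_info k) $ a $ b)) \<longlonglongrightarrow>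
     (\<Sum>a\<in>UNIV. \<Sum>b\<in>UNIV. S $ i $ a * S $ j $ b * (v * R $ a $ b))"
    by (intro tendsto_intros mean[folded mean_info_def])
  moreover have "(\<Sum>a\<in>UNIV. \<Sum>b\<in>UNIV. S $ i $ a * S $ j $ b * (v * R $ a $ b)) = v * S $ i $ j"
  proof -
    have SR: "S ** R = mat 1" using RS matrix_left_right_inverse by blast
    have sym: "S $ a $ b = S $ b $ a" for a b using S_sym by (metis transpose_def vec_lambda_beta)
    have "(\<Sum>a\<in>UNIV. \<Sum>b\<in>UNIV. S $ i $ a * S $ j $ b * (v * R $ a $ b)) =
       v * (\<Sum>b\<in>UNIV. (\<Sum>a\<in>UNIV. S $ i $ a * R $ a $ b) * S $ b $ j)"
      by (subst sum.swap) (simp add: sum_distrib_left sum_distrib_right sym[of j] mult_ac)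
    also have "(\<Sum>b\<in>UNIV. (\<Sum>a\<in>UNIV. S $ i $ a * R $ a $ b) * S $ b $ j) = ((S ** R) ** S) $ i $ j"
      by (simp add: matrix_matrix_mult_def)
    finally show ?thesis by (simp add: SR)
  qed
  ultimately show "(\<lambda>k. expectation (\<lambda>\<omega>. linear_part k \<omega> $ i * linear_part k \<omega> $ j)) \<longlonglongrightarrow> v * S $ i $ j"
    unfolding e by simp
qed

lemma scaled_error_square_integrable:
  "integrable M (\<lambda>\<omega>. scaled_error k \<omega> $ i * scaled_error k \<omega> $ j)"
proof -
  have i: "integrable M (\<lambda>\<omega>. real k * pc\<^sup>2 * (2 * (norm g)\<^sup>2 + 2 * (norm (score k \<omega>))\<^sup>2))"
    using score_mean by auto
  have sq: "integrable M (\<lambda>\<omega>. (scaled_error k \<omega> $ i)\<^sup>2)" for i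
  proof (rule Bochner_Integration.integrable_bound[OF i])
    show "AE \<omega> in M. norm ((scaled_error k \<omega> $ i)\<^sup>2) \<le> norm (real k * pc\<^sup>2 * (2 * (norm g)\<^sup>2 + 2 * (norm (score k \<omega>))\<^sup>2))"
    proof (rule AE_I2)
      fix \<omega> assume \<omega>: "\<omega> \<in> space M"
      have "\<bar>scaled_error k \<omega> $ i\<bar> \<le> norm (scaled_error k \<omega>)" by (rule component_le_norm_cart)
      also have "\<dots> = sqrt (real k) * norm (Pm k \<omega> *v (g + score k \<omega>))" by (simp add: scaled_error_def)
      also have "\<dots> \<le> sqrt (real k) * (pc * (norm g + norm (score k \<omega>)))"
      proof (intro mult_left_mono)
        have "norm (Pm k \<omega> *v (g + score k \<omega>)) \<le> norm (Pm k \<omega>) * norm (g + score k \<omega>)" by (rule norm_matrix_vector_le)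
        also have "\<dots> \<le> pc * (norm g + norm (score k \<omega>))"
          using P_bound[OF \<omega>] by (intro mult_mono norm_triangle_ineq) (auto intro: order_trans[OF norm_ge_zero])
        finally show "norm (Pm k \<omega> *v (g + score k \<omega>)) \<le> pc * (norm g + norm (score k \<omega>))" .
      qed simp
      finally have "\<bar>scaled_error k \<omega> $ i\<bar>\<^sup>2 \<le> (sqrt (real k) * (pc * (norm g + norm (score k \<omega>))))\<^sup>2"
        by (intro power_mono) auto
      also have "\<dots> = real k * pc\<^sup>2 * (norm g + norm (score k \<omega>))\<^sup>2" by (simp add: power_mult_distrib)
      also have "\<dots> \<le> real k * pc\<^sup>2 * (2 * (norm g)\<^sup>2 + 2 * (norm (score k \<omega>))\<^sup>2)"
        using sum_squares_bound[of "norm g" "norm (score k \<omega>)"] by (intro mult_left_mono) (auto simp: power2_sum)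
      finally show "norm ((scaled_error k \<omega> $ i)\<^sup>2) \<le> norm (real k * pc\<^sup>2 * (2 * (norm g)\<^sup>2 + 2 * (norm (score k \<omega>))\<^sup>2))"
        by simp
    qed
  qed measurable
  show ?thesis by (rule integrable_mult_of_squares[OF _ _ sq sq]) measurable
qed

theorem scaled_error_covariance:
  assumes mr: "moment_rate 2" "moment_rate 5"
  shows "(\<lambda>k. expectation (\<lambda>\<omega>. scaled_error k \<omega> $ i * scaled_error k \<omega> $ j)) \<longlonglongrightarrow> v * S $ i $ j"
proof -
  let ?Y = "\<lambda>k \<omega> i. scaled_error k \<omega> $ i" and ?Z = "\<lambda>k \<omega> i. linear_part k \<omega> $ i"
  let ?E = "\<lambda>k. expectation (\<lambda>\<omega>. (remainder k \<omega>)\<^sup>2)" and ?V = "\<lambda>k i. expectation (\<lambda>\<omega>. ?Z k \<omega> i * ?Z k \<omega> i)"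
  have bnd: "\<forall>\<^sub>F k in sequentially. norm (expectation (\<lambda>\<omega>. ?Y k \<omega> i * ?Y k \<omega> j) - expectation (\<lambda>\<omega>. ?Z k \<omega> i * ?Z k \<omega> j)) \<le>
      sqrt (?E k) * sqrt (?E k) + sqrt (?E k) * sqrt (?V k j) + sqrt (?V k i) * sqrt (?E k)"
    using remainder_mean_square(1)[OF mr]
  proof eventually_elim
    case (elim k)
    let ?D = "\<lambda>i \<omega>. ?Y k \<omega> i - ?Z k \<omega> i"
    have dm: "?D i \<in> borel_measurable M" "(\<lambda>\<omega>. ?Z k \<omega> i) \<in> borel_measurable M" for i by measurable
    have le: "(?D i \<omega>)\<^sup>2 \<le> (remainder k \<omega>)\<^sup>2" for i \<omega>
    proof -
      have "\<bar>?D i \<omega>\<bar> \<le> remainder k \<omega>"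
        using component_le_norm_cart[of "scaled_error k \<omega> - linear_part k \<omega>" i] by (simp add: remainder_def)
      then show ?thesis by (metis abs_ge_zero power2_abs power_mono)
    qed
    have D2: "integrable M (\<lambda>\<omega>. (?D i \<omega>)\<^sup>2)" for i
      by (rule Bochner_Integration.integrable_bound[OF elim]) (use le in auto)
    have DE: "expectation (\<lambda>\<omega>. (?D i \<omega>)\<^sup>2) \<le> ?E k" for i by (rule integral_mono[OF D2 elim le])
    have Z2: "integrable M (\<lambda>\<omega>. (?Z k \<omega> i)\<^sup>2)" "expectation (\<lambda>\<omega>. (?Z k \<omega> i)\<^sup>2) \<le> ?V k i" for i
      using linear_part_covariance(1)[of k i i] by (simp_all add: power2_eq_square)
    have i: "integrable M (\<lambda>\<omega>. ?D i \<omega> * ?D j \<omega>)" "integrable M (\<lambda>\<omega>. ?D i \<omega> * ?Z k \<omega> j)" "integrable M (\<lambda>\<omega>. ?Z k \<omega> i * ?D j \<omega>)"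
      "integrable M (\<lambda>\<omega>. ?Z k \<omega> i * ?Z k \<omega> j)"
      by (intro integrable_mult_of_squares dm D2 Z2)+
    have "(\<lambda>\<omega>. ?Y k \<omega> i * ?Y k \<omega> j) = (\<lambda>\<omega>. ?Z k \<omega> i * ?Z k \<omega> j + ?D i \<omega> * ?D j \<omega> + ?D i \<omega> * ?Z k \<omega> j + ?Z k \<omega> i * ?D j \<omega>)"
      by (simp add: fun_eq_iff algebra_simps)
    then have "expectation (\<lambda>\<omega>. ?Y k \<omega> i * ?Y k \<omega> j) = expectation (\<lambda>\<omega>. ?Z k \<omega> i * ?Z k \<omega> j) + expectation (\<lambda>\<omega>. ?D i \<omega> * ?D j \<omega>)
       + expectation (\<lambda>\<omega>. ?D i \<omega> * ?Z k \<omega> j) + expectation (\<lambda>\<omega>. ?Z k \<omega> i * ?D j \<omega>)"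
      using i by (simp del: right_diff_distrib left_diff_distrib)
    moreover have "\<bar>expectation (\<lambda>\<omega>. ?D i \<omega> * ?D j \<omega>)\<bar> \<le> sqrt (?E k) * sqrt (?E k)"
      by (rule expectation_cauchy_schwarz[OF dm(1) dm(1) D2 D2 DE DE])
    moreover have "\<bar>expectation (\<lambda>\<omega>. ?D i \<omega> * ?Z k \<omega> j)\<bar> \<le> sqrt (?E k) * sqrt (?V k j)"
      by (rule expectation_cauchy_schwarz[OF dm(1) dm(2) D2 Z2(1) DE Z2(2)])
    moreover have "\<bar>expectation (\<lambda>\<omega>. ?Z k \<omega> i * ?D j \<omega>)\<bar> \<le> sqrt (?V k i) * sqrt (?E k)"
      by (rule expectation_cauchy_schwarz[OF dm(2) dm(1) Z2(1) D2 Z2(2) DE])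
    ultimately show ?case unfolding real_norm_def by linarith
  qed
  have E0: "?E \<longlonglongrightarrow> 0" by (rule remainder_mean_square(2)[OF mr])
  have V: "(\<lambda>k. ?V k i) \<longlonglongrightarrow> v * S $ i $ i" for i by (rule linear_part_covariance(2))
  have "(\<lambda>k. sqrt (?E k) * sqrt (?E k) + sqrt (?E k) * sqrt (?V k j) + sqrt (?V k i) * sqrt (?E k)) \<longlonglongrightarrow>
     sqrt 0 * sqrt 0 + sqrt 0 * sqrt (v * S $ j $ j) + sqrt (v * S $ i $ i) * sqrt 0"
    by (intro tendsto_intros E0 V)
  then have "(\<lambda>k. expectation (\<lambda>\<omega>. ?Y k \<omega> i * ?Y k \<omega> j) - expectation (\<lambda>\<omega>. ?Z k \<omega> i * ?Z k \<omega> j)) \<longlonglongrightarrow> 0"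
    by (intro Lim_null_comparison[OF bnd]) simp
  from tendsto_add[OF this linear_part_covariance(2)[of i j]] show ?thesis by simp
qed

end


section \<open>Innovations and filters of the ARX data\<close>

lemma (in prob_space) innovations_of_indep_vars:
  fixes e :: "int \<Rightarrow> 'a \<Rightarrow> real"
  assumes ind: "indep_vars (\<lambda>_. borel) e {0..}"
  shows "innovations M (\<lambda>k. sigma (space M) (\<Union>t<k. {e (int t) -` S \<inter> space M |S. S \<in> sets borel})) (\<lambda>k. e (int k))"
proof
  define E where "E = (\<lambda>i. {e i -` S \<inter> space M |S. S \<in> sets borel})"
  let ?G = "\<lambda>k. \<Union>t<k. {e (int t) -` S \<inter> space M |S. S \<in> sets borel}"
  have em: "e (int k) \<in> borel_measurable M" for k using ind by (auto simp: indep_vars_def)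
  have GP: "?G k \<subseteq> Pow (space M)" for k by auto
  have GM: "?G k \<subseteq> sets M" for k using em by (auto intro: measurable_sets)
  have sets: "sets (sigma (space M) (?G k)) = sigma_sets (space M) (?G k)" for k using GP by (rule sets_measure_of)
  fix k
  show "space (sigma (space M) (?G k)) = space M" using GP by (rule space_measure_of)
  show "sets (sigma (space M) (?G k)) \<subseteq> events" unfolding sets by (rule sets.sigma_sets_subset[OF GM])
  show "sets (sigma (space M) (?G k)) \<subseteq> sets (sigma (space M) (?G (Suc k)))"
    unfolding sets by (rule sigma_sets_mono') force
  show "e (int k) \<in> borel_measurable (sigma (space M) (?G (Suc k)))"
  proof (rule measurableI)
    fix S :: "real set" assume "S \<in> sets borel"
    then have "e (int k) -` S \<inter> space M \<in> ?G (Suc k)" by auto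
    then show "e (int k) -` S \<inter> space (sigma (space M) (?G (Suc k))) \<in> sets (sigma (space M) (?G (Suc k)))"
      unfolding sets space_measure_of[OF GP] by (rule sigma_sets.Basic)
  qed auto
  show "indep_set {e (int k) -` S \<inter> space M |S. S \<in> sets borel} (sets (sigma (space M) (?G k)))"
  proof -
    \<comment> \<open>groups the present and the past, so that independence of the two groups can be read off\<close>
    define I where "I = case_bool {int k} (int ` {..<k})"
    have "indep_sets E {0..}" using ind unfolding indep_vars_def2 E_def by simp
    moreover have "(\<Union>j\<in>UNIV. I j) \<subseteq> {0..}" by (auto simp: I_def split: bool.splits)
    ultimately have "indep_sets E (\<Union>j\<in>UNIV. I j)" by (metis indep_sets_mono_index)
    moreover have "Int_stable (E i)" for i
    proof (rule Int_stableI)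
      fix a b assume "a \<in> E i" "b \<in> E i"
      then obtain S T where "S \<in> sets borel" "T \<in> sets borel" "a = e i -` S \<inter> space M" "b = e i -` T \<inter> space M"
        by (auto simp: E_def)
      then show "a \<inter> b \<in> E i" by (auto simp: E_def intro!: exI[of _ "S \<inter> T"])
    qed
    moreover have "disjoint_family_on I UNIV"
      by (auto simp: disjoint_family_on_def I_def split: bool.splits)
    ultimately have "indep_sets (\<lambda>j. sigma_sets (space M) (\<Union>i\<in>I j. E i)) UNIV"
      by (intro indep_sets_collect_sigma) auto
    then have "indep_sets (case_bool {e (int k) -` S \<inter> space M |S. S \<in> sets borel} (sets (sigma (space M) (?G k)))) UNIV"
    proof (rule indep_sets_mono_sets)
      fix j
      show "case_bool {e (int k) -` S \<inter> space M |S. S \<in> sets borel} (sets (sigma (space M) (?G k))) j \<subseteq> sigma_sets (space M) (\<Union>i\<in>I j. E i)"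
        unfolding sets by (cases j) (auto simp: I_def E_def)
    qed
    then show ?thesis by (simp add: indep_set_def)
  qed
qed

definition past :: "'w measure \<Rightarrow> (int \<Rightarrow> 'w \<Rightarrow> real) \<Rightarrow> (int \<Rightarrow> 'w \<Rightarrow> real) \<Rightarrow> int \<Rightarrow> 'w measure" where
  "past M y u k = sigma (space M)
     ({y j -` S \<inter> space M |j S. j < k \<and> S \<in> sets borel} \<union> {u j -` S \<inter> space M |j S. j < k \<and> S \<in> sets borel})"

lemma space_past [simp]: "space (past M y u k) = space M"
  unfolding past_def by (rule space_measure_of) auto

lemma sets_past: "sets (past M y u k) = sigma_sets (space M)
     ({y j -` S \<inter> space M |j S. j < k \<and> S \<in> sets borel} \<union> {u j -` S \<inter> space M |j S. j < k \<and> S \<in> sets borel})"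
  unfolding past_def by (rule sets_measure_of) auto

lemma past_mono:
  assumes "k \<le> l" shows "sets (past M y u k) \<subseteq> sets (past M y u l)"
proof -
  have "{z j -` S \<inter> space M |j S. j < k \<and> S \<in> sets borel} \<subseteq> {z j -` S \<inter> space M |j S. j < l \<and> S \<in> sets borel}"
    for z :: "int \<Rightarrow> 'a \<Rightarrow> real"
  proof
    fix A assume "A \<in> {z j -` S \<inter> space M |j S. j < k \<and> S \<in> sets borel}"
    then obtain j S where "A = z j -` S \<inter> space M" "j < k" "S \<in> sets borel" by auto
    then show "A \<in> {z j -` S \<inter> space M |j S. j < l \<and> S \<in> sets borel}"
      using assms by (intro CollectI exI[of _ j] exI[of _ S]) auto
  qed
  then show ?thesis unfolding sets_past by (intro sigma_sets_mono' Un_mono)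
qed

lemma past_measurable:
  assumes "j < k"
  shows "y j \<in> borel_measurable (past M y u k)" "u j \<in> borel_measurable (past M y u k)"
proof -
  show "y j \<in> borel_measurable (past M y u k)"
    by (rule measurableI, simp, unfold sets_past space_past, rule sigma_sets.Basic) (use assms in blast)
  show "u j \<in> borel_measurable (past M y u k)"
    by (rule measurableI, simp, unfold sets_past space_past, rule sigma_sets.Basic) (use assms in blast)
qed

text \<open>
  The noise is known at the next time, since the system equation expresses it by inputs and outputs.
\<close>

lemma (in prob_space) innovations_of_equation_noise:
  assumes y: "\<And>j. y j \<in> borel_measurable M" and u: "\<And>j. u j \<in> borel_measurable M" and d: "\<And>k. k \<ge> 1 \<Longrightarrow> d k \<in> borel_measurable M"
    and ind: "noise_indep_of_past M d y u" and arx: "arx_system M m n a b y u d"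
  shows "innovations M (\<lambda>k. past M y u (int k + 1)) (\<lambda>k. d (int k + 1))"
proof
  fix k :: nat
  show "space (past M y u (int k + 1)) = space M" by simp
  show "sets (past M y u (int k + 1)) \<subseteq> events"
    unfolding sets_past using y u by (intro sets.sigma_sets_subset) (auto intro: measurable_sets)
  show "sets (past M y u (int k + 1)) \<subseteq> sets (past M y u (int (Suc k) + 1))"
    by (rule past_mono) simp
  let ?P = "past M y u (int (Suc k) + 1)" and ?k = "int k + 1"
  have eq_meas: "(\<lambda>\<omega>. y ?k \<omega> + (\<Sum>i=1..m. a i * y (?k - int i) \<omega>) - (\<Sum>i=1..n. b i * u (?k - int i) \<omega>)) \<in> borel_measurable ?P"
    by (intro borel_measurable_diff borel_measurable_add borel_measurable_sum borel_measurable_times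
        borel_measurable_const past_measurable) auto
  have eq: "d ?k \<omega> = y ?k \<omega> + (\<Sum>i=1..m. a i * y (?k - int i) \<omega>) - (\<Sum>i=1..n. b i * u (?k - int i) \<omega>)"
    if "\<omega> \<in> space ?P" for \<omega>
    using arx that unfolding arx_system_def by (simp add: algebra_simps)
  show "d ?k \<in> borel_measurable ?P" by (rule measurable_cong[THEN iffD2, OF eq eq_meas])
  show "indep_set {d ?k -` S \<inter> space M |S. S \<in> sets borel} (sets (past M y u ?k))"
    unfolding sets_past by (rule ind[unfolded noise_indep_of_past_def, rule_format]) simp
qed

text \<open>
  A signal as a bounded deterministic part \<open>D\<close> plus a causal filter of \<open>e\<close> whose kernel \<open>c\<close> is dominated by \<open>h\<close>. The
  noise sum may run up to any \<open>n > \<tau>\<close>, because the kernel vanishes for times after \<open>\<tau>\<close>; so one \<open>n\<close> serves all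
  times up to a horizon.
\<close>

definition filter_form :: "'w measure \<Rightarrow> (nat \<Rightarrow> 'w \<Rightarrow> real) \<Rightarrow> (int \<Rightarrow> 'w \<Rightarrow> real) \<Rightarrow> real \<Rightarrow> (nat \<Rightarrow> real) \<Rightarrow>
    (int \<Rightarrow> real) \<Rightarrow> (int \<Rightarrow> nat \<Rightarrow> real) \<Rightarrow> bool" where
  "filter_form M e z D0 h D c \<longleftrightarrow> (\<forall>\<tau>. \<bar>D \<tau>\<bar> \<le> D0) \<and>
     (\<forall>\<tau> t. \<bar>c \<tau> t\<bar> \<le> (if int t \<le> \<tau> then \<bar>h (nat (\<tau> - int t))\<bar> else 0)) \<and>
     (\<forall>\<tau> n. \<forall>\<omega>\<in>space M. \<tau> < int n \<longrightarrow> z \<tau> \<omega> = D \<tau> + (\<Sum>t<n. c \<tau> t * e t \<omega>))"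

lemma sum_abs_inj_le_suminf:
  fixes h :: "nat \<Rightarrow> real"
  assumes h: "summable (\<lambda>i. \<bar>h i\<bar>)" and A: "finite A" "inj_on g A"
  shows "(\<Sum>a\<in>A. \<bar>h (g a)\<bar>) \<le> (\<Sum>i. \<bar>h i\<bar>)"
proof -
  have "(\<Sum>a\<in>A. \<bar>h (g a)\<bar>) = (\<Sum>i\<in>g ` A. \<bar>h i\<bar>)" using A by (simp add: sum.reindex)
  also have "\<dots> \<le> (\<Sum>i. \<bar>h i\<bar>)" using A by (intro sum_le_suminf h) auto
  finally show ?thesis .
qed

lemma filter_form_row_sum:
  assumes ff: "filter_form M e z D0 h D c" and h: "summable (\<lambda>i. \<bar>h i\<bar>)"
  shows "(\<Sum>t<n. \<bar>c \<tau> t\<bar>) \<le> (\<Sum>i. \<bar>h i\<bar>)"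
proof -
  have "(\<Sum>t<n. \<bar>c \<tau> t\<bar>) \<le> (\<Sum>t<n. if int t \<le> \<tau> then \<bar>h (nat (\<tau> - int t))\<bar> else 0)"
    using ff unfolding filter_form_def by (intro sum_mono) auto
  also have "\<dots> = (\<Sum>t\<in>{t\<in>{..<n}. int t \<le> \<tau>}. \<bar>h (nat (\<tau> - int t))\<bar>)"
    by (rule sum.inter_filter[symmetric]) simp
  also have "\<dots> \<le> (\<Sum>i. \<bar>h i\<bar>)"
    by (intro sum_abs_inj_le_suminf h) (auto simp: inj_on_def)
  finally show ?thesis .
qed

lemma filter_form_col_sum:
  assumes ff: "filter_form M e z D0 h D c" and h: "summable (\<lambda>i. \<bar>h i\<bar>)"
  shows "(\<Sum>l<n. \<bar>c (int l + j) t\<bar>) \<le> (\<Sum>i. \<bar>h i\<bar>)"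
proof -
  have "(\<Sum>l<n. \<bar>c (int l + j) t\<bar>) \<le> (\<Sum>l<n. if int t \<le> int l + j then \<bar>h (nat (int l + j - int t))\<bar> else 0)"
    using ff unfolding filter_form_def by (intro sum_mono) auto
  also have "\<dots> = (\<Sum>l\<in>{l\<in>{..<n}. int t \<le> int l + j}. \<bar>h (nat (int l + j - int t))\<bar>)"
    by (rule sum.inter_filter[symmetric]) simp
  also have "\<dots> \<le> (\<Sum>i. \<bar>h i\<bar>)"
    by (intro sum_abs_inj_le_suminf h) (auto simp: inj_on_def)
  finally show ?thesis .
qed

lemma filter_form_uminus: "filter_form M e z D0 h D c \<Longrightarrow> filter_form M e (\<lambda>\<tau> \<omega>. - z \<tau> \<omega>) D0 h (\<lambda>\<tau>. - D \<tau>) (\<lambda>\<tau> t. - c \<tau> t)"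
  by (simp add: filter_form_def sum_negf)

text \<open>
  The injection \<open>\<sigma>\<close> covers both kinds of deterministic series, those that start at lag \<open>0\<close> and those that start
  at lag \<open>1\<close>; \<open>start\<close> is the first time of the signal.
\<close>

lemma filter_form_exists:
  fixes z e :: "int \<Rightarrow> 'w \<Rightarrow> real"
  assumes r: "\<And>k. \<bar>r k\<bar> \<le> rB" and e0: "\<And>k \<omega>. k < 0 \<Longrightarrow> \<omega> \<in> space M \<Longrightarrow> e k \<omega> = 0"
    and h: "summable (\<lambda>i. \<bar>h i\<bar>)"
    and \<sigma>: "inj \<sigma>"
    and f: "\<And>k i. k \<ge> start \<Longrightarrow> \<bar>f k i\<bar> \<le> \<bar>h i\<bar>" and g: "\<And>k i. k \<ge> start \<Longrightarrow> \<bar>g k i\<bar> \<le> \<bar>h i\<bar>"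
    and z0: "\<And>k \<omega>. k < start \<Longrightarrow> \<omega> \<in> space M \<Longrightarrow> z k \<omega> = 0"
    and z: "\<And>k \<omega>. k \<ge> start \<Longrightarrow> \<omega> \<in> space M \<Longrightarrow> z k \<omega> = (\<Sum>i. f k (\<sigma> i) * r (k - int (\<sigma> i))) + (\<Sum>i. g k i * e (k - int i) \<omega>)"
    and start: "start \<ge> 0"
  shows "\<exists>D c. filter_form M (\<lambda>t. e (int t)) z (rB * (\<Sum>i. \<bar>h i\<bar>)) h D c"
proof -
  let ?H = "\<Sum>i. \<bar>h i\<bar>"
  define D where "D = (\<lambda>k. if k < start then 0 else \<Sum>i. f k (\<sigma> i) * r (k - int (\<sigma> i)))"
  define c where "c = (\<lambda>k t. if k < start \<or> k < int t then 0 else g k (nat (k - int t)))"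
  have rB: "rB \<ge> 0" using r[of 0] by linarith
  have H: "?H \<ge> 0" by (rule suminf_nonneg[OF h]) simp
  have "\<bar>D k\<bar> \<le> rB * ?H" for k
  proof (cases "k < start")
    case True then show ?thesis using rB H by (simp add: D_def)
  next
    case False
    have hs: "summable (\<lambda>i. \<bar>h (\<sigma> i)\<bar>)"
    proof (rule summableI_nonneg_bounded[where x = ?H])
      show "(\<Sum>i<n. \<bar>h (\<sigma> i)\<bar>) \<le> ?H" for n
        using \<sigma> by (intro sum_abs_inj_le_suminf h) (auto intro: inj_on_subset)
    qed simp
    have hH: "(\<Sum>i. \<bar>h (\<sigma> i)\<bar>) \<le> ?H"
      by (rule suminf_le_const[OF hs]) (use \<sigma> in \<open>auto intro!: sum_abs_inj_le_suminf h intro: inj_on_subset\<close>)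
    have le: "\<bar>f k (\<sigma> i) * r (k - int (\<sigma> i))\<bar> \<le> \<bar>h (\<sigma> i)\<bar> * rB" for i
      unfolding abs_mult using f[of k] r False by (intro mult_mono) auto
    have s1: "summable (\<lambda>i. \<bar>h (\<sigma> i)\<bar> * rB)" using hs by (rule summable_mult2)
    have s2: "summable (\<lambda>i. \<bar>f k (\<sigma> i) * r (k - int (\<sigma> i))\<bar>)"
      by (rule summable_comparison_test'[OF s1]) (use le in auto)
    have "\<bar>D k\<bar> \<le> (\<Sum>i. \<bar>f k (\<sigma> i) * r (k - int (\<sigma> i))\<bar>)"
      using False s2 by (simp add: D_def summable_rabs)
    also have "\<dots> \<le> (\<Sum>i. \<bar>h (\<sigma> i)\<bar> * rB)" by (rule suminf_le[OF le s2 s1])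
    also have "\<dots> = (\<Sum>i. \<bar>h (\<sigma> i)\<bar>) * rB" by (rule suminf_mult2[OF hs, symmetric])
    also have "\<dots> \<le> ?H * rB" using hH rB by (intro mult_right_mono)
    finally show ?thesis by (simp add: mult.commute)
  qed
  moreover have "\<bar>c k t\<bar> \<le> (if int t \<le> k then \<bar>h (nat (k - int t))\<bar> else 0)" for k t
    using g[of k] by (auto simp: c_def)
  moreover have "z k \<omega> = D k + (\<Sum>t<n. c k t * e (int t) \<omega>)" if \<omega>: "\<omega> \<in> space M" and kn: "k < int n" for k n \<omega>
  proof (cases "k < start")
    case True then show ?thesis using z0 \<omega> by (simp add: D_def c_def)
  next
    case False
    then have k: "k \<ge> 0" using start by simp
    have "(\<Sum>i. g k i * e (k - int i) \<omega>) = (\<Sum>i\<in>{..nat k}. g k i * e (k - int i) \<omega>)"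
      by (rule suminf_finite) (use e0 \<omega> in auto)
    also have "\<dots> = (\<Sum>t\<in>{..nat k}. c k t * e (int t) \<omega>)"
    proof (rule sum.reindex_bij_witness[where i = "\<lambda>t. nat k - t" and j = "\<lambda>t. nat k - t"])
      fix i assume "i \<in> {..nat k}"
      then show "c k (nat k - i) * e (int (nat k - i)) \<omega> = g k i * e (k - int i) \<omega>"
        using False k by (auto simp: c_def of_nat_diff)
    qed auto
    also have "\<dots> = (\<Sum>t<n. c k t * e (int t) \<omega>)"
      using kn k by (intro sum.mono_neutral_left) (auto simp: c_def)
    finally show ?thesis using z[of k \<omega>] False \<omega> by (simp add: D_def)
  qed
  ultimately have "filter_form M (\<lambda>t. e (int t)) z (rB * ?H) h D c" by (simp add: filter_form_def)
  then show ?thesis by blast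
qed

section \<open>Time averages\<close>

lemma sum_int_shift: "(\<Sum>l=1..k. F (int l)) = (\<Sum>s<k. F (int s + 1))"
  by (simp add: sum.atLeast1_atMost_eq add.commute)

text \<open>
  Shifting by one time step changes the sum only by two boundary terms.
\<close>

lemma average_shift:
  fixes G :: "int \<Rightarrow> real"
  assumes G: "\<And>k. \<bar>G k\<bar> \<le> C" and lim: "(\<lambda>k. (\<Sum>l=1..k. G (int l)) / real k) \<longlonglongrightarrow> L"
  shows "(\<lambda>k. (\<Sum>l=1..k. G (int l - int i)) / real k) \<longlonglongrightarrow> L"
proof (induct i)
  case 0 show ?case using lim by simp
next
  case (Suc i)
  have tel: "(\<Sum>l=1..k. G (int l - int (Suc i))) = (\<Sum>l=1..k. G (int l - int i)) + (G (- int i) - G (int k - int i))" for k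
  proof (induct k)
    case (Suc k)
    have "int (Suc k) - int (Suc i) = int k - int i" by simp
    then show ?case using Suc by simp
  qed simp
  have "(\<lambda>k. (G (- int i) - G (int k - int i)) / real k) \<longlonglongrightarrow> 0"
  proof (rule Lim_null_comparison)
    show "\<forall>\<^sub>F k in sequentially. norm ((G (- int i) - G (int k - int i)) / real k) \<le> (2 * C) * (1 / real k)"
    proof (rule always_eventually, rule allI)
      fix k
      have "\<bar>G (- int i) - G (int k - int i)\<bar> \<le> 2 * C" using G[of "- int i"] G[of "int k - int i"] by linarith
      then show "norm ((G (- int i) - G (int k - int i)) / real k) \<le> (2 * C) * (1 / real k)"
        by (simp add: divide_right_mono)
    qed
    show "(\<lambda>k. (2 * C) * (1 / real k)) \<longlonglongrightarrow> 0" using tendsto_mult_right_zero[OF lim_1_over_n] .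
  qed
  from tendsto_add[OF Suc this] show ?case unfolding tel by (simp add: add_divide_distrib)
qed

lemma mean_avg_real: "mean_avg M t k = (\<Sum>l=1..k. \<integral>\<omega>. t (int l) \<omega> \<partial>M) / real k" for t :: "int \<Rightarrow> 'w \<Rightarrow> real"
  by (simp add: mean_avg_def)

lemma convergent_matrixI:
  fixes f :: "nat \<Rightarrow> real^'p^'q"
  assumes "\<And>i j. convergent (\<lambda>k. f k $ i $ j)"
  shows "convergent f"
proof -
  have "f \<longlonglongrightarrow> (\<chi> i j. lim (\<lambda>k. f k $ i $ j))"
    using assms by (intro tendsto_matrixI) (simp add: convergent_LIMSEQ_iff)
  then show ?thesis by (rule convergentI)
qed

text \<open>
  Shifting the time by \<open>i\<close> reduces this to the covariance function at lag \<open>j - i\<close>.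
\<close>

lemma (in prob_space) lagged_product_average:
  fixes s t :: "int \<Rightarrow> 'a \<Rightarrow> real"
  assumes ex: "\<And>\<tau>. Ebar_exists M (\<lambda>k \<omega>. s k \<omega> * t (k - \<tau>) \<omega>)"
    and bd: "\<And>k l. \<bar>expectation (\<lambda>\<omega>. s k \<omega> * t l \<omega>)\<bar> \<le> C"
  shows "convergent (\<lambda>k. (\<Sum>l=1..k. expectation (\<lambda>\<omega>. s (int l - int i) \<omega> * t (int l - int j) \<omega>)) / real k)"
proof -
  define G where "G = (\<lambda>k. expectation (\<lambda>\<omega>. s k \<omega> * t (k - (int j - int i)) \<omega>))"
  obtain L where "(\<lambda>k. (\<Sum>l=1..k. G (int l)) / real k) \<longlonglongrightarrow> L"
    using ex[of "int j - int i"] unfolding Ebar_exists_def convergent_def mean_avg_real[abs_def] G_def by auto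
  then have "(\<lambda>k. (\<Sum>l=1..k. G (int l - int i)) / real k) \<longlonglongrightarrow> L"
    by (rule average_shift[where C = C, rotated]) (simp add: G_def bd)
  then have "(\<lambda>k. (\<Sum>l=1..k. expectation (\<lambda>\<omega>. s (int l - int i) \<omega> * t (int l - int j) \<omega>)) / real k) \<longlonglongrightarrow> L"
    by (simp add: G_def)
  then show ?thesis by (rule convergentI)
qed

lemma converges_in_distribution_cong:
  assumes "\<And>k \<omega>. \<omega> \<in> space M \<Longrightarrow> X k \<omega> = Y k \<omega>" "converges_in_distribution M X N"
  shows "converges_in_distribution M Y N"
proof -
  have "(\<integral>\<omega>. g (Y k \<omega>) \<partial>M) = (\<integral>\<omega>. g (X k \<omega>) \<partial>M)" for g :: "'b \<Rightarrow> real" and k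
    by (rule Bochner_Integration.integral_cong) (simp_all add: assms(1))
  moreover have "Y k \<in> borel_measurable M \<longleftrightarrow> X k \<in> borel_measurable M" for k
    by (rule measurable_cong) (simp add: assms(1))
  ultimately show ?thesis using assms(2) unfolding converges_in_distribution_def by simp
qed

section \<open>The ARX equation and its least squares estimate\<close>

lemma arx_equation:
  assumes arx: "arx_system M m n a b y u d" and ix: "bij_betw ix (UNIV :: 'p::finite set) {1..m + n}"
    and \<omega>: "\<omega> \<in> space M" and k: "k \<ge> 1"
  shows "y k \<omega> = arx_regressor ix m y u k \<omega> \<bullet> arx_param ix m a b + d k \<omega>"
proof -
  let ?f = "\<lambda>i. if i \<le> m then - y (k - int i) \<omega> * a i else u (k - int (i - m)) \<omega> * b (i - m)"
  have "arx_regressor ix m y u k \<omega> \<bullet> arx_param ix m a b = (\<Sum>p\<in>UNIV. ?f (ix p))"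
    unfolding inner_vec_def arx_regressor_def arx_param_def by (intro sum.cong) auto
  also have "\<dots> = (\<Sum>i\<in>{1..m + n}. ?f i)" by (rule sum.reindex_bij_betw[OF ix])
  also have "{1..m + n} = {1..m} \<union> {m + 1..m + n}" by auto
  also have "(\<Sum>i\<in>{1..m} \<union> {m + 1..m + n}. ?f i) = (\<Sum>i\<in>{1..m}. ?f i) + (\<Sum>i\<in>{m + 1..m + n}. ?f i)"
    by (rule sum.union_disjoint) auto
  also have "(\<Sum>i\<in>{1..m}. ?f i) = - (\<Sum>i=1..m. a i * y (k - int i) \<omega>)"
    by (simp add: sum_negf[symmetric] mult.commute)
  also have "(\<Sum>i\<in>{m + 1..m + n}. ?f i) = (\<Sum>i=1..n. b i * u (k - int i) \<omega>)"
    by (rule sum.reindex_bij_witness[where i = "\<lambda>i. i + m" and j = "\<lambda>i. i - m"]) (auto simp: mult.commute)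
  finally have eq: "arx_regressor ix m y u k \<omega> \<bullet> arx_param ix m a b =
    - (\<Sum>i=1..m. a i * y (k - int i) \<omega>) + (\<Sum>i=1..n. b i * u (k - int i) \<omega>)" .
  have "y k \<omega> + (\<Sum>i=1..m. a i * y (k - int i) \<omega>) = (\<Sum>i=1..n. b i * u (k - int i) \<omega>) + d k \<omega>"
    using arx \<omega> k unfolding arx_system_def by blast
  then show ?thesis unfolding eq by linarith
qed

lemma rls_P_measurable:
  fixes x :: "nat \<Rightarrow> 'w \<Rightarrow> real^'p"
  assumes x: "\<And>l. l \<ge> 1 \<Longrightarrow> x l \<in> borel_measurable M"
  shows "(\<lambda>\<omega>. rls_P (\<lambda>l. x l \<omega>) P0 k) \<in> borel_measurable M"
proof (induct k)
  case 0 show ?case by simp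
next
  case (Suc k)
  note P = Suc and xk = x[of "Suc k", simplified]
  have "(\<lambda>\<omega>. rls_gain (rls_P (\<lambda>l. x l \<omega>) P0 k) (x (Suc k) \<omega>)) \<in> borel_measurable M"
    unfolding rls_gain_def
    by (intro borel_measurable_inverse borel_measurable_add borel_measurable_const borel_measurable_inner
        matrix_vector_borel_measurable P xk)
  moreover have "(\<lambda>\<omega>. rls_P (\<lambda>l. x l \<omega>) P0 k ** outer (x (Suc k) \<omega>) (x (Suc k) \<omega>) ** rls_P (\<lambda>l. x l \<omega>) P0 k) \<in> borel_measurable M"
    by (intro matrix_matrix_borel_measurable outer_borel_measurable P xk)
  ultimately show ?case unfolding rls_P.simps Let_def
    by (intro borel_measurable_diff borel_measurable_scaleR P)
qed

lemma rls_P_norm_le: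
  assumes "pos_def (P0::real^'p^'p)"
  shows "norm (rls_P x P0 k) \<le> (\<Sum>i\<in>(UNIV::'p set). \<Sum>j\<in>(UNIV::'p set). norm P0)"
  using rls_P_props[OF assms, of x k] by (intro psd_norm_le) auto

lemma scaled_matrix_inv_tendsto:
  fixes T :: "nat \<Rightarrow> real^'p^'p"
  assumes lim: "(\<lambda>k. (1 / real k) *\<^sub>R T k) \<longlonglongrightarrow> R" and RS: "R ** S = mat 1"
  shows "(\<lambda>k. real k *\<^sub>R matrix_inv (T k)) \<longlonglongrightarrow> S"
proof (rule tendsto_matrix_inverse[OF lim RS])
  show "\<forall>\<^sub>F k in sequentially. (real k *\<^sub>R matrix_inv (T k)) ** ((1 / real k) *\<^sub>R T k) = mat 1"
    using eventually_invertible_of_tendsto[OF lim RS] eventually_ge_at_top[of 1]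
  proof eventually_elim
    case (elim k)
    let ?V = "(1 / real k) *\<^sub>R T k"
    have k: "real k \<noteq> 0" using elim by simp
    have "T k ** ((1 / real k) *\<^sub>R matrix_inv ?V) = ?V ** matrix_inv ?V"
      by (simp add: vec_eq_iff matrix_matrix_mult_def sum_distrib_left mult_ac)
    then have "matrix_inv (T k) = (1 / real k) *\<^sub>R matrix_inv ?V"
      using elim by (intro matrix_inv_eqI) simp
    then have "real k *\<^sub>R matrix_inv (T k) = matrix_inv ?V" using k by simp
    then show ?case using elim by simp
  qed
qed


section \<open>Asymptotic efficiency\<close>

theorem theorem3p3:
  fixes M :: "'w measure"
    and \<gamma> m n :: nat
    and ix :: "'p::finite \<Rightarrow> nat"
    and a b :: "nat \<Rightarrow> real"
    and y u d :: "int \<Rightarrow> 'w \<Rightarrow> real"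
    and \<delta>d :: real
    and \<theta>0 \<theta> :: "real^'p"
    and P0 R :: "real^'p^'p"
    and \<phi> :: "int \<Rightarrow> 'w \<Rightarrow> real^'p"
    and \<theta>err :: "nat \<Rightarrow> 'w \<Rightarrow> real^'p"
  assumes "prob_space M"
    and "\<gamma> \<ge> 1"
    and "bij_betw ix UNIV {1..m + n}"
    and "arx_system M m n a b y u d"
    and \<theta>_eq: "\<theta> = arx_param ix m a b"
    and \<phi>_eq: "\<phi> = arx_regressor ix m y u"
    and "filtered_data_assumption M \<gamma> y u \<phi>"
    and "stable_A m a"
    and "gaussian_noise M d \<delta>d"
    and "noise_indep_of_past M d y u"
    and "pos_def P0"
    and \<theta>err_eq: "\<theta>err = (\<lambda>k \<omega>. rls_estimate (\<lambda>l. \<phi> (int l) \<omega>) (\<lambda>l. y (int l) \<omega>) \<theta>0 P0 k - \<theta>)"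
    and R_eq: "R = Ebar M (\<lambda>k \<omega>. outer (\<phi> k \<omega>) (\<phi> k \<omega>))"
  shows "(\<gamma> \<ge> 2 \<longrightarrow>
            (\<exists>N. is_gaussian_law N 0 (\<delta>d\<^sup>2 *\<^sub>R matrix_inv R) \<and>
                 converges_in_distribution M (\<lambda>k \<omega>. sqrt (real k) *\<^sub>R \<theta>err k \<omega>) N) \<and>
            (\<lambda>k. real k *\<^sub>R sigma_CR M \<phi> \<delta>d k) \<longlonglongrightarrow> \<delta>d\<^sup>2 *\<^sub>R matrix_inv R) \<and>
         (\<gamma> > 4 \<longrightarrow>
            (\<forall>k. integrable M (\<lambda>\<omega>. outer (\<theta>err k \<omega>) (\<theta>err k \<omega>))) \<and>
            (\<lambda>k. real k *\<^sub>R ((\<integral>\<omega>. outer (\<theta>err k \<omega>) (\<theta>err k \<omega>) \<partial>M) - sigma_CR M \<phi> \<delta>d k)) \<longlonglongrightarrow> 0)"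
proof -
  interpret prob_space M by fact
  have \<gamma>: "\<gamma> \<ge> 1" by fact
  have ix: "bij_betw ix UNIV {1..m + n}" by fact
  have arx: "arx_system M m n a b y u d" by fact
  have P0: "pos_def P0" by fact
  \<comment> \<open>component \<open>p\<close> of the regressor at time \<open>k\<close> is the signal \<open>z p\<close> at time \<open>k - lag p\<close>\<close>
  define lag where "lag = (\<lambda>p. if ix p \<le> m then ix p else ix p - m)"
  define z where "z = (\<lambda>p \<tau> \<omega>. if ix p \<le> m then - y \<tau> \<omega> else u \<tau> \<omega>)"
  have lag: "lag p \<ge> 1" for p
  proof -
    have "ix p \<in> {1..m + n}" using ix by (auto simp: bij_betw_def)
    then show ?thesis by (auto simp: lag_def)
  qed
  have \<phi>_nth: "\<phi> k \<omega> $ p = z p (k - int (lag p)) \<omega>" for k \<omega> p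
    by (simp add: \<phi>_eq arx_regressor_def z_def lag_def)

  obtain r :: "int \<Rightarrow> real" and e :: "int \<Rightarrow> 'w \<Rightarrow> real" and \<delta>e :: real
      and f :: "nat \<Rightarrow> int \<Rightarrow> nat \<Rightarrow> real" and h :: "nat \<Rightarrow> real" and Ke where
    r: "bounded (range r)" and e0: "\<forall>k<0. \<forall>\<omega>\<in>space M. e k \<omega> = 0" and e_ind: "indep_vars (\<lambda>_. borel) e {0..}"
    and e_mean: "\<forall>k\<ge>0. expectation (e k) = 0 \<and> variance (e k) = \<delta>e\<^sup>2"
    and e_mom: "\<forall>k\<ge>0. integrable M (\<lambda>\<omega>. \<bar>e k \<omega>\<bar> ^ (4 * \<gamma>)) \<and> (\<integral>\<omega>. \<bar>e k \<omega>\<bar> ^ (4 * \<gamma>) \<partial>M) \<le> Ke"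
    and y_filt: "\<forall>k\<ge>1. \<forall>\<omega>\<in>space M. y k \<omega> = (\<Sum>i. f 1 k (Suc i) * r (k - int (Suc i))) + (\<Sum>i. f 2 k i * e (k - int i) \<omega>)"
    and u_filt: "\<forall>k\<ge>0. \<forall>\<omega>\<in>space M. u k \<omega> = (\<Sum>i. f 3 k i * r (k - int i)) + (\<Sum>i. f 4 k i * e (k - int i) \<omega>)"
    and f_le: "\<forall>j\<in>{1..4}. \<forall>k\<ge>0. \<forall>i. \<bar>f j k i\<bar> \<le> \<bar>h i\<bar>" and h: "summable (\<lambda>i. \<bar>h i\<bar>)"
    and qs_y: "quasi_stationary M y" and qs_u: "quasi_stationary M u"
    and yu: "\<forall>\<tau>. Ebar_exists M (\<lambda>k \<omega>. y k \<omega> * u (k - \<tau>) \<omega>)" and pdR: "pos_def R"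
    using \<open>filtered_data_assumption M \<gamma> y u \<phi>\<close> unfolding filtered_data_assumption_def R_eq by blast

  obtain Cy where Cy: "\<And>k. integrable M (y k)" "\<And>i j. integrable M (\<lambda>\<omega>. y i \<omega> * y j \<omega>)"
      "\<And>i j. \<bar>expectation (\<lambda>\<omega>. y i \<omega> * y j \<omega>)\<bar> \<le> Cy" "\<And>\<tau>. Ebar_exists M (\<lambda>k \<omega>. y k \<omega> * y (k - \<tau>) \<omega>)"
    using qs_y unfolding quasi_stationary_def by (metis less_imp_le)
  obtain Cu where Cu: "\<And>k. integrable M (u k)" "\<And>i j. integrable M (\<lambda>\<omega>. u i \<omega> * u j \<omega>)"
      "\<And>i j. \<bar>expectation (\<lambda>\<omega>. u i \<omega> * u j \<omega>)\<bar> \<le> Cu" "\<And>\<tau>. Ebar_exists M (\<lambda>k \<omega>. u k \<omega> * u (k - \<tau>) \<omega>)"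
    using qs_u unfolding quasi_stationary_def by (metis less_imp_le)
  have ym: "y k \<in> borel_measurable M" and um: "u k \<in> borel_measurable M" for k
    using Cy(1) Cu(1) by auto
  have y2: "integrable M (\<lambda>\<omega>. (y k \<omega>)\<^sup>2)" "expectation (\<lambda>\<omega>. (y k \<omega>)\<^sup>2) \<le> Cy" for k
    using Cy(2)[of k k] Cy(3)[of k k] by (auto simp: power2_eq_square)
  have u2: "integrable M (\<lambda>\<omega>. (u k \<omega>)\<^sup>2)" "expectation (\<lambda>\<omega>. (u k \<omega>)\<^sup>2) \<le> Cu" for k
    using Cu(2)[of k k] Cu(3)[of k k] by (auto simp: power2_eq_square)
  have yu_int: "integrable M (\<lambda>\<omega>. y i \<omega> * u j \<omega>)" for i j
    by (rule integrable_mult_of_squares[OF ym um y2(1) u2(1)])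
  have yu_bd: "\<bar>expectation (\<lambda>\<omega>. y i \<omega> * u j \<omega>)\<bar> \<le> sqrt Cy * sqrt Cu" for i j
    by (rule expectation_cauchy_schwarz[OF ym um y2(1) u2(1) y2(2) u2(2)])

  have zm: "z p \<tau> \<in> borel_measurable M" for p \<tau> using ym um by (simp add: z_def)
  have zz_int: "integrable M (\<lambda>\<omega>. z p i \<omega> * z q j \<omega>)" for p q i j
    using Cy(2)[of i j] Cu(2)[of i j] yu_int[of i j] yu_int[of j i]
    by (cases "ix p \<le> m"; cases "ix q \<le> m") (simp_all add: z_def mult.commute)
  have zz_avg: "convergent (\<lambda>k. (\<Sum>l=1..k. expectation (\<lambda>\<omega>. z p (int l - int i) \<omega> * z q (int l - int j) \<omega>)) / real k)" for p q i j
  proof -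
    have neg: "convergent (\<lambda>k. (\<Sum>l=1..k. - g l) / real k)" if "convergent (\<lambda>k. (\<Sum>l=1..k. g l) / real k)" for g :: "nat \<Rightarrow> real"
      using convergent_minus_iff[THEN iffD1, OF that] by (simp add: sum_negf)
    have yu_avg: "convergent (\<lambda>k. (\<Sum>l=1..k. expectation (\<lambda>\<omega>. y (int l - int i) \<omega> * u (int l - int j) \<omega>)) / real k)" for i j
      by (rule lagged_product_average[OF yu[rule_format] yu_bd])
    show ?thesis
      using lagged_product_average[OF Cy(4) Cy(3), of i j] lagged_product_average[OF Cu(4) Cu(3), of i j]
        neg[OF yu_avg[of i j]] neg[OF yu_avg[of j i]]
      by (cases "ix p \<le> m"; cases "ix q \<le> m") (simp_all add: z_def mult.commute)
  qed

  define T where "T = (\<lambda>k. \<Sum>l=1..k. \<integral>\<omega>. outer (\<phi> (int l) \<omega>) (\<phi> (int l) \<omega>) \<partial>M)"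
  have outer_int: "integrable M (\<lambda>\<omega>. outer (\<phi> k \<omega>) (\<phi> k \<omega>))" for k
    by (rule integrable_matrixI) (simp add: outer_nth \<phi>_nth zz_int)
  have T_nth: "T k $ i $ j = (\<Sum>l=1..k. expectation (\<lambda>\<omega>. \<phi> (int l) \<omega> $ i * \<phi> (int l) \<omega> $ j))" for k i j
    unfolding T_def by (simp add: integral_entry(2)[OF outer_int] outer_nth)
  have avgT: "mean_avg M (\<lambda>k \<omega>. outer (\<phi> k \<omega>) (\<phi> k \<omega>)) = (\<lambda>k. (1 / real k) *\<^sub>R T k)"
    by (simp add: mean_avg_def T_def fun_eq_iff)
  have T_lim: "(\<lambda>k. (1 / real k) *\<^sub>R T k) \<longlonglongrightarrow> R"
  proof -
    have "convergent (\<lambda>k. (1 / real k) *\<^sub>R T k)"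
      by (rule convergent_matrixI) (use zz_avg in \<open>simp add: T_nth \<phi>_nth\<close>)
    then show ?thesis unfolding R_eq Ebar_def avgT by (simp add: convergent_LIMSEQ_iff)
  qed

  define S where "S = matrix_inv R"
  have RS: "R ** S = mat 1" and S_sym: "transpose S = S" and S_psd: "0 \<le> v \<bullet> (S *v v)" for v
    using pos_def_inverse[OF pdR] unfolding S_def by auto

  interpret E: innovations M "\<lambda>k. sigma (space M) (\<Union>t<k. {e (int t) -` S \<inter> space M |S. S \<in> sets borel})" "\<lambda>k. e (int k)"
    by (rule innovations_of_indep_vars[OF e_ind])
  have e_pow: "(\<lambda>\<omega>. \<bar>e (int s) \<omega>\<bar> ^ (4 * \<gamma>)) = (\<lambda>\<omega>. e (int s) \<omega> ^ (2 * (2 * \<gamma>)))" for s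
    by (simp add: power_mult)
  have e_int: "integrable M (\<lambda>\<omega>. e (int s) \<omega> ^ (2 * (2 * \<gamma>)))" "expectation (\<lambda>\<omega>. e (int s) \<omega> ^ (2 * (2 * \<gamma>))) \<le> Ke" for s
    using e_mom[rule_format, of "int s"] unfolding e_pow by auto
  have "0 \<le> expectation (\<lambda>\<omega>. e (int 0) \<omega> ^ (2 * (2 * \<gamma>)))" by (simp add: power_mult)
  then have Ke: "Ke \<ge> 0" using e_int(2)[of 0] by linarith
  define K where "K = 1 + Ke"
  have K: "K \<ge> 0" using Ke by (simp add: K_def)
  have e_mom_q: "integrable M (\<lambda>\<omega>. e (int s) \<omega> ^ (4 * q))" "expectation (\<lambda>\<omega>. e (int s) \<omega> ^ (4 * q)) \<le> K" if "q \<le> \<gamma>" for s q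
  proof -
    have q: "2 * (2 * q) \<le> 2 * (2 * \<gamma>)" using that by simp
    show "integrable M (\<lambda>\<omega>. e (int s) \<omega> ^ (4 * q))"
      using integrable_lower_power[OF E.X_measurable e_int(1) q] by simp
    show "expectation (\<lambda>\<omega>. e (int s) \<omega> ^ (4 * q)) \<le> K"
      using moment_le_one_plus[OF E.X_measurable e_int(1) q, of s] e_int(2)[of s] by (simp add: K_def)
  qed
  have e_zero: "expectation (e (int s)) = 0" and e_var: "expectation (\<lambda>\<omega>. (e (int s) \<omega>)\<^sup>2) = \<delta>e\<^sup>2" for s
    using e_mean[rule_format, of "int s"] by auto

  obtain rB where rB: "\<And>k. \<bar>r k\<bar> \<le> rB" using r by (auto simp: bounded_real)
  define H where "H = (\<Sum>i. \<bar>h i\<bar>)"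
  define D0 where "D0 = rB * H"
  have fj: "\<bar>f j k i\<bar> \<le> \<bar>h i\<bar>" if "j \<in> {1..4}" "k \<ge> 0" for j k i using f_le that by blast
  have "\<exists>D c. filter_form M (\<lambda>t. e (int t)) y D0 h D c"
    unfolding D0_def H_def
  proof (rule filter_form_exists[where start = 1 and \<sigma> = Suc and f = "f 1" and g = "f 2" and r = r])
    show "y k \<omega> = 0" if "k < 1" "\<omega> \<in> space M" for k \<omega>
      using arx that unfolding arx_system_def by auto
  qed (use rB e0 h fj y_filt in auto)
  then obtain Dy cy where ff_y: "filter_form M (\<lambda>t. e (int t)) y D0 h Dy cy" by blast
  have "\<exists>D c. filter_form M (\<lambda>t. e (int t)) u D0 h D c"
    unfolding D0_def H_def
  proof (rule filter_form_exists[where start = 0 and \<sigma> = "\<lambda>i. i" and f = "f 3" and g = "f 4" and r = r])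
    show "u k \<omega> = 0" if "k < 0" "\<omega> \<in> space M" for k \<omega>
      using arx that unfolding arx_system_def by auto
  qed (use rB e0 h fj u_filt in auto)
  then obtain Du cu where ff_u: "filter_form M (\<lambda>t. e (int t)) u D0 h Du cu" by blast
  define Dz where "Dz = (\<lambda>p \<tau>. if ix p \<le> m then - Dy \<tau> else Du \<tau>)"
  define cz where "cz = (\<lambda>p \<tau> t. if ix p \<le> m then - cy \<tau> t else cu \<tau> t)"
  have ff: "filter_form M (\<lambda>t. e (int t)) (z p) D0 h (Dz p) (cz p)" for p
    using filter_form_uminus[OF ff_y] ff_u by (cases "ix p \<le> m") (simp_all add: z_def Dz_def cz_def)
  \<comment> \<open>the filters of the components of \<open>\<phi>\<^bsub>s+1\<^esub>\<close>, whose time argument is \<open>s + 1 - lag p \<le> s\<close>\<close>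
  define DD where "DD = (\<lambda>p s. Dz p (int s + (1 - int (lag p))))"
  define FF where "FF = (\<lambda>p s t. cz p (int s + (1 - int (lag p))) t)"
  have DD: "\<bar>DD p s\<bar> \<le> D0" for p s using ff[of p] unfolding filter_form_def DD_def by blast
  have D0: "D0 \<ge> 0" using DD[of undefined 0] by linarith
  have row: "(\<Sum>t<k. \<bar>FF p s t\<bar>) \<le> H" for p s k
    unfolding FF_def H_def by (rule filter_form_row_sum[OF ff h])
  have col: "(\<Sum>s<k. \<bar>FF p s t\<bar>) \<le> H" for p k t
    unfolding FF_def H_def by (rule filter_form_col_sum[OF ff h])
  define x where "x = (\<lambda>s. \<phi> (int s + 1))"
  have x_filt: "x s \<omega> $ p = E.filtered (DD p) (FF p) k s \<omega>" if "s < k" "\<omega> \<in> space M" for s k \<omega> p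
  proof -
    have "int s + (1 - int (lag p)) < int k" using lag[of p] that by linarith
    then have "z p (int s + (1 - int (lag p))) \<omega> = DD p s + (\<Sum>t<k. FF p s t * e (int t) \<omega>)"
      using ff[of p] that unfolding filter_form_def DD_def FF_def by blast
    then show ?thesis unfolding x_def \<phi>_nth E.filtered_def by (simp add: algebra_simps)
  qed

  have d_meas: "d k \<in> borel_measurable M" if "k \<ge> 1" for k
    using \<open>gaussian_noise M d \<delta>d\<close> that unfolding gaussian_noise_def indep_vars_def by auto
  interpret J: innovations M "\<lambda>k. past M y u (int k + 1)" "\<lambda>k. d (int k + 1)"
    by (rule innovations_of_equation_noise[OF ym um d_meas \<open>noise_indep_of_past M d y u\<close> arx])
  define Pm where "Pm = (\<lambda>k \<omega>. rls_P (\<lambda>l. \<phi> (int l) \<omega>) P0 k)"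
  define pc where "pc = (\<Sum>i\<in>(UNIV::'p set). \<Sum>j\<in>(UNIV::'p set). norm P0)"
  define B where "B = 4 ^ 2 * (D0 ^ (2 * 2) + H ^ (2 * 2) * K)"
  have \<phi>_meas: "\<phi> k \<in> borel_measurable M" for k
    by (rule vec_borel_measurableI) (simp add: \<phi>_nth zm)
  interpret L: rls_regression M "\<lambda>k. past M y u (int k + 1)" "\<lambda>k. d (int k + 1)" x R S "matrix_inv P0"
    "matrix_inv P0 *v (\<theta>0 - \<theta>)" "\<delta>d\<^sup>2" B pc Pm
  proof
    show "0 \<le> \<delta>d\<^sup>2" by simp
    show "distr M borel (d (int s + 1)) = gaussian_law 0 (\<delta>d\<^sup>2)" for s
      using \<open>gaussian_noise M d \<delta>d\<close> unfolding gaussian_noise_def by simp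
    show "x s \<in> borel_measurable (past M y u (int s + 1))" for s
    proof (rule vec_borel_measurableI)
      fix p
      have "int s + 1 - int (lag p) < int s + 1" using lag[of p] by linarith
      from past_measurable[OF this, where y = y and M = M and u = u]
      show "(\<lambda>\<omega>. x s \<omega> $ p) \<in> borel_measurable (past M y u (int s + 1))"
        by (cases "ix p \<le> m") (simp_all add: x_def \<phi>_nth z_def)
    qed
    have e4: "integrable M (\<lambda>\<omega>. e (int s) \<omega> ^ (2 * 2))" "expectation (\<lambda>\<omega>. e (int s) \<omega> ^ (2 * 2)) \<le> K" for s
      using e_mom_q[of 1] \<gamma> by simp_all
    have two: "1 \<le> (2::nat)" by simp
    have f4: "integrable M (\<lambda>\<omega>. E.filtered (DD p) (FF p) (Suc s) s \<omega> ^ (2 * 2))"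
      "expectation (\<lambda>\<omega>. E.filtered (DD p) (FF p) (Suc s) s \<omega> ^ (2 * 2)) \<le> B" for s p
      unfolding B_def by (rule E.filtered_moment[OF two e4 K DD row])+
    have x4: "x s \<omega> $ p ^ 4 = E.filtered (DD p) (FF p) (Suc s) s \<omega> ^ (2 * 2)" if "\<omega> \<in> space M" for s p \<omega>
      using x_filt[of s "Suc s" \<omega> p] that by simp
    show "integrable M (\<lambda>\<omega>. x s \<omega> $ p ^ 4)" for s p
      using f4(1)[of p s] by (simp add: x4 cong: Bochner_Integration.integrable_cong)
    show "expectation (\<lambda>\<omega>. x s \<omega> $ p ^ 4) \<le> B" for s p
      using f4(2)[of p s] by (simp add: x4 cong: Bochner_Integration.integral_cong)
    have "T k = (\<Sum>s<k. \<chi> i j. expectation (\<lambda>\<omega>. x s \<omega> $ i * x s \<omega> $ j))" for k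
      unfolding T_def by (subst sum_int_shift[where F = "\<lambda>l. \<integral>\<omega>. outer (\<phi> l \<omega>) (\<phi> l \<omega>) \<partial>M"])
        (simp add: vec_eq_iff integral_entry(2)[OF outer_int] outer_nth x_def)
    then show "(\<lambda>k. (1 / real k) *\<^sub>R (\<Sum>s<k. \<chi> i j. expectation (\<lambda>\<omega>. x s \<omega> $ i * x s \<omega> $ j))) \<longlonglongrightarrow> R"
      using T_lim by simp
    show "R ** S = mat 1" "transpose S = S" "0 \<le> v \<bullet> (S *v v)" for v by (fact RS S_sym S_psd)+
    show "Pm k \<omega> ** (matrix_inv P0 + (\<Sum>s<k. outer (x s \<omega>) (x s \<omega>))) = mat 1" for k \<omega>
      using rls_P_props[OF P0, of "\<lambda>l. \<phi> (int l) \<omega>" k]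
      unfolding Pm_def information_def x_def sum_int_shift[where F = "\<lambda>l. outer (\<phi> l \<omega>) (\<phi> l \<omega>)", symmetric] by blast
    show "Pm k \<in> borel_measurable M" for k
      unfolding Pm_def by (rule rls_P_measurable) (rule \<phi>_meas)
    show "norm (Pm k \<omega>) \<le> pc" for k \<omega> unfolding Pm_def pc_def by (rule rls_P_norm_le[OF P0])
  qed

  have rate: "L.moment_rate q" if q: "1 \<le> q" "q \<le> \<gamma>" for q
    unfolding L.moment_rate_def
  proof (intro exI[of _ "\<bar>E.covariance_rate q K (\<delta>e\<^sup>2) D0 H\<bar>"] conjI allI)
    fix k i j
    let ?W = "\<lambda>\<omega>. \<Sum>s<k. E.filtered (DD i) (FF i) (Suc k) s \<omega> * E.filtered (DD j) (FF j) (Suc k) s \<omega>"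
    note cov = E.filtered_covariance_moment[where n = "Suc k" and I = "{..<k}" and D = "DD i" and D' = "DD j"
      and \<Phi> = "FF i" and \<Phi>' = "FF j", OF q(1) e_zero e_var e_mom_q[OF q(2)] K finite_lessThan D0 DD DD row row col col]
    have xx: "integrable M (\<lambda>\<omega>. x s \<omega> $ i * x s \<omega> $ j)" for s by (simp add: x_def \<phi>_nth zz_int)
    have W: "(\<Sum>s<k. x s \<omega> $ i * x s \<omega> $ j) = ?W \<omega>" if "\<omega> \<in> space M" for \<omega>
      using x_filt[of _ "Suc k" \<omega>] that by (intro sum.cong) auto
    have "L.mean_info k $ i $ j = expectation (\<lambda>\<omega>. \<Sum>s<k. x s \<omega> $ i * x s \<omega> $ j)"
      using xx by (simp add: L.mean_info_def)
    also have "\<dots> = expectation ?W" by (rule Bochner_Integration.integral_cong[OF refl W])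
    finally have fl: "L.fluctuation k \<omega> $ i $ j = ?W \<omega> - expectation ?W" if "\<omega> \<in> space M" for \<omega>
      using W[OF that] by (simp add: L.fluctuation_def outer_nth)
    show "integrable M (\<lambda>\<omega>. (L.fluctuation k \<omega> $ i $ j) ^ (2 * q))"
      using cov(2) by (simp add: fl cong: Bochner_Integration.integrable_cong)
    have "expectation (\<lambda>\<omega>. (L.fluctuation k \<omega> $ i $ j) ^ (2 * q)) = expectation (\<lambda>\<omega>. (?W \<omega> - expectation ?W) ^ (2 * q))"
      by (rule Bochner_Integration.integral_cong[OF refl]) (simp add: fl)
    also have "\<dots> \<le> E.covariance_rate q K (\<delta>e\<^sup>2) D0 H * real (Suc k) ^ q" by (rule cov(3))
    also have "\<dots> \<le> \<bar>E.covariance_rate q K (\<delta>e\<^sup>2) D0 H\<bar> * real (Suc k) ^ q" by (intro mult_right_mono) auto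
    finally show "expectation (\<lambda>\<omega>. (L.fluctuation k \<omega> $ i $ j) ^ (2 * q)) \<le> \<bar>E.covariance_rate q K (\<delta>e\<^sup>2) D0 H\<bar> * real (Suc k) ^ q" .
  qed simp

  have err: "\<theta>err k \<omega> = Pm k \<omega> *v (matrix_inv P0 *v (\<theta>0 - \<theta>) + L.score k \<omega>)" if "\<omega> \<in> space M" for k \<omega>
  proof -
    have "rls_estimate (\<lambda>l. \<phi> (int l) \<omega>) (\<lambda>l. y (int l) \<omega>) \<theta>0 P0 k - \<theta> =
       Pm k \<omega> *v (matrix_inv P0 *v (\<theta>0 - \<theta>) + (\<Sum>l=1..k. d (int l) \<omega> *\<^sub>R \<phi> (int l) \<omega>))"
      unfolding Pm_def
      by (rule rls_error[OF P0]) (use arx_equation[OF arx ix that] in \<open>simp add: \<theta>_eq \<phi>_eq\<close>)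
    moreover have "L.score k \<omega> = (\<Sum>l=1..k. d (int l) \<omega> *\<^sub>R \<phi> (int l) \<omega>)"
      unfolding L.score_def unfolding x_def sum_int_shift[where F = "\<lambda>l. d l \<omega> *\<^sub>R \<phi> l \<omega>"] ..
    ultimately show ?thesis unfolding \<theta>err_eq by simp
  qed
  have scaled: "L.scaled_error k \<omega> = sqrt (real k) *\<^sub>R \<theta>err k \<omega>" if "\<omega> \<in> space M" for k \<omega>
    by (simp add: L.scaled_error_def err[OF that])
  have cr: "(\<lambda>k. real k *\<^sub>R sigma_CR M \<phi> \<delta>d k) \<longlonglongrightarrow> \<delta>d\<^sup>2 *\<^sub>R matrix_inv R"
  proof -
    have "(\<lambda>k. \<delta>d\<^sup>2 *\<^sub>R (real k *\<^sub>R matrix_inv (T k))) \<longlonglongrightarrow> \<delta>d\<^sup>2 *\<^sub>R S"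
      by (intro tendsto_intros scaled_matrix_inv_tendsto[OF T_lim RS])
    then show ?thesis by (simp add: sigma_CR_def T_def S_def mult.commute)
  qed
  show ?thesis
  proof (intro conjI impI)
    assume "2 \<le> \<gamma>"
    have "transpose (\<delta>d\<^sup>2 *\<^sub>R S) = \<delta>d\<^sup>2 *\<^sub>R S"
      using S_sym by (simp add: vec_eq_iff transpose_def)
    moreover have "0 \<le> v \<bullet> ((\<delta>d\<^sup>2 *\<^sub>R S) *v v)" for v
      using S_psd[of v] by (simp add: scaleR_matrix_vector)
    ultimately obtain N where N: "is_gaussian_law N 0 (\<delta>d\<^sup>2 *\<^sub>R S)" "prob_space N"
      using gaussian_law_exists[of "\<delta>d\<^sup>2 *\<^sub>R S"] by blast
    have cd: "converges_in_distribution M L.scaled_error N"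
      by (rule L.scaled_error_in_distribution[OF rate N(2,1)]) (use \<gamma> in auto)
    have "converges_in_distribution M (\<lambda>k \<omega>. sqrt (real k) *\<^sub>R \<theta>err k \<omega>) N"
      by (rule converges_in_distribution_cong[OF _ cd]) (rule scaled)
    then show "\<exists>N. is_gaussian_law N 0 (\<delta>d\<^sup>2 *\<^sub>R matrix_inv R) \<and>
                 converges_in_distribution M (\<lambda>k \<omega>. sqrt (real k) *\<^sub>R \<theta>err k \<omega>) N"
      using N(1) unfolding S_def by blast
    show "(\<lambda>k. real k *\<^sub>R sigma_CR M \<phi> \<delta>d k) \<longlonglongrightarrow> \<delta>d\<^sup>2 *\<^sub>R matrix_inv R" by (rule cr)
  next
    assume \<gamma>4: "4 < \<gamma>"
    have entry: "L.scaled_error k \<omega> $ i * L.scaled_error k \<omega> $ j = real k * (outer (\<theta>err k \<omega>) (\<theta>err k \<omega>) $ i $ j)"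
      if "\<omega> \<in> space M" for k \<omega> i j
      by (simp add: scaled[OF that] outer_nth mult.assoc mult.left_commute)
    have int: "integrable M (\<lambda>\<omega>. outer (\<theta>err k \<omega>) (\<theta>err k \<omega>))" for k
    proof (cases "k = 0")
      case True then show ?thesis by (simp add: \<theta>err_eq)
    next
      case False
      show ?thesis
      proof (rule integrable_matrixI)
        fix i j
        have "integrable M (\<lambda>\<omega>. real k * (outer (\<theta>err k \<omega>) (\<theta>err k \<omega>) $ i $ j))"
          using L.scaled_error_square_integrable[of k i j]
          by (simp add: entry cong: Bochner_Integration.integrable_cong)
        then show "integrable M (\<lambda>\<omega>. outer (\<theta>err k \<omega>) (\<theta>err k \<omega>) $ i $ j)" using False by simp
      qed
    qed
    then show "\<forall>k. integrable M (\<lambda>\<omega>. outer (\<theta>err k \<omega>) (\<theta>err k \<omega>))" by blast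
    have "(\<lambda>k. real k *\<^sub>R (\<integral>\<omega>. outer (\<theta>err k \<omega>) (\<theta>err k \<omega>) \<partial>M)) \<longlonglongrightarrow> \<delta>d\<^sup>2 *\<^sub>R S"
    proof (rule tendsto_matrixI)
      fix i j
      have "(real k *\<^sub>R (\<integral>\<omega>. outer (\<theta>err k \<omega>) (\<theta>err k \<omega>) \<partial>M)) $ i $ j =
          expectation (\<lambda>\<omega>. L.scaled_error k \<omega> $ i * L.scaled_error k \<omega> $ j)" for k
        by (simp add: integral_entry(2)[OF int] entry cong: Bochner_Integration.integral_cong)
      then show "(\<lambda>k. (real k *\<^sub>R (\<integral>\<omega>. outer (\<theta>err k \<omega>) (\<theta>err k \<omega>) \<partial>M)) $ i $ j) \<longlonglongrightarrow> (\<delta>d\<^sup>2 *\<^sub>R S) $ i $ j"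
        using L.scaled_error_covariance[OF rate rate, of i j] \<gamma>4 by simp
    qed
    from tendsto_diff[OF this cr]
    show "(\<lambda>k. real k *\<^sub>R ((\<integral>\<omega>. outer (\<theta>err k \<omega>) (\<theta>err k \<omega>) \<partial>M) - sigma_CR M \<phi> \<delta>d k)) \<longlonglongrightarrow> 0"
      by (simp add: scaleR_diff_right S_def)
  qed
qed

end
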